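(* Let $A$ and $B$ be separable Frobenius algebras over $k$, and let $\Gamma_A:A\to A\otimes A$ and $\Gamma_B:B\to B\otimes B$ be the right inverses of the respective multiplications (as in the definition of separability). Let $\tau:B\otimes A\rightarrow A\otimes B$ be a twisting map such that $$(\Delta_A\otimes\Delta_B)\,\tau=(1\otimes\tau\otimes 1)(\tau\otimes\tau)(1\otimes\tau\otimes 1)(\Delta_B\otimes\Delta_A).$$ Then $(A\otimes_{\tau} B,\nabla_{A\otimes_{\tau} B},\eta_{A\otimes_{\tau} B},\Delta_{A\otimes_{\tau} B},\epsilon_{A\otimes_{\tau} B})$ is a separable Frobenius algebra if and only if $$(\Gamma_A\otimes 1)\,\tau=(1\otimes\tau)(\tau\otimes 1)(1\otimes\Gamma_A)\quad\text{and}\quad (1\otimes\Gamma_B)\,\tau=(\tau\otimes 1)(1\otimes\tau)(\Gamma_B\otimes 1).$$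
   Context: $k$ is a field, $\otimes=\otimes_k$, and $1$ denotes identity maps. A Frobenius algebra over $k$ is a tuple $(A,\nabla,\eta,\Delta,\epsilon)$ with $(A,\nabla,\eta)$ an associative unital $k$-algebra, $(A,\Delta,\epsilon)$ a coassociative counital $k$-coalgebra, and $\Delta\nabla=(1\otimes\nabla)(\Delta\otimes 1)=(\nabla\otimes 1)(1\otimes\Delta)$. A $k$-algebra $(A,\nabla,\eta)$ is separable when the $A$-bimodule morphism $\nabla:A\otimes A\to A$ has a right inverse which is an $A$-bimodule morphism, i.e. there is a $k$-linear map $\Gamma:A\to A\otimes A$ with $\nabla\Gamma=1$ and $\Gamma\nabla(1\otimes\nabla)=(\nabla\otimes\nabla)(1\otimes\Gamma\otimes 1)$. A separable Frobenius algebra is a Frobenius algebra whose underlying algebra is separable. A twisting map for algebras $A$, $B$ is a bijective $k$-linear map $\tau:B\otimes A\to A\otimes B$ such that $\tau(b\otimes 1_A)=1_A\otimes b$ and $\tau(1_B\otimes a)=a\otimes 1_B$ for all $a\in A$, $b\in B$, and $\tau(\nabla_B\otimes\nabla_A)=(\nabla_A\otimes\nabla_B)(1\otimes\tau\otimes 1)(\tau\otimes\tau)(1\otimes\tau\otimes 1)$. The twisted tensor product $A\otimes_\tau B$ is the vector space $A\otimes B$ with $\nabla_{A\otimes_\tau B}=(\nabla_A\otimes\nabla_B)(1\otimes\tau\otimes 1)$, $\eta_{A\otimes_\tau B}=\eta_A\otimes\eta_B$, $\Delta_{A\otimes_\tau B}=(1\otimes\tau^{-1}\otimes 1)(\Delta_A\otimes\Delta_B)$,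 $\epsilon_{A\otimes_\tau B}=\epsilon_A\otimes\epsilon_B$ (using $k\otimes k\cong k$).
   Formalization: "Is a separable Frobenius algebra" is taken to require also that (1⊗τ⁻¹⊗1)(Γ_A⊗Γ_B) be the right inverse of the multiplication as in the definition of separability; with mere existence of some right inverse the "only if" part is false, e.g. for M_2(k) twisted with k[Z/2]. *)

theory Defs
  imports "HOL-Algebra.Module" "HOL-Algebra.Free_Abelian_Groups"
begin

section \<open>Linear maps and tensor products of vector spaces\<close>

text \<open>
  Vector spaces over a field \<open>k\<close> are the modules over \<open>k\<close> of HOL-Algebra (locale
  \<^locale>\<open>module\<close>). The \<open>mult\<close> and \<open>one\<close> fields which the record type
  inherits from rings are irrelevant for a vector space; they hold the product and the unit of
  an algebra. Maps between spaces matter only on the carrier of their domain, so equality of maps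
  is always stated pointwise on that carrier.
\<close>

definition linear_map ::
    "('k, 'r) ring_scheme \<Rightarrow> ('k, 'a, 'v) module_scheme \<Rightarrow> ('k, 'b, 'w) module_scheme
      \<Rightarrow> ('a \<Rightarrow> 'b) \<Rightarrow> bool" where
  "linear_map k V W f \<longleftrightarrow>
     f \<in> carrier V \<rightarrow> carrier W \<and>
     (\<forall>x\<in>carrier V. \<forall>y\<in>carrier V. f (x \<oplus>\<^bsub>V\<^esub> y) = f x \<oplus>\<^bsub>W\<^esub> f y) \<and>
     (\<forall>r\<in>carrier k. \<forall>x\<in>carrier V. f (r \<odot>\<^bsub>V\<^esub> x) = r \<odot>\<^bsub>W\<^esub> f x)"

definition linear_functional ::
    "('k, 'r) ring_scheme \<Rightarrow> ('k, 'a, 'v) module_scheme \<Rightarrow> ('a \<Rightarrow> 'k) \<Rightarrow> bool" where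
  "linear_functional k V f \<longleftrightarrow>
     f \<in> carrier V \<rightarrow> carrier k \<and>
     (\<forall>x\<in>carrier V. \<forall>y\<in>carrier V. f (x \<oplus>\<^bsub>V\<^esub> y) = f x \<oplus>\<^bsub>k\<^esub> f y) \<and>
     (\<forall>r\<in>carrier k. \<forall>x\<in>carrier V. f (r \<odot>\<^bsub>V\<^esub> x) = r \<otimes>\<^bsub>k\<^esub> f x)"

text \<open>
  \<open>V \<otimes> W\<close> is the free abelian group on the set \<open>V \<times> W\<close> modulo the subgroup generated by the
  biadditivity and balancing relations; its elements are cosets.
\<close>

type_synonym ('a, 'b) tens = "(('a \<times> 'b) \<Rightarrow>\<^sub>0 int) set"

definition tensor_relations ::
    "('k, 'r) ring_scheme \<Rightarrow> ('k, 'a, 'v) module_scheme \<Rightarrow> ('k, 'b, 'w) module_scheme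
      \<Rightarrow> (('a \<times> 'b) \<Rightarrow>\<^sub>0 int) set" where
  "tensor_relations k V W =
     {frag_of (v \<oplus>\<^bsub>V\<^esub> v', w) - frag_of (v, w) - frag_of (v', w) | v v' w.
        v \<in> carrier V \<and> v' \<in> carrier V \<and> w \<in> carrier W} \<union>
     {frag_of (v, w \<oplus>\<^bsub>W\<^esub> w') - frag_of (v, w) - frag_of (v, w') | v w w'.
        v \<in> carrier V \<and> w \<in> carrier W \<and> w' \<in> carrier W} \<union>
     {frag_of (r \<odot>\<^bsub>V\<^esub> v, w) - frag_of (v, r \<odot>\<^bsub>W\<^esub> w) | r v w.
        r \<in> carrier k \<and> v \<in> carrier V \<and> w \<in> carrier W}"

definition tensor_class ::
    "('k, 'r) ring_scheme \<Rightarrow> ('k, 'a, 'v) module_scheme \<Rightarrow> ('k, 'b, 'w) module_scheme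
      \<Rightarrow> (('a \<times> 'b) \<Rightarrow>\<^sub>0 int) \<Rightarrow> ('a, 'b) tens" where
  "tensor_class k V W x =
     (let F = free_Abelian_group (carrier V \<times> carrier W)
      in generate F (tensor_relations k V W) #>\<^bsub>F\<^esub> x)"

definition pure_tensor ::
    "('k, 'r) ring_scheme \<Rightarrow> ('k, 'a, 'v) module_scheme \<Rightarrow> ('k, 'b, 'w) module_scheme
      \<Rightarrow> 'a \<Rightarrow> 'b \<Rightarrow> ('a, 'b) tens" where
  "pure_tensor k V W v w = tensor_class k V W (frag_of (v, w))"

text \<open>
  Scalars act by \<open>r \<odot> (v \<otimes> w) = (r \<odot> v) \<otimes> w\<close>. As in HOL-Algebra's homomorphism theorem, a map
  that is constant on the coset \<open>Y\<close> is evaluated on \<open>Y\<close> by taking the unique element of its image.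
\<close>

definition tensor ::
    "('k, 'r) ring_scheme \<Rightarrow> ('k, 'a, 'v) module_scheme \<Rightarrow> ('k, 'b, 'w) module_scheme
      \<Rightarrow> ('k, ('a, 'b) tens) module" where
  "tensor k V W =
     (let F = free_Abelian_group (carrier V \<times> carrier W);
          Q = F Mod generate F (tensor_relations k V W)
      in \<lparr>carrier = carrier Q, monoid.mult = undefined, monoid.one = undefined,
          ring.zero = \<one>\<^bsub>Q\<^esub>, ring.add = (\<lambda>x y. x \<otimes>\<^bsub>Q\<^esub> y),
          smult = (\<lambda>r Y. the_elem
            ((\<lambda>x. tensor_class k V W (frag_extend (\<lambda>(v, w). frag_of (r \<odot>\<^bsub>V\<^esub> v, w)) x)) ` Y))\<rparr>)"

text \<open>
  The map \<open>V \<otimes> W \<rightarrow> P\<close> induced by a bilinear map \<open>\<phi>\<close>, sending \<open>\<Sum>\<^sub>i v\<^sub>i \<otimes> w\<^sub>i\<close> to \<open>\<Sum>\<^sub>i \<phi> v\<^sub>i w\<^sub>i\<close>.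
\<close>

definition tensor_lift ::
    "('p, 's) ring_scheme \<Rightarrow> ('a \<Rightarrow> 'b \<Rightarrow> 'p) \<Rightarrow> ('a, 'b) tens \<Rightarrow> 'p" where
  "tensor_lift P \<phi> Y =
     the_elem ((\<lambda>x. \<Oplus>\<^bsub>P\<^esub>p\<in>Poly_Mapping.keys x. [Poly_Mapping.lookup x p] \<cdot>\<^bsub>P\<^esub> \<phi> (fst p) (snd p)) ` Y)"

text \<open>\<open>f \<otimes> g\<close>, where \<open>V\<close> and \<open>W\<close> are the codomains of \<open>f\<close> and \<open>g\<close>.\<close>

definition tensor_map ::
    "('k, 'r) ring_scheme \<Rightarrow> ('k, 'a, 'v) module_scheme \<Rightarrow> ('k, 'b, 'w) module_scheme
      \<Rightarrow> ('c \<Rightarrow> 'a) \<Rightarrow> ('d \<Rightarrow> 'b) \<Rightarrow> ('c, 'd) tens \<Rightarrow> ('a, 'b) tens" where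
  "tensor_map k V W f g = tensor_lift (tensor k V W) (\<lambda>x y. pure_tensor k V W (f x) (g y))"

text \<open>\<open>(U \<otimes> V) \<otimes> W \<rightarrow> U \<otimes> (V \<otimes> W)\<close> and its inverse.\<close>

definition tensor_assoc ::
    "('k, 'r) ring_scheme \<Rightarrow> ('k, 'a, 'u) module_scheme \<Rightarrow> ('k, 'b, 'v) module_scheme
      \<Rightarrow> ('k, 'c, 'w) module_scheme \<Rightarrow> (('a, 'b) tens, 'c) tens \<Rightarrow> ('a, ('b, 'c) tens) tens" where
  "tensor_assoc k U V W =
     tensor_lift (tensor k U (tensor k V W))
       (\<lambda>x w. tensor_lift (tensor k U (tensor k V W))
          (\<lambda>u v. pure_tensor k U (tensor k V W) u (pure_tensor k V W v w)) x)"

definition tensor_unassoc ::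
    "('k, 'r) ring_scheme \<Rightarrow> ('k, 'a, 'u) module_scheme \<Rightarrow> ('k, 'b, 'v) module_scheme
      \<Rightarrow> ('k, 'c, 'w) module_scheme \<Rightarrow> ('a, ('b, 'c) tens) tens \<Rightarrow> (('a, 'b) tens, 'c) tens" where
  "tensor_unassoc k U V W =
     tensor_lift (tensor k (tensor k U V) W)
       (\<lambda>u y. tensor_lift (tensor k (tensor k U V) W)
          (\<lambda>v w. pure_tensor k (tensor k U V) W (pure_tensor k U V u v) w) y)"

text \<open>
  \<open>1 \<otimes> f \<otimes> 1\<close> for \<open>f : V \<otimes> W \<rightarrow> W \<otimes> V\<close>, as a map
  \<open>(U \<otimes> V) \<otimes> (W \<otimes> Y) \<rightarrow> (U \<otimes> W) \<otimes> (V \<otimes> Y)\<close>.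
\<close>

definition tensor_middle ::
    "('k, 'r) ring_scheme \<Rightarrow> ('k, 'a, 'u) module_scheme \<Rightarrow> ('k, 'b, 'v) module_scheme
      \<Rightarrow> ('k, 'c, 'w) module_scheme \<Rightarrow> ('k, 'd, 'x) module_scheme
      \<Rightarrow> (('b, 'c) tens \<Rightarrow> ('c, 'b) tens)
      \<Rightarrow> (('a, 'b) tens, ('c, 'd) tens) tens \<Rightarrow> (('a, 'c) tens, ('b, 'd) tens) tens" where
  "tensor_middle k U V W Y f =
     tensor_unassoc k U W (tensor k V Y) \<circ>
     tensor_map k U (tensor k W (tensor k V Y)) id
       (tensor_assoc k W V Y \<circ>
        tensor_map k (tensor k W V) Y f id \<circ>
        tensor_unassoc k V W Y) \<circ>
     tensor_assoc k U V (tensor k W Y)"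


section \<open>Separable Frobenius algebras\<close>

record ('k, 'a) frobenius = "('k, 'a) module" +
  comult :: "'a \<Rightarrow> ('a, 'a) tens"
  counit :: "'a \<Rightarrow> 'k"

definition nabla :: "('k, 'a, 'm) module_scheme \<Rightarrow> ('a, 'a) tens \<Rightarrow> 'a" where
  "nabla A = tensor_lift A (\<lambda>x y. x \<otimes>\<^bsub>A\<^esub> y)"

text \<open>The locale \<^locale>\<open>algebra\<close> of HOL-Algebra is for commutative algebras only.\<close>

definition unital_algebra :: "('k, 'r) ring_scheme \<Rightarrow> ('k, 'a, 'm) module_scheme \<Rightarrow> bool" where
  "unital_algebra k A \<longleftrightarrow>
     module k A \<and> ring A \<and>
     (\<forall>r\<in>carrier k. \<forall>x\<in>carrier A. \<forall>y\<in>carrier A.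
        (r \<odot>\<^bsub>A\<^esub> x) \<otimes>\<^bsub>A\<^esub> y = r \<odot>\<^bsub>A\<^esub> (x \<otimes>\<^bsub>A\<^esub> y) \<and>
        x \<otimes>\<^bsub>A\<^esub> (r \<odot>\<^bsub>A\<^esub> y) = r \<odot>\<^bsub>A\<^esub> (x \<otimes>\<^bsub>A\<^esub> y))"

text \<open>
  In the counit laws, \<open>k \<otimes> A\<close> and \<open>A \<otimes> k\<close> are identified with \<open>A\<close>: the lifts below are
  \<open>\<epsilon> \<otimes> 1\<close> and \<open>1 \<otimes> \<epsilon>\<close> followed by these identifications.
\<close>

definition counital_coalgebra ::
    "('k, 'r) ring_scheme \<Rightarrow> ('k, 'a, 'm) frobenius_scheme \<Rightarrow> bool" where
  "counital_coalgebra k A \<longleftrightarrow>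
     module k A \<and>
     linear_map k A (tensor k A A) (comult A) \<and>
     linear_functional k A (counit A) \<and>
     (\<forall>a\<in>carrier A.
        tensor_assoc k A A A (tensor_map k (tensor k A A) A (comult A) id (comult A a)) =
        tensor_map k A (tensor k A A) id (comult A) (comult A a)) \<and>
     (\<forall>a\<in>carrier A. tensor_lift A (\<lambda>x y. counit A x \<odot>\<^bsub>A\<^esub> y) (comult A a) = a) \<and>
     (\<forall>a\<in>carrier A. tensor_lift A (\<lambda>x y. counit A y \<odot>\<^bsub>A\<^esub> x) (comult A a) = a)"

definition frobenius_algebra ::
    "('k, 'r) ring_scheme \<Rightarrow> ('k, 'a, 'm) frobenius_scheme \<Rightarrow> bool" where
  "frobenius_algebra k A \<longleftrightarrow>
     unital_algebra k A \<and> counital_coalgebra k A \<and>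
     (\<forall>t\<in>carrier (tensor k A A).
        comult A (nabla A t) =
          tensor_map k A A id (nabla A)
            (tensor_assoc k A A A (tensor_map k (tensor k A A) A (comult A) id t)) \<and>
        comult A (nabla A t) =
          tensor_map k A A (nabla A) id
            (tensor_unassoc k A A A (tensor_map k A (tensor k A A) id (comult A) t)))"

text \<open>\<open>\<Gamma>\<close> is a right inverse of \<open>\<nabla>\<close> as a morphism of bimodules.\<close>

definition separability_section ::
    "('k, 'r) ring_scheme \<Rightarrow> ('k, 'a, 'm) module_scheme \<Rightarrow> ('a \<Rightarrow> ('a, 'a) tens) \<Rightarrow> bool" where
  "separability_section k A \<Gamma> \<longleftrightarrow>
     linear_map k A (tensor k A A) \<Gamma> \<and>
     (\<forall>a\<in>carrier A. nabla A (\<Gamma> a) = a) \<and>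
     (\<forall>t\<in>carrier (tensor k A (tensor k A A)).
        \<Gamma> (nabla A (tensor_map k A A id (nabla A) t)) =
        tensor_map k A A (nabla A) (nabla A)
          (tensor_unassoc k A A (tensor k A A)
            (tensor_map k A (tensor k A (tensor k A A)) id
              (tensor_assoc k A A A \<circ> tensor_map k (tensor k A A) A \<Gamma> id) t)))"

definition separable_algebra :: "('k, 'r) ring_scheme \<Rightarrow> ('k, 'a, 'm) module_scheme \<Rightarrow> bool" where
  "separable_algebra k A \<longleftrightarrow> unital_algebra k A \<and> (\<exists>\<Gamma>. separability_section k A \<Gamma>)"

definition separable_frobenius_algebra ::
    "('k, 'r) ring_scheme \<Rightarrow> ('k, 'a, 'm) frobenius_scheme \<Rightarrow> bool" where
  "separable_frobenius_algebra k A \<longleftrightarrow> frobenius_algebra k A \<and> separable_algebra k A"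


section \<open>Twisting maps and twisted tensor products\<close>

text \<open>\<open>(1 \<otimes> \<tau> \<otimes> 1)(\<tau> \<otimes> \<tau>)(1 \<otimes> \<tau> \<otimes> 1) : (B \<otimes> B) \<otimes> (A \<otimes> A) \<rightarrow> (A \<otimes> A) \<otimes> (B \<otimes> B)\<close>\<close>

definition twist_square ::
    "('k, 'r) ring_scheme \<Rightarrow> ('k, 'a, 'm) module_scheme \<Rightarrow> ('k, 'b, 'n) module_scheme
      \<Rightarrow> (('b, 'a) tens \<Rightarrow> ('a, 'b) tens)
      \<Rightarrow> (('b, 'b) tens, ('a, 'a) tens) tens \<Rightarrow> (('a, 'a) tens, ('b, 'b) tens) tens" where
  "twist_square k A B \<tau> =
     tensor_middle k A B A B \<tau> \<circ>
     tensor_map k (tensor k A B) (tensor k A B) \<tau> \<tau> \<circ>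
     tensor_middle k B B A A \<tau>"

definition twisting_map ::
    "('k, 'r) ring_scheme \<Rightarrow> ('k, 'a, 'm) module_scheme \<Rightarrow> ('k, 'b, 'n) module_scheme
      \<Rightarrow> (('b, 'a) tens \<Rightarrow> ('a, 'b) tens) \<Rightarrow> bool" where
  "twisting_map k A B \<tau> \<longleftrightarrow>
     linear_map k (tensor k B A) (tensor k A B) \<tau> \<and>
     bij_betw \<tau> (carrier (tensor k B A)) (carrier (tensor k A B)) \<and>
     (\<forall>b\<in>carrier B. \<tau> (pure_tensor k B A b \<one>\<^bsub>A\<^esub>) = pure_tensor k A B \<one>\<^bsub>A\<^esub> b) \<and>
     (\<forall>a\<in>carrier A. \<tau> (pure_tensor k B A \<one>\<^bsub>B\<^esub> a) = pure_tensor k A B a \<one>\<^bsub>B\<^esub>) \<and>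
     (\<forall>t\<in>carrier (tensor k (tensor k B B) (tensor k A A)).
        \<tau> (tensor_map k B A (nabla B) (nabla A) t) =
        tensor_map k A B (nabla A) (nabla B) (twist_square k A B \<tau> t))"

definition twist_inverse ::
    "('k, 'r) ring_scheme \<Rightarrow> ('k, 'a, 'm) module_scheme \<Rightarrow> ('k, 'b, 'n) module_scheme
      \<Rightarrow> (('b, 'a) tens \<Rightarrow> ('a, 'b) tens) \<Rightarrow> ('a, 'b) tens \<Rightarrow> ('b, 'a) tens" where
  "twist_inverse k A B \<tau> = inv_into (carrier (tensor k B A)) \<tau>"

text \<open>\<open>(1 \<otimes> \<tau>\<^sup>-\<^sup>1 \<otimes> 1)(f \<otimes> g)\<close> for \<open>f : A \<rightarrow> A \<otimes> A\<close> and \<open>g : B \<rightarrow> B \<otimes> B\<close>\<close>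

definition twisted_cotensor ::
    "('k, 'r) ring_scheme \<Rightarrow> ('k, 'a, 'm) module_scheme \<Rightarrow> ('k, 'b, 'n) module_scheme
      \<Rightarrow> (('b, 'a) tens \<Rightarrow> ('a, 'b) tens)
      \<Rightarrow> ('a \<Rightarrow> ('a, 'a) tens) \<Rightarrow> ('b \<Rightarrow> ('b, 'b) tens)
      \<Rightarrow> ('a, 'b) tens \<Rightarrow> (('a, 'b) tens, ('a, 'b) tens) tens" where
  "twisted_cotensor k A B \<tau> f g =
     tensor_middle k A A B B (twist_inverse k A B \<tau>) \<circ>
     tensor_map k (tensor k A A) (tensor k B B) f g"

definition twisted_tensor_product ::
    "('k, 'r) ring_scheme \<Rightarrow> ('k, 'a, 'm) frobenius_scheme \<Rightarrow> ('k, 'b, 'n) frobenius_scheme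
      \<Rightarrow> (('b, 'a) tens \<Rightarrow> ('a, 'b) tens) \<Rightarrow> ('k, ('a, 'b) tens) frobenius" where
  "twisted_tensor_product k A B \<tau> =
     \<lparr>carrier = carrier (tensor k A B),
      monoid.mult = (\<lambda>x y. tensor_map k A B (nabla A) (nabla B)
        (tensor_middle k A B A B \<tau> (pure_tensor k (tensor k A B) (tensor k A B) x y))),
      monoid.one = pure_tensor k A B \<one>\<^bsub>A\<^esub> \<one>\<^bsub>B\<^esub>,
      ring.zero = \<zero>\<^bsub>tensor k A B\<^esub>,
      ring.add = ring.add (tensor k A B),
      smult = smult (tensor k A B),
      comult = twisted_cotensor k A B \<tau> (comult A) (comult B),
      counit = tensor_lift k (\<lambda>a b. counit A a \<otimes>\<^bsub>k\<^esub> counit B b)\<rparr>"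

text \<open>
  The separability structure of the twisted tensor product formed, like its comultiplication, from
  those of the factors. Bimodule sections of a multiplication are not unique, and compatibility of
  \<open>\<tau>\<close> with the given \<open>\<Gamma>A\<close> and \<open>\<Gamma>B\<close> characterises separability with this section: the bare
  existence of some section of the product does not imply it.
\<close>

definition twisted_section ::
    "('k, 'r) ring_scheme \<Rightarrow> ('k, 'a, 'm) module_scheme \<Rightarrow> ('k, 'b, 'n) module_scheme
      \<Rightarrow> (('b, 'a) tens \<Rightarrow> ('a, 'b) tens)
      \<Rightarrow> ('a \<Rightarrow> ('a, 'a) tens) \<Rightarrow> ('b \<Rightarrow> ('b, 'b) tens)
      \<Rightarrow> ('a, 'b) tens \<Rightarrow> (('a, 'b) tens, ('a, 'b) tens) tens" where
  "twisted_section k A B \<tau> \<Gamma>A \<Gamma>B = twisted_cotensor k A B \<tau> \<Gamma>A \<Gamma>B"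

end

theory Submission
  imports Defs
begin

text \<open>
  Write \<open>C\<close> for the twisted tensor product. A comultiplication satisfying the Frobenius identities,
  and likewise a bimodule section, is the same as a central element \<open>e\<close> of the tensor square:
  \<open>f c = c e = e c\<close>. If \<open>f\<^sub>A\<close> and \<open>f\<^sub>B\<close> are such maps, with elements \<open>\<Sum> x \<otimes> y\<close> and
  \<open>\<Sum> u \<otimes> v\<close>, then \<open>f\<^sub>C = (1 \<otimes> \<tau>\<^sup>-\<^sup>1 \<otimes> 1)(f\<^sub>A \<otimes> f\<^sub>B)\<close> satisfies \<open>f\<^sub>C (a b) = a e b\<close>, where \<open>e\<close> is
  \<open>\<Sum> x \<otimes> y u \<otimes> v\<close> with \<open>y u\<close> rewritten as an element of \<open>B \<otimes> A\<close>. If moreover \<open>f\<^sub>A \<otimes> f\<^sub>B\<close>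
  is compatible with the square of \<open>\<tau>\<close>, then also \<open>f\<^sub>C (b a) = b e' a\<close>; comparing at \<open>a = 1\<close> and
  \<open>b = 1\<close> shows that \<open>e = e'\<close> is central. With \<open>f = \<Delta>\<close> this makes \<open>C\<close> a Frobenius algebra.

  The two conditions on \<open>\<Gamma>\<^sub>A\<close> and \<open>\<Gamma>\<^sub>B\<close> together give the compatibility with the square, so the
  same argument makes \<open>\<Gamma>\<^sub>C\<close> a bimodule map. Conversely, the projection
  \<open>C \<otimes> C \<rightarrow> C \<otimes>\<^sub>B C \<cong> A \<otimes> C\<close> maps \<open>\<Gamma>\<^sub>C (a b)\<close> to \<open>\<Gamma>\<^sub>A a \<otimes> b\<close>, since \<open>\<nabla>\<^sub>B \<Gamma>\<^sub>B = 1\<close>. Applying it to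
  \<open>\<Gamma>\<^sub>C (b a) = b \<Gamma>\<^sub>C a\<close> gives the condition on \<open>\<Gamma>\<^sub>A\<close>, and the projection to \<open>C \<otimes>\<^sub>A C\<close> gives
  the one on \<open>\<Gamma>\<^sub>B\<close>.
\<close>

section \<open>Tensor products as modules\<close>

text \<open>The elementwise formulas hide an obstacle: \<open>\<tau> (b \<otimes> a)\<close> and
  \<open>\<Gamma>A a\<close> are tensors, in general not pure, and their components cannot be named
  inside a formula. A nested expression is therefore read as a linear function of such a value; the
  value is replaced by an arbitrary tensor \<open>s\<close>, the identity is checked for pure
  \<open>s\<close>, and linearity carries it back. Hence the many statements quantified over a
  tensor product and the many rules on linearity of composites.

  Three steps rest on further observations. Coassociativity holds for every bimodule map into the
  tensor square, by centrality of its value at the unit. The counit laws reduce to the unit of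
  \<open>C\<close>, where one input of the inverse of \<open>\<tau>\<close> has been contracted to
  \<open>1\<close>, so that the inverse becomes trivial. And the square of \<open>\<tau>\<close> on
  \<open>\<Gamma>B b \<otimes> \<Gamma>A a\<close> lets the two components from \<open>B\<close>
  cross \<open>\<Gamma>A a\<close> one after the other; each crossing is pushed in front of
  \<open>\<Gamma>A\<close> by the condition on \<open>\<Gamma>A\<close>, and then the condition on
  \<open>\<Gamma>B\<close> finishes.\<close>

lemma keys_frag_diff:
  fixes x y :: "'a \<Rightarrow>\<^sub>0 int"
  assumes "Poly_Mapping.keys x \<subseteq> S" "Poly_Mapping.keys y \<subseteq> S"
  shows "Poly_Mapping.keys (x - y) \<subseteq> S"
  using keys_diff[of x y] assms by blast

lemma keys_frag_add:
  fixes x y :: "'a \<Rightarrow>\<^sub>0 int"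
  assumes "Poly_Mapping.keys x \<subseteq> S" "Poly_Mapping.keys y \<subseteq> S"
  shows "Poly_Mapping.keys (x + y) \<subseteq> S"
  using keys_add[of x y] assms by blast

section \<open>Values of a lift on representatives in the free abelian group\<close>

definition tensor_kernel ::
    "('k, 'r) ring_scheme \<Rightarrow> ('k, 'a, 'v) module_scheme \<Rightarrow> ('k, 'b, 'w) module_scheme
      \<Rightarrow> (('a \<times> 'b) \<Rightarrow>\<^sub>0 int) set" where
  "tensor_kernel k V W =
     generate (free_Abelian_group (carrier V \<times> carrier W)) (tensor_relations k V W)"

text \<open>This is the expression inside \<open>tensor_lift\<close> before the passage to cosets.
  Kept separate, it can be shown additive on representatives first; independence of the
  representative then only needs that relations are sent to zero.\<close>

definition frag_lift ::
    "('p, 's) ring_scheme \<Rightarrow> ('a \<Rightarrow> 'b \<Rightarrow> 'p) \<Rightarrow> (('a \<times> 'b) \<Rightarrow>\<^sub>0 int) \<Rightarrow> 'p" where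
  "frag_lift P \<phi> x =
     (\<Oplus>\<^bsub>P\<^esub>p\<in>Poly_Mapping.keys x. [Poly_Mapping.lookup x p] \<cdot>\<^bsub>P\<^esub> \<phi> (fst p) (snd p))"

context
  fixes P :: "('p, 's) ring_scheme" and S :: "'a set" and T :: "'b set"
    and \<phi> :: "'a \<Rightarrow> 'b \<Rightarrow> 'p"
  assumes P: "abelian_group P"
    and \<phi>: "\<And>v w. v \<in> S \<Longrightarrow> w \<in> T \<Longrightarrow> \<phi> v w \<in> carrier P"
begin

interpretation P: abelian_group P by (rule P)

text \<open>Coefficients can cancel in a sum, so \<open>x\<close>, \<open>y\<close> and
  \<open>x + y\<close> may have different supports. A larger finite index set adds only terms with
  coefficient \<open>0\<close>, and over a common set addition is termwise.\<close>

lemma frag_lift_superset: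
  assumes "Poly_Mapping.keys x \<subseteq> K" "finite K" "K \<subseteq> S \<times> T"
  shows "frag_lift P \<phi> x = (\<Oplus>\<^bsub>P\<^esub>p\<in>K. [Poly_Mapping.lookup x p] \<cdot>\<^bsub>P\<^esub> \<phi> (fst p) (snd p))"
  unfolding frag_lift_def
proof (rule P.add.finprod_mono_neutral_cong_left)
  show "\<And>i. i \<in> K - Poly_Mapping.keys x \<Longrightarrow>
      [Poly_Mapping.lookup x i] \<cdot>\<^bsub>P\<^esub> \<phi> (fst i) (snd i) = \<zero>\<^bsub>P\<^esub>"
    by (auto simp: in_keys_iff add_pow_def)
  show "(\<lambda>p. [Poly_Mapping.lookup x p] \<cdot>\<^bsub>P\<^esub> \<phi> (fst p) (snd p)) \<in> K \<rightarrow> carrier P"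
    using assms \<phi> by fastforce
qed (use assms in auto)

lemma frag_lift_closed:
  assumes "Poly_Mapping.keys x \<subseteq> S \<times> T"
  shows "frag_lift P \<phi> x \<in> carrier P"
  unfolding frag_lift_def using assms \<phi> by (intro P.finsum_closed) fastforce

lemma frag_lift_add:
  assumes "Poly_Mapping.keys x \<subseteq> S \<times> T" "Poly_Mapping.keys y \<subseteq> S \<times> T"
  shows "frag_lift P \<phi> (x + y) = frag_lift P \<phi> x \<oplus>\<^bsub>P\<^esub> frag_lift P \<phi> y"
proof -
  let ?K = "Poly_Mapping.keys x \<union> Poly_Mapping.keys y"
  have K: "finite ?K" "?K \<subseteq> S \<times> T"
    using assms by auto
  have c: "\<phi> (fst p) (snd p) \<in> carrier P" if "p \<in> ?K" for p
    using that K \<phi> by auto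
  have "frag_lift P \<phi> (x + y) =
      (\<Oplus>\<^bsub>P\<^esub>p\<in>?K. [Poly_Mapping.lookup (x + y) p] \<cdot>\<^bsub>P\<^esub> \<phi> (fst p) (snd p))"
    by (rule frag_lift_superset) (use K keys_add[of x y] in auto)
  also have "\<dots> = (\<Oplus>\<^bsub>P\<^esub>p\<in>?K. [Poly_Mapping.lookup x p] \<cdot>\<^bsub>P\<^esub> \<phi> (fst p) (snd p) \<oplus>\<^bsub>P\<^esub>
      [Poly_Mapping.lookup y p] \<cdot>\<^bsub>P\<^esub> \<phi> (fst p) (snd p))"
    by (rule P.finsum_cong') (use c in \<open>auto simp: lookup_add P.add.int_pow_mult\<close>)
  also have "\<dots> = (\<Oplus>\<^bsub>P\<^esub>p\<in>?K. [Poly_Mapping.lookup x p] \<cdot>\<^bsub>P\<^esub> \<phi> (fst p) (snd p)) \<oplus>\<^bsub>P\<^esub>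
      (\<Oplus>\<^bsub>P\<^esub>p\<in>?K. [Poly_Mapping.lookup y p] \<cdot>\<^bsub>P\<^esub> \<phi> (fst p) (snd p))"
    by (rule P.finsum_addf) (use c in auto)
  also have "\<dots> = frag_lift P \<phi> x \<oplus>\<^bsub>P\<^esub> frag_lift P \<phi> y"
    using frag_lift_superset[of x ?K] frag_lift_superset[of y ?K] K by simp
  finally show ?thesis .
qed

lemma frag_lift_frag_of:
  assumes "v \<in> S" "w \<in> T"
  shows "frag_lift P \<phi> (frag_of (v, w)) = \<phi> v w"
  using \<phi>[OF assms] by (simp add: frag_lift_def P.add.finprod_singleton)

lemma frag_lift_zero: "frag_lift P \<phi> 0 = \<zero>\<^bsub>P\<^esub>"
  by (simp add: frag_lift_def)

lemma frag_lift_minus: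
  assumes "Poly_Mapping.keys x \<subseteq> S \<times> T"
  shows "frag_lift P \<phi> (- x) = \<ominus>\<^bsub>P\<^esub> frag_lift P \<phi> x"
proof -
  have "frag_lift P \<phi> (- x) \<oplus>\<^bsub>P\<^esub> frag_lift P \<phi> x = \<zero>\<^bsub>P\<^esub>"
    using frag_lift_add[of "- x" x] assms by (simp add: frag_lift_zero)
  then show ?thesis
    using assms by (intro P.minus_equality[symmetric] frag_lift_closed) auto
qed

lemma frag_lift_diff:
  assumes "Poly_Mapping.keys x \<subseteq> S \<times> T" "Poly_Mapping.keys y \<subseteq> S \<times> T"
  shows "frag_lift P \<phi> (x - y) = frag_lift P \<phi> x \<ominus>\<^bsub>P\<^esub> frag_lift P \<phi> y"
  using frag_lift_add[of x "- y"] frag_lift_minus[of y] assms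
  by (simp add: P.minus_eq)

end

text \<open>The target is an abelian group, which is what well-definedness on cosets calls for. This
  also covers the target \<open>k\<close>, a ring record with no scalar multiplication of its own,
  as occurs for the counit of the product.\<close>

definition balanced_map ::
    "('k, 'r) ring_scheme \<Rightarrow> ('k, 'a, 'v) module_scheme \<Rightarrow> ('k, 'b, 'w) module_scheme
      \<Rightarrow> ('p, 's) ring_scheme \<Rightarrow> ('a \<Rightarrow> 'b \<Rightarrow> 'p) \<Rightarrow> bool" where
  "balanced_map k V W P \<phi> \<longleftrightarrow> abelian_group P \<and>
     (\<forall>v\<in>carrier V. \<forall>w\<in>carrier W. \<phi> v w \<in> carrier P) \<and>
     (\<forall>v\<in>carrier V. \<forall>v'\<in>carrier V. \<forall>w\<in>carrier W. \<phi> (v \<oplus>\<^bsub>V\<^esub> v') w = \<phi> v w \<oplus>\<^bsub>P\<^esub> \<phi> v' w) \<and>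
     (\<forall>v\<in>carrier V. \<forall>w\<in>carrier W. \<forall>w'\<in>carrier W. \<phi> v (w \<oplus>\<^bsub>W\<^esub> w') = \<phi> v w \<oplus>\<^bsub>P\<^esub> \<phi> v w') \<and>
     (\<forall>r\<in>carrier k. \<forall>v\<in>carrier V. \<forall>w\<in>carrier W. \<phi> (r \<odot>\<^bsub>V\<^esub> v) w = \<phi> v (r \<odot>\<^bsub>W\<^esub> w))"

section \<open>The quotient by the relations as a module\<close>

context
  fixes k :: "('k, 'r) ring_scheme"
    and V :: "('k, 'a, 'v) module_scheme" and W :: "('k, 'b, 'w) module_scheme"
  assumes V: "module k V" and W: "module k W"
begin

interpretation V: module k V by (rule V)
interpretation W: module k W by (rule W)

private abbreviation "F \<equiv> free_Abelian_group (carrier V \<times> carrier W)"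
private abbreviation "N \<equiv> tensor_kernel k V W"
private abbreviation "cls \<equiv> tensor_class k V W"

interpretation F: comm_group F by (rule abelian_free_Abelian_group)

lemma tensor_relations_cases [consumes 1, case_names left right balanced]:
  assumes "x \<in> tensor_relations k V W"
  obtains v v' w where "x = frag_of (v \<oplus>\<^bsub>V\<^esub> v', w) - frag_of (v, w) - frag_of (v', w)"
      "v \<in> carrier V" "v' \<in> carrier V" "w \<in> carrier W"
  | v w w' where "x = frag_of (v, w \<oplus>\<^bsub>W\<^esub> w') - frag_of (v, w) - frag_of (v, w')"
      "v \<in> carrier V" "w \<in> carrier W" "w' \<in> carrier W"
  | r v w where "x = frag_of (r \<odot>\<^bsub>V\<^esub> v, w) - frag_of (v, r \<odot>\<^bsub>W\<^esub> w)"
      "r \<in> carrier k" "v \<in> carrier V" "w \<in> carrier W"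
  using assms unfolding tensor_relations_def by blast

lemma tensor_relations_leftI:
  "v \<in> carrier V \<Longrightarrow> v' \<in> carrier V \<Longrightarrow> w \<in> carrier W \<Longrightarrow>
    frag_of (v \<oplus>\<^bsub>V\<^esub> v', w) - frag_of (v, w) - frag_of (v', w) \<in> tensor_relations k V W"
  and tensor_relations_rightI:
  "v \<in> carrier V \<Longrightarrow> w \<in> carrier W \<Longrightarrow> w' \<in> carrier W \<Longrightarrow>
    frag_of (v, w \<oplus>\<^bsub>W\<^esub> w') - frag_of (v, w) - frag_of (v, w') \<in> tensor_relations k V W"
  and tensor_relations_balancedI:
  "r \<in> carrier k \<Longrightarrow> v \<in> carrier V \<Longrightarrow> w \<in> carrier W \<Longrightarrow>
    frag_of (r \<odot>\<^bsub>V\<^esub> v, w) - frag_of (v, r \<odot>\<^bsub>W\<^esub> w) \<in> tensor_relations k V W"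
  unfolding tensor_relations_def by blast+

lemma tensor_relations_subset: "tensor_relations k V W \<subseteq> carrier F"
proof
  fix x assume "x \<in> tensor_relations k V W"
  then show "x \<in> carrier F"
    by (cases rule: tensor_relations_cases) (simp_all add: keys_frag_diff)
qed

lemma subgroup_tensor_kernel: "subgroup N F"
  unfolding tensor_kernel_def by (rule F.generate_is_subgroup[OF tensor_relations_subset])

lemma normal_tensor_kernel: "N \<lhd> F"
  by (rule F.subgroup_imp_normal[OF subgroup_tensor_kernel])

lemma tensor_class_eq: "cls x = N #>\<^bsub>F\<^esub> x"
  by (simp add: tensor_class_def tensor_kernel_def Let_def)

lemma carrier_tensor: "carrier (tensor k V W) = cls ` carrier F"
  by (auto simp: tensor_def Let_def FactGroup_def RCOSETS_def tensor_class_eq tensor_kernel_def)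

lemma tensor_class_closed: "x \<in> carrier F \<Longrightarrow> cls x \<in> carrier (tensor k V W)"
  by (simp only: carrier_tensor imageI)

lemma add_tensor_class:
  assumes "x \<in> carrier F" "y \<in> carrier F"
  shows "cls x \<oplus>\<^bsub>tensor k V W\<^esub> cls y = cls (x + y)"
proof -
  have "cls x \<oplus>\<^bsub>tensor k V W\<^esub> cls y = cls x <#>\<^bsub>F\<^esub> cls y"
    by (simp add: tensor_def Let_def FactGroup_def)
  then show ?thesis
    using normal.rcos_sum[OF normal_tensor_kernel assms] by (simp add: tensor_class_eq)
qed

lemma zero_tensor: "\<zero>\<^bsub>tensor k V W\<^esub> = cls 0"
proof -
  have "cls 0 = N"
    using F.coset_mult_one[of N] subgroup.subset[OF subgroup_tensor_kernel]
    by (simp add: tensor_class_eq)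
  then show ?thesis
    by (simp add: tensor_def Let_def FactGroup_def tensor_kernel_def)
qed

lemma tensor_class_eqI:
  assumes "x \<in> carrier F" "y \<in> carrier F" "x - y \<in> N"
  shows "cls x = cls y"
proof -
  have "x \<in> N #>\<^bsub>F\<^esub> y"
    using assms(3) by (force simp: r_coset_def)
  then show ?thesis
    using F.repr_independence[OF _ assms(2) subgroup_tensor_kernel] by (simp add: tensor_class_eq)
qed

text \<open>The subgroup generated by a set inverts generators only, so the case
  \<open>minus\<close> concerns relations. The case \<open>add\<close> offers membership in the free
  group, which is what the additivity of \<open>frag_lift\<close> asks for.\<close>

lemma tensor_kernel_induct [consumes 1, case_names relation zero minus add]:
  assumes "x \<in> N"
    and "\<And>x. x \<in> tensor_relations k V W \<Longrightarrow> Q x"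
    and "Q 0"
    and "\<And>x. x \<in> tensor_relations k V W \<Longrightarrow> Q x \<Longrightarrow> Q (- x)"
    and "\<And>x y. x \<in> carrier F \<Longrightarrow> y \<in> carrier F \<Longrightarrow> Q x \<Longrightarrow> Q y \<Longrightarrow> Q (x + y)"
  shows "Q x"
  using assms(1) unfolding tensor_kernel_def
proof (induction rule: generate.induct)
  case (inv h)
  have "Poly_Mapping.keys h \<subseteq> carrier V \<times> carrier W"
    using subsetD[OF tensor_relations_subset inv] by simp
  then show ?case
    using assms(2,4)[OF inv] by simp
next
  case (eng h1 h2)
  then have "h1 \<in> carrier F" "h2 \<in> carrier F"
    using F.generate_in_carrier[OF tensor_relations_subset] by blast+
  then show ?case
    using assms(5)[of h1 h2] eng by simp
qed (use assms in auto)

lemma tensor_kernel_closed: "x \<in> N \<Longrightarrow> x \<in> carrier F"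
  using subgroup.subset[OF subgroup_tensor_kernel] by blast

text \<open>Evaluation on a coset by \<open>the_elem\<close> is meaningful when the image of the
  coset is a singleton, and invariance under translation by the kernel ensures this. Both
  \<open>tensor_lift\<close> and the scalar multiplication are defined in this way.\<close>

lemma rcoset_image_eq:
  assumes "x \<in> carrier F" "\<And>n. n \<in> N \<Longrightarrow> h (n + x) = h x"
  shows "h ` cls x = {h x}"
proof -
  have "cls x = (\<lambda>n. n + x) ` N"
    by (auto simp: tensor_class_eq r_coset_def)
  then have "h ` cls x = (\<lambda>n. h (n + x)) ` N"
    by (simp add: image_image)
  also have "\<dots> = (\<lambda>n. h x) ` N"
    using assms(2) by (rule image_cong[OF refl])
  also have "\<dots> = {h x}"
    using subgroup.one_closed[OF subgroup_tensor_kernel] by auto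
  finally show ?thesis .
qed

text \<open>Each of the three families of relations is sent to zero by the matching property of a
  balanced map, so the sum over a representative is the same for the whole coset.\<close>

lemma tensor_lift_class:
  fixes P :: "('p, 's) ring_scheme"
  assumes \<phi>: "balanced_map k V W P \<phi>"
    and x: "x \<in> carrier F"
  shows "tensor_lift P \<phi> (cls x) = frag_lift P \<phi> x"
proof -
  have P: "abelian_group P"
    and closed: "\<And>v w. v \<in> carrier V \<Longrightarrow> w \<in> carrier W \<Longrightarrow> \<phi> v w \<in> carrier P"
    and addl: "\<And>v v' w. v \<in> carrier V \<Longrightarrow> v' \<in> carrier V \<Longrightarrow> w \<in> carrier W \<Longrightarrow>
      \<phi> (v \<oplus>\<^bsub>V\<^esub> v') w = \<phi> v w \<oplus>\<^bsub>P\<^esub> \<phi> v' w"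
    and addr: "\<And>v w w'. v \<in> carrier V \<Longrightarrow> w \<in> carrier W \<Longrightarrow> w' \<in> carrier W \<Longrightarrow>
      \<phi> v (w \<oplus>\<^bsub>W\<^esub> w') = \<phi> v w \<oplus>\<^bsub>P\<^esub> \<phi> v w'"
    and bal: "\<And>r v w. r \<in> carrier k \<Longrightarrow> v \<in> carrier V \<Longrightarrow> w \<in> carrier W \<Longrightarrow>
      \<phi> (r \<odot>\<^bsub>V\<^esub> v) w = \<phi> v (r \<odot>\<^bsub>W\<^esub> w)"
    using \<phi> unfolding balanced_map_def by blast+
  interpret P: abelian_group P by (rule P)
  note lift = frag_lift_add[where S = "carrier V" and T = "carrier W" and \<phi> = \<phi>, OF P closed]
    frag_lift_diff[where S = "carrier V" and T = "carrier W" and \<phi> = \<phi>, OF P closed]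
    frag_lift_minus[where S = "carrier V" and T = "carrier W" and \<phi> = \<phi>, OF P closed]
    frag_lift_frag_of[where S = "carrier V" and T = "carrier W" and \<phi> = \<phi>, OF P closed]
    frag_lift_closed[where S = "carrier V" and T = "carrier W" and \<phi> = \<phi>, OF P closed]
    frag_lift_zero[where S = "carrier V" and T = "carrier W" and \<phi> = \<phi>, OF P closed]
  \<comment> \<open>This is \<open>(a + b) - a - b\<close> in the shape that the associativity rules
    leave behind.\<close>
  have cancel: "a \<oplus>\<^bsub>P\<^esub> (b \<oplus>\<^bsub>P\<^esub> (\<ominus>\<^bsub>P\<^esub> a \<oplus>\<^bsub>P\<^esub> \<ominus>\<^bsub>P\<^esub> b)) = \<zero>\<^bsub>P\<^esub>"
    if "a \<in> carrier P" "b \<in> carrier P" for a b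
    using that P.r_neg[of "a \<oplus>\<^bsub>P\<^esub> b"] by (simp add: P.a_assoc P.minus_add)
  have "frag_lift P \<phi> n = \<zero>\<^bsub>P\<^esub>" if "n \<in> N" for n
    using that
  proof (induction rule: tensor_kernel_induct)
    case (relation x)
    then show ?case
      by (cases rule: tensor_relations_cases)
        (simp_all add: lift keys_frag_diff closed addl addr bal P.minus_eq P.a_assoc
          P.r_neg cancel)
  next
    case (minus x)
    then show ?case
      using tensor_relations_subset by (auto simp: lift)
  qed (auto simp: lift)
  then have "frag_lift P \<phi> ` cls x = {frag_lift P \<phi> x}"
    using x tensor_kernel_closed by (intro rcoset_image_eq) (auto simp: lift)
  then show ?thesis
    unfolding tensor_lift_def frag_lift_def[abs_def] by simp
qed


lemma tensor_relation_kernel: "x \<in> tensor_relations k V W \<Longrightarrow> x \<in> N"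
  unfolding tensor_kernel_def by (rule generate.incl)

lemma kernel_add: "x \<in> N \<Longrightarrow> y \<in> N \<Longrightarrow> x + y \<in> N"
  using subgroup.m_closed[OF subgroup_tensor_kernel] by fastforce

lemma kernel_minus: "x \<in> N \<Longrightarrow> - x \<in> N"
  using subgroup.m_inv_closed[OF subgroup_tensor_kernel] tensor_kernel_closed by fastforce

section \<open>Scalar multiplication of cosets\<close>

private abbreviation "scale r \<equiv> frag_extend (\<lambda>(v, w). frag_of (r \<odot>\<^bsub>V\<^esub> v, w))"

lemma frag_scale_closed:
  assumes "r \<in> carrier k" "x \<in> carrier F"
  shows "scale r x \<in> carrier F"
proof -
  have "Poly_Mapping.keys x \<subseteq> carrier V \<times> carrier W"
    using assms by simp
  then have "Poly_Mapping.keys (scale r x) \<subseteq> carrier V \<times> carrier W"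
  proof (induction x rule: free_Abelian_group_induct[consumes 1, case_names zero diff frag])
    case (diff x y)
    then show ?case
      by (simp add: frag_extend_diff keys_frag_diff)
  qed (use assms in auto)
  then show ?thesis
    by simp
qed

text \<open>Scaling the left entry takes each relation to a relation of the same family. In the
  balancing family the scalars \<open>r\<close> and \<open>s\<close> have to change places on
  \<open>v\<close>, which is where commutativity of \<open>k\<close> enters.\<close>

lemma frag_scale_kernel:
  assumes r: "r \<in> carrier k" and "n \<in> N"
  shows "scale r n \<in> N"
  using assms(2)
proof (induction rule: tensor_kernel_induct)
  case (relation x)
  then have "scale r x \<in> tensor_relations k V W"
  proof (cases rule: tensor_relations_cases)
    case (left v v' w)
    then show ?thesis
      using r tensor_relations_leftI[of "r \<odot>\<^bsub>V\<^esub> v" "r \<odot>\<^bsub>V\<^esub> v'" w]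
      by (simp add: frag_extend_diff V.smult_r_distr)
  next
    case (right v w w')
    then show ?thesis
      using r tensor_relations_rightI[of "r \<odot>\<^bsub>V\<^esub> v" w w'] by (simp add: frag_extend_diff)
  next
    case (balanced s v w)
    then have "r \<odot>\<^bsub>V\<^esub> (s \<odot>\<^bsub>V\<^esub> v) = s \<odot>\<^bsub>V\<^esub> (r \<odot>\<^bsub>V\<^esub> v)"
      using r by (metis V.smult_assoc1 V.R.m_comm)
    then show ?thesis
      using r balanced tensor_relations_balancedI[of s "r \<odot>\<^bsub>V\<^esub> v" w]
      by (simp add: frag_extend_diff)
  qed
  then show ?case
    by (rule tensor_relation_kernel)
next
  case zero
  show ?case
    using subgroup.one_closed[OF subgroup_tensor_kernel] by simp
qed (simp_all add: frag_extend_minus frag_extend_add kernel_add kernel_minus)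

lemma smult_tensor_class:
  assumes "r \<in> carrier k" "x \<in> carrier F"
  shows "r \<odot>\<^bsub>tensor k V W\<^esub> cls x = cls (scale r x)"
proof -
  have "(\<lambda>x. cls (scale r x)) ` cls x = {cls (scale r x)}"
  proof (rule rcoset_image_eq[OF assms(2)])
    fix n assume n: "n \<in> N"
    show "cls (scale r (n + x)) = cls (scale r x)"
    proof (rule tensor_class_eqI)
      show "scale r (n + x) \<in> carrier F"
        using assms tensor_kernel_closed[OF n] keys_frag_add[of n _ x]
        by (intro frag_scale_closed) auto
      show "scale r x \<in> carrier F"
        using assms by (rule frag_scale_closed)
      show "scale r (n + x) - scale r x \<in> N"
        using frag_scale_kernel[OF assms(1) n] by (simp add: frag_extend_add)
    qed
  qed
  then show ?thesis
    by (simp add: tensor_def Let_def)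
qed

lemma tensor_classE:
  assumes "t \<in> carrier (tensor k V W)"
  obtains x where "x \<in> carrier F" "t = cls x"
  using assms carrier_tensor by blast

lemma abelian_group_tensor: "abelian_group (tensor k V W)"
proof (rule abelian_groupI)
  fix s t u
  assume s: "s \<in> carrier (tensor k V W)" and t: "t \<in> carrier (tensor k V W)"
    and u: "u \<in> carrier (tensor k V W)"
  obtain x where x: "x \<in> carrier F" "s = cls x"
    using s by (rule tensor_classE)
  obtain y where y: "y \<in> carrier F" "t = cls y"
    using t by (rule tensor_classE)
  obtain z where z: "z \<in> carrier F" "u = cls z"
    using u by (rule tensor_classE)
  have xy: "x + y \<in> carrier F" and yz: "y + z \<in> carrier F"
    using x y z by (simp_all add: keys_frag_add)
  show "s \<oplus>\<^bsub>tensor k V W\<^esub> t \<in> carrier (tensor k V W)"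
    using tensor_class_closed[OF xy] x y by (simp add: add_tensor_class del: carrier_free_Abelian_group_iff)
  show "s \<oplus>\<^bsub>tensor k V W\<^esub> t = t \<oplus>\<^bsub>tensor k V W\<^esub> s"
    using x y by (simp add: add_tensor_class add.commute del: carrier_free_Abelian_group_iff)
  show "s \<oplus>\<^bsub>tensor k V W\<^esub> t \<oplus>\<^bsub>tensor k V W\<^esub> u = s \<oplus>\<^bsub>tensor k V W\<^esub> (t \<oplus>\<^bsub>tensor k V W\<^esub> u)"
    using x y z xy yz by (simp add: add_tensor_class add.assoc del: carrier_free_Abelian_group_iff)
next
  show "\<zero>\<^bsub>tensor k V W\<^esub> \<in> carrier (tensor k V W)"
    using tensor_class_closed[of 0] by (simp add: zero_tensor)
next
  fix s assume "s \<in> carrier (tensor k V W)"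
  then obtain x where x: "x \<in> carrier F" "s = cls x"
    by (rule tensor_classE)
  show "\<zero>\<^bsub>tensor k V W\<^esub> \<oplus>\<^bsub>tensor k V W\<^esub> s = s"
    using add_tensor_class[of 0 x] x by (simp add: zero_tensor)
  have "cls (- x) \<in> carrier (tensor k V W)" "cls (- x) \<oplus>\<^bsub>tensor k V W\<^esub> s = \<zero>\<^bsub>tensor k V W\<^esub>"
    using tensor_class_closed[of "- x"] add_tensor_class[of "- x" x] x
    by (simp_all add: zero_tensor)
  then show "\<exists>t\<in>carrier (tensor k V W). t \<oplus>\<^bsub>tensor k V W\<^esub> s = \<zero>\<^bsub>tensor k V W\<^esub>"
    by blast
qed

interpretation T: abelian_group "tensor k V W" by (rule abelian_group_tensor)

section \<open>Pure tensors as additive generators\<close>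

lemma pure_tensor_closed:
  assumes "v \<in> carrier V" "w \<in> carrier W"
  shows "pure_tensor k V W v w \<in> carrier (tensor k V W)"
  unfolding pure_tensor_def by (rule tensor_class_closed) (use assms in simp)

lemma smult_pure_tensor:
  assumes "r \<in> carrier k" "v \<in> carrier V" "w \<in> carrier W"
  shows "r \<odot>\<^bsub>tensor k V W\<^esub> pure_tensor k V W v w = pure_tensor k V W (r \<odot>\<^bsub>V\<^esub> v) w"
  unfolding pure_tensor_def using assms by (simp add: smult_tensor_class)

lemma pure_tensor_balanced:
  assumes "r \<in> carrier k" "v \<in> carrier V" "w \<in> carrier W"
  shows "pure_tensor k V W (r \<odot>\<^bsub>V\<^esub> v) w = pure_tensor k V W v (r \<odot>\<^bsub>W\<^esub> w)"
  unfolding pure_tensor_def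
  by (rule tensor_class_eqI)
    (use assms in \<open>simp_all add: tensor_relation_kernel tensor_relations_balancedI\<close>)

lemma pure_tensor_add_left:
  assumes "v \<in> carrier V" "v' \<in> carrier V" "w \<in> carrier W"
  shows "pure_tensor k V W (v \<oplus>\<^bsub>V\<^esub> v') w =
    pure_tensor k V W v w \<oplus>\<^bsub>tensor k V W\<^esub> pure_tensor k V W v' w"
proof -
  have "frag_of (v \<oplus>\<^bsub>V\<^esub> v', w) - (frag_of (v, w) + frag_of (v', w)) \<in> N"
    unfolding diff_diff_eq[symmetric] using assms
    by (intro tensor_relation_kernel tensor_relations_leftI)
  then show ?thesis
    unfolding pure_tensor_def using assms
    by (simp add: add_tensor_class tensor_class_eqI keys_frag_add)
qed

lemma pure_tensor_add_right:
  assumes "v \<in> carrier V" "w \<in> carrier W" "w' \<in> carrier W"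
  shows "pure_tensor k V W v (w \<oplus>\<^bsub>W\<^esub> w') =
    pure_tensor k V W v w \<oplus>\<^bsub>tensor k V W\<^esub> pure_tensor k V W v w'"
proof -
  have "frag_of (v, w \<oplus>\<^bsub>W\<^esub> w') - (frag_of (v, w) + frag_of (v, w')) \<in> N"
    unfolding diff_diff_eq[symmetric] using assms
    by (intro tensor_relation_kernel tensor_relations_rightI)
  then show ?thesis
    unfolding pure_tensor_def using assms
    by (simp add: add_tensor_class tensor_class_eqI keys_frag_add)
qed

lemma pure_tensor_zero_left:
  assumes "w \<in> carrier W"
  shows "pure_tensor k V W \<zero>\<^bsub>V\<^esub> w = \<zero>\<^bsub>tensor k V W\<^esub>"
  using pure_tensor_add_left[of "\<zero>\<^bsub>V\<^esub>" "\<zero>\<^bsub>V\<^esub>" w] assms pure_tensor_closed[of "\<zero>\<^bsub>V\<^esub>" w]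
  by (simp add: T.add.l_cancel_one)

text \<open>Elements of the free group are integer combinations, yet no case for negatives is called
  for: \<open>- (v \<otimes> w)\<close> is the pure tensor of \<open>- v\<close> and
  \<open>w\<close>, and zero is the pure tensor of two zeros.\<close>

lemma tensor_induct [consumes 1, case_names pure add]:
  assumes "t \<in> carrier (tensor k V W)"
    and pure: "\<And>v w. v \<in> carrier V \<Longrightarrow> w \<in> carrier W \<Longrightarrow> Q (pure_tensor k V W v w)"
    and add: "\<And>s t. s \<in> carrier (tensor k V W) \<Longrightarrow> t \<in> carrier (tensor k V W) \<Longrightarrow> Q s \<Longrightarrow> Q t \<Longrightarrow>
      Q (s \<oplus>\<^bsub>tensor k V W\<^esub> t)"
  shows "Q t"
proof -
  obtain x where x: "x \<in> carrier F" "t = cls x"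
    using assms(1) by (rule tensor_classE)
  have Q0: "Q \<zero>\<^bsub>tensor k V W\<^esub>"
    using pure[of "\<zero>\<^bsub>V\<^esub>" "\<zero>\<^bsub>W\<^esub>"] by (simp add: pure_tensor_zero_left)
  \<comment> \<open>Induction in the free abelian group proceeds by differences, so the claim is
    carried for \<open>x\<close> and \<open>- x\<close> together.\<close>
  have "Q (cls x) \<and> Q (cls (- x))"
    using x(1)[unfolded carrier_free_Abelian_group_iff]
  proof (induction x rule: free_Abelian_group_induct[consumes 1, case_names zero diff frag])
    case zero
    then show ?case
      using Q0 by (simp add: zero_tensor)
  next
    case (diff x y)
    have "cls (x - y) = cls x \<oplus>\<^bsub>tensor k V W\<^esub> cls (- y)"
      "cls (- (x - y)) = cls (- x) \<oplus>\<^bsub>tensor k V W\<^esub> cls y"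
      using add_tensor_class[of x "- y"] add_tensor_class[of "- x" y] diff by simp_all
    then show ?case
      using diff add tensor_class_closed by simp
  next
    case (frag p)
    obtain v w where p: "p = (v, w)" "v \<in> carrier V" "w \<in> carrier W"
      using frag by auto
    have "cls (- frag_of p) = pure_tensor k V W (\<ominus>\<^bsub>V\<^esub> v) w"
    proof -
      have "pure_tensor k V W v w \<oplus>\<^bsub>tensor k V W\<^esub> pure_tensor k V W (\<ominus>\<^bsub>V\<^esub> v) w = \<zero>\<^bsub>tensor k V W\<^esub>"
        using p pure_tensor_add_left[of v "\<ominus>\<^bsub>V\<^esub> v" w]
        by (simp add: V.r_neg pure_tensor_zero_left)
      moreover have "pure_tensor k V W v w \<oplus>\<^bsub>tensor k V W\<^esub> cls (- frag_of p) = \<zero>\<^bsub>tensor k V W\<^esub>"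
        using p add_tensor_class[of "frag_of p" "- frag_of p"]
        by (simp add: pure_tensor_def zero_tensor)
      moreover have "cls (- frag_of p) \<in> carrier (tensor k V W)"
        by (rule tensor_class_closed) (use frag in simp)
      ultimately show ?thesis
        using p pure_tensor_closed[of v w] pure_tensor_closed[of "\<ominus>\<^bsub>V\<^esub> v" w]
        by (metis T.minus_equality T.a_comm V.a_inv_closed)
    qed
    then show ?case
      using p pure[of v w] pure[of "\<ominus>\<^bsub>V\<^esub> v" w] by (simp add: pure_tensor_def)
  qed
  then show ?thesis
    using x by simp
qed

lemma tensor_smult_closed:
  assumes "r \<in> carrier k" "t \<in> carrier (tensor k V W)"
  shows "r \<odot>\<^bsub>tensor k V W\<^esub> t \<in> carrier (tensor k V W)"
proof -
  obtain x where x: "x \<in> carrier F" "t = cls x"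
    using assms(2) by (rule tensor_classE)
  show ?thesis
    unfolding x(2) smult_tensor_class[OF assms(1) x(1)]
    by (rule tensor_class_closed[OF frag_scale_closed[OF assms(1) x(1)]])
qed

lemma tensor_smult_add:
  assumes r: "r \<in> carrier k" and s: "s \<in> carrier (tensor k V W)" and t: "t \<in> carrier (tensor k V W)"
  shows "r \<odot>\<^bsub>tensor k V W\<^esub> (s \<oplus>\<^bsub>tensor k V W\<^esub> t) =
    r \<odot>\<^bsub>tensor k V W\<^esub> s \<oplus>\<^bsub>tensor k V W\<^esub> r \<odot>\<^bsub>tensor k V W\<^esub> t"
proof -
  obtain x where x: "x \<in> carrier F" "s = cls x"
    using s by (rule tensor_classE)
  obtain y where y: "y \<in> carrier F" "t = cls y"
    using t by (rule tensor_classE)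
  have xy: "x + y \<in> carrier F"
    using x y by (simp add: keys_frag_add)
  show ?thesis
    unfolding x(2) y(2) add_tensor_class[OF x(1) y(1)] smult_tensor_class[OF r x(1)]
      smult_tensor_class[OF r y(1)] smult_tensor_class[OF r xy]
      add_tensor_class[OF frag_scale_closed[OF r x(1)] frag_scale_closed[OF r y(1)]]
    by (simp add: frag_extend_add)
qed

text \<open>Closure and additivity of the scalar action are read off from representatives; the
  remaining scalar axioms are checked on pure tensors, where they become axioms of
  \<open>V\<close>.\<close>

lemma module_tensor: "module k (tensor k V W)"
proof (rule moduleI)
  show "cring k" ..
  show "abelian_group (tensor k V W)"
    by (rule abelian_group_tensor)
next
  fix a b t
  assume ab: "a \<in> carrier k" "b \<in> carrier k" and "t \<in> carrier (tensor k V W)"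
  show "(a \<oplus>\<^bsub>k\<^esub> b) \<odot>\<^bsub>tensor k V W\<^esub> t = a \<odot>\<^bsub>tensor k V W\<^esub> t \<oplus>\<^bsub>tensor k V W\<^esub> b \<odot>\<^bsub>tensor k V W\<^esub> t"
    using \<open>t \<in> _\<close>
  proof (induction rule: tensor_induct)
    case (pure v w)
    then show ?case
      using ab by (simp add: smult_pure_tensor V.smult_l_distr pure_tensor_add_left)
  next
    case (add s t)
    then show ?case
      using ab by (simp add: tensor_smult_add tensor_smult_closed T.a_ac)
  qed
  show "(a \<otimes>\<^bsub>k\<^esub> b) \<odot>\<^bsub>tensor k V W\<^esub> t = a \<odot>\<^bsub>tensor k V W\<^esub> (b \<odot>\<^bsub>tensor k V W\<^esub> t)"
    using \<open>t \<in> _\<close>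
  proof (induction rule: tensor_induct)
    case (pure v w)
    then show ?case
      using ab by (simp add: smult_pure_tensor V.smult_assoc1)
  next
    case (add s t)
    then show ?case
      using ab by (simp add: tensor_smult_add tensor_smult_closed)
  qed
next
  fix t assume "t \<in> carrier (tensor k V W)"
  then show "\<one>\<^bsub>k\<^esub> \<odot>\<^bsub>tensor k V W\<^esub> t = t"
  proof (induction rule: tensor_induct)
    case (pure v w)
    then show ?case
      by (simp add: smult_pure_tensor)
  next
    case (add s t)
    then show ?case
      by (simp add: tensor_smult_add)
  qed
qed (rule tensor_smult_closed tensor_smult_add; assumption)+

lemma tensor_lift_pure:
  assumes "balanced_map k V W P \<phi>" "v \<in> carrier V" "w \<in> carrier W"
  shows "tensor_lift P \<phi> (pure_tensor k V W v w) = \<phi> v w"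
proof -
  have "frag_lift P \<phi> (frag_of (v, w)) = \<phi> v w"
    by (rule frag_lift_frag_of[of P "carrier V" "carrier W"])
      (use assms in \<open>auto simp: balanced_map_def\<close>)
  then show ?thesis
    unfolding pure_tensor_def using assms by (simp add: tensor_lift_class)
qed

lemma tensor_lift_closed:
  assumes "balanced_map k V W P \<phi>" "t \<in> carrier (tensor k V W)"
  shows "tensor_lift P \<phi> t \<in> carrier P"
proof -
  obtain x where x: "x \<in> carrier F" "t = cls x"
    using assms(2) by (rule tensor_classE)
  have "frag_lift P \<phi> x \<in> carrier P"
    by (rule frag_lift_closed[of P "carrier V" "carrier W"])
      (use assms x in \<open>auto simp: balanced_map_def\<close>)
  then show ?thesis
    using x assms by (simp add: tensor_lift_class)
qed

lemma tensor_lift_add: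
  assumes "balanced_map k V W P \<phi>" "s \<in> carrier (tensor k V W)" "t \<in> carrier (tensor k V W)"
  shows "tensor_lift P \<phi> (s \<oplus>\<^bsub>tensor k V W\<^esub> t) = tensor_lift P \<phi> s \<oplus>\<^bsub>P\<^esub> tensor_lift P \<phi> t"
proof -
  obtain x where x: "x \<in> carrier F" "s = cls x"
    using assms(2) by (rule tensor_classE)
  obtain y where y: "y \<in> carrier F" "t = cls y"
    using assms(3) by (rule tensor_classE)
  have "frag_lift P \<phi> (x + y) = frag_lift P \<phi> x \<oplus>\<^bsub>P\<^esub> frag_lift P \<phi> y"
    by (rule frag_lift_add[of P "carrier V" "carrier W"])
      (use assms x y in \<open>auto simp: balanced_map_def\<close>)
  then show ?thesis
    using x y assms by (simp add: tensor_lift_class add_tensor_class keys_frag_add)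
qed

end

section \<open>Linear and bilinear maps\<close>

lemma linear_mapI:
  assumes "\<And>x. x \<in> carrier V \<Longrightarrow> f x \<in> carrier W"
    and "\<And>x y. x \<in> carrier V \<Longrightarrow> y \<in> carrier V \<Longrightarrow> f (x \<oplus>\<^bsub>V\<^esub> y) = f x \<oplus>\<^bsub>W\<^esub> f y"
    and "\<And>r x. r \<in> carrier k \<Longrightarrow> x \<in> carrier V \<Longrightarrow> f (r \<odot>\<^bsub>V\<^esub> x) = r \<odot>\<^bsub>W\<^esub> f x"
  shows "linear_map k V W f"
  using assms by (auto simp: linear_map_def)

lemma linear_map_closed: "linear_map k V W f \<Longrightarrow> x \<in> carrier V \<Longrightarrow> f x \<in> carrier W"
  and linear_map_add: "linear_map k V W f \<Longrightarrow> x \<in> carrier V \<Longrightarrow> y \<in> carrier V \<Longrightarrow>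
    f (x \<oplus>\<^bsub>V\<^esub> y) = f x \<oplus>\<^bsub>W\<^esub> f y"
  and linear_map_smult: "linear_map k V W f \<Longrightarrow> r \<in> carrier k \<Longrightarrow> x \<in> carrier V \<Longrightarrow>
    f (r \<odot>\<^bsub>V\<^esub> x) = r \<odot>\<^bsub>W\<^esub> f x"
  by (auto simp: linear_map_def)

lemma linear_map_ident: "linear_map k V V (\<lambda>x. x)"
  by (simp add: linear_map_def)

lemma linear_map_id: "linear_map k V V id"
  by (simp add: linear_map_def)

lemma linear_map_compose:
  "linear_map k V W f \<Longrightarrow> linear_map k X V h \<Longrightarrow> linear_map k X W (\<lambda>x. f (h x))"
  by (auto simp: linear_map_def Pi_iff)

text \<open>Maps are compared on the carrier only, so under \<open>linear_map\<close> a function is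
  exchanged for its evaluated form by this rule and not by plain rewriting.\<close>

lemma linear_map_cong:
  assumes "module k V" "\<And>x. x \<in> carrier V \<Longrightarrow> f x = g x"
  shows "linear_map k V W f \<longleftrightarrow> linear_map k V W g"
proof -
  interpret V: module k V by (rule assms)
  show ?thesis
    using assms(2) by (auto simp: linear_map_def Pi_iff)
qed

lemma linear_map_plus:
  assumes "module k W" "linear_map k V W f" "linear_map k V W g"
  shows "linear_map k V W (\<lambda>x. f x \<oplus>\<^bsub>W\<^esub> g x)"
proof -
  interpret W: module k W by (rule assms)
  show ?thesis
    using assms(2,3)
    by (auto simp: linear_map_def Pi_iff W.smult_r_distr W.a_ac)
qed

definition bilinear_map ::
    "('k, 'r) ring_scheme \<Rightarrow> ('k, 'a, 'v) module_scheme \<Rightarrow> ('k, 'b, 'w) module_scheme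
      \<Rightarrow> ('k, 'c, 'u) module_scheme \<Rightarrow> ('a \<Rightarrow> 'b \<Rightarrow> 'c) \<Rightarrow> bool" where
  "bilinear_map k V W P \<phi> \<longleftrightarrow>
     (\<forall>w\<in>carrier W. linear_map k V P (\<lambda>v. \<phi> v w)) \<and> (\<forall>v\<in>carrier V. linear_map k W P (\<phi> v))"

lemma bilinear_mapI:
  assumes "\<And>w. w \<in> carrier W \<Longrightarrow> linear_map k V P (\<lambda>v. \<phi> v w)"
    and "\<And>v. v \<in> carrier V \<Longrightarrow> linear_map k W P (\<lambda>w. \<phi> v w)"
  shows "bilinear_map k V W P \<phi>"
  using assms by (simp add: bilinear_map_def)

lemma bilinear_map_left: "bilinear_map k V W P \<phi> \<Longrightarrow> w \<in> carrier W \<Longrightarrow> linear_map k V P (\<lambda>v. \<phi> v w)"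
  and bilinear_map_right: "bilinear_map k V W P \<phi> \<Longrightarrow> v \<in> carrier V \<Longrightarrow> linear_map k W P (\<lambda>w. \<phi> v w)"
  by (simp_all add: bilinear_map_def)

lemma bilinear_map_balanced:
  assumes "module k P" "bilinear_map k V W P \<phi>"
  shows "balanced_map k V W P \<phi>"
proof -
  interpret P: module k P by (rule assms)
  show ?thesis
    unfolding balanced_map_def
    using assms(2) P.abelian_group_axioms
    by (auto simp: bilinear_map_def linear_map_def Pi_iff)
qed

lemma tensor_lift_pure_tensor:
  assumes "module k V" "module k W" "module k P" "bilinear_map k V W P \<phi>"
    and "v \<in> carrier V" "w \<in> carrier W"
  shows "tensor_lift P \<phi> (pure_tensor k V W v w) = \<phi> v w"
  using assms by (intro tensor_lift_pure bilinear_map_balanced)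

lemma linear_map_tensor_lift:
  assumes V: "module k V" and W: "module k W" and P: "module k P" and \<phi>: "bilinear_map k V W P \<phi>"
  shows "linear_map k (tensor k V W) P (tensor_lift P \<phi>)"
proof (rule linear_mapI)
  interpret P: module k P by (rule P)
  interpret T: module k "tensor k V W" by (rule module_tensor[OF V W])
  note bal = bilinear_map_balanced[OF P \<phi>]
  show closed: "tensor_lift P \<phi> t \<in> carrier P" if "t \<in> carrier (tensor k V W)" for t
    using that by (rule tensor_lift_closed[OF V W bal])
  show lift_add: "tensor_lift P \<phi> (s \<oplus>\<^bsub>tensor k V W\<^esub> t) = tensor_lift P \<phi> s \<oplus>\<^bsub>P\<^esub> tensor_lift P \<phi> t"
    if "s \<in> carrier (tensor k V W)" "t \<in> carrier (tensor k V W)" for s t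
    using that by (rule tensor_lift_add[OF V W bal])
  show "tensor_lift P \<phi> (r \<odot>\<^bsub>tensor k V W\<^esub> t) = r \<odot>\<^bsub>P\<^esub> tensor_lift P \<phi> t"
    if r: "r \<in> carrier k" and "t \<in> carrier (tensor k V W)" for r t
    using that(2)
  proof (induction rule: tensor_induct[OF V W, consumes 1, case_names pure add])
    case (pure v w)
    interpret V: module k V by (rule V)
    show ?case
      using pure r linear_map_smult[OF bilinear_map_left[OF \<phi>]]
      by (simp add: smult_pure_tensor[OF V W] tensor_lift_pure_tensor[OF V W P \<phi>])
  next
    case (add s t)
    then show ?case
      using r by (simp add: T.smult_r_distr P.smult_r_distr lift_add closed)
  qed
qed

text \<open>Here the tensor is fixed and the bilinear map varies. This gives linearity in the second
  variable of maps that lift in the first, as in \<open>tensor_assoc\<close>, and linearity of an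
  action in the acting element. The induction runs over \<open>t\<close> because on a pure tensor
  the lift is just \<open>\<phi> x v w\<close>.\<close>

lemma linear_map_tensor_lift_family:
  assumes V: "module k V" and W: "module k W" and P: "module k P" and X: "module k X"
    and \<phi>: "\<And>x. x \<in> carrier X \<Longrightarrow> bilinear_map k V W P (\<phi> x)"
    and fam: "\<And>v w. v \<in> carrier V \<Longrightarrow> w \<in> carrier W \<Longrightarrow> linear_map k X P (\<lambda>x. \<phi> x v w)"
    and t: "t \<in> carrier (tensor k V W)"
  shows "linear_map k X P (\<lambda>x. tensor_lift P (\<phi> x) t)"
  using t
proof (induction rule: tensor_induct[OF V W, consumes 1, case_names pure add])
  case (pure v w)
  have "linear_map k X P (\<lambda>x. tensor_lift P (\<phi> x) (pure_tensor k V W v w)) \<longleftrightarrow>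
      linear_map k X P (\<lambda>x. \<phi> x v w)"
    by (rule linear_map_cong[OF X]) (use pure \<phi> in \<open>simp add: tensor_lift_pure_tensor[OF V W P]\<close>)
  then show ?case
    using fam[OF pure] by simp
next
  case (add s t)
  have "linear_map k X P (\<lambda>x. tensor_lift P (\<phi> x) (s \<oplus>\<^bsub>tensor k V W\<^esub> t)) \<longleftrightarrow>
      linear_map k X P (\<lambda>x. tensor_lift P (\<phi> x) s \<oplus>\<^bsub>P\<^esub> tensor_lift P (\<phi> x) t)"
    by (rule linear_map_cong[OF X])
      (use add \<phi> in \<open>simp add: linear_map_add[OF linear_map_tensor_lift[OF V W P]]\<close>)
  then show ?case
    using linear_map_plus[OF P add(3,4)] by simp
qed

text \<open>Nearly all identities below are reduced to elements by this rule. Its conclusion is a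
  bounded quantifier, so that an identity proved for a variable tensor can be instantiated at, or
  used to rewrite, a value that is not pure.\<close>

lemma tensor_extI:
  assumes "module k V" "module k W" "linear_map k (tensor k V W) X f" "linear_map k (tensor k V W) X g"
    and "\<And>v w. v \<in> carrier V \<Longrightarrow> w \<in> carrier W \<Longrightarrow>
      f (pure_tensor k V W v w) = g (pure_tensor k V W v w)"
  shows "\<forall>t\<in>carrier (tensor k V W). f t = g t"
proof
  fix t assume "t \<in> carrier (tensor k V W)"
  then show "f t = g t"
    by (induction rule: tensor_induct[OF assms(1,2), consumes 1, case_names pure add])
      (simp_all add: assms(5) linear_map_add[OF assms(3)] linear_map_add[OF assms(4)])
qed

lemma bilinear_map_pure_tensor:
  assumes "module k V" "module k W"
  shows "bilinear_map k V W (tensor k V W) (pure_tensor k V W)"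
proof -
  interpret V: module k V by (rule assms)
  interpret W: module k W by (rule assms)
  show ?thesis
    using assms
    by (auto intro!: bilinear_mapI linear_mapI
        simp: pure_tensor_closed pure_tensor_add_left pure_tensor_add_right smult_pure_tensor
          pure_tensor_balanced)
qed

lemma linear_map_pure_left:
  assumes "linear_map k X V h" "w \<in> carrier W" "module k V" "module k W"
  shows "linear_map k X (tensor k V W) (\<lambda>x. pure_tensor k V W (h x) w)"
  using linear_map_compose[OF bilinear_map_left[OF bilinear_map_pure_tensor[OF assms(3,4)] assms(2)] assms(1)] .

lemma linear_map_pure_right:
  assumes "linear_map k X W h" "v \<in> carrier V" "module k V" "module k W"
  shows "linear_map k X (tensor k V W) (\<lambda>x. pure_tensor k V W v (h x))"
  using linear_map_compose[OF bilinear_map_right[OF bilinear_map_pure_tensor[OF assms(3,4)] assms(2)] assms(1)] .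

context
  fixes k :: "('k, 'r) ring_scheme"
    and V :: "('k, 'a, 'v) module_scheme" and W :: "('k, 'b, 'w) module_scheme"
    and V' :: "('k, 'c, 'x) module_scheme" and W' :: "('k, 'd, 'y) module_scheme"
    and f g
  assumes f: "linear_map k V V' f" and g: "linear_map k W W' g"
    and mod: "module k V" "module k W" "module k V'" "module k W'"
begin

lemma bilinear_map_tensor_map:
  "bilinear_map k V W (tensor k V' W') (\<lambda>x y. pure_tensor k V' W' (f x) (g y))"
  using f g mod
  by (auto intro!: bilinear_mapI linear_map_pure_left linear_map_pure_right linear_map_closed[OF f]
      linear_map_closed[OF g])

lemma tensor_map_pure:
  "v \<in> carrier V \<Longrightarrow> w \<in> carrier W \<Longrightarrow>
    tensor_map k V' W' f g (pure_tensor k V W v w) = pure_tensor k V' W' (f v) (g w)"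
  unfolding tensor_map_def
  by (rule tensor_lift_pure_tensor[OF _ _ _ bilinear_map_tensor_map]) (simp_all add: mod module_tensor)

lemma linear_map_tensor_map:
  assumes "linear_map k X (tensor k V W) h"
  shows "linear_map k X (tensor k V' W') (\<lambda>x. tensor_map k V' W' f g (h x))"
  unfolding tensor_map_def
  by (rule linear_map_compose[OF linear_map_tensor_lift[OF _ _ _ bilinear_map_tensor_map] assms])
    (simp_all add: mod module_tensor)

end

lemma linear_map_tensor_map_family_left:
  assumes "\<And>x. x \<in> carrier X \<Longrightarrow> linear_map k V V' (F x)"
    and "\<And>v. v \<in> carrier V \<Longrightarrow> linear_map k X V' (\<lambda>x. F x v)"
    and "linear_map k W W' g" "t \<in> carrier (tensor k V W)"
    and "module k V" "module k W" "module k V'" "module k W'" "module k X"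
  shows "linear_map k X (tensor k V' W') (\<lambda>x. tensor_map k V' W' (F x) g t)"
  unfolding tensor_map_def
  by (rule linear_map_tensor_lift_family[of k V W])
    (use assms in \<open>auto intro!: bilinear_map_tensor_map linear_map_pure_left module_tensor
      linear_map_closed[OF assms(3)]\<close>)

lemma linear_map_tensor_map_family_right:
  assumes "\<And>x. x \<in> carrier X \<Longrightarrow> linear_map k W W' (G x)"
    and "\<And>w. w \<in> carrier W \<Longrightarrow> linear_map k X W' (\<lambda>x. G x w)"
    and "linear_map k V V' f" "t \<in> carrier (tensor k V W)"
    and "module k V" "module k W" "module k V'" "module k W'" "module k X"
  shows "linear_map k X (tensor k V' W') (\<lambda>x. tensor_map k V' W' f (G x) t)"
  unfolding tensor_map_def
  by (rule linear_map_tensor_lift_family[of k V W])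
    (use assms in \<open>auto intro!: bilinear_map_tensor_map linear_map_pure_right module_tensor
      linear_map_closed[OF assms(3)]\<close>)

section \<open>The associativity isomorphisms\<close>

context
  fixes k :: "('k, 'r) ring_scheme"
    and U :: "('k, 'a, 'u) module_scheme" and V :: "('k, 'b, 'v) module_scheme"
    and W :: "('k, 'c, 'w) module_scheme"
  assumes mod: "module k U" "module k V" "module k W"
begin

private lemma mods: "module k (tensor k U V)" "module k (tensor k V W)"
  "module k (tensor k U (tensor k V W))" "module k (tensor k (tensor k U V) W)"
  by (simp_all add: mod module_tensor)

private lemma assoc_inner:
  "w \<in> carrier W \<Longrightarrow> bilinear_map k U V (tensor k U (tensor k V W))
    (\<lambda>u v. pure_tensor k U (tensor k V W) u (pure_tensor k V W v w))"
  by (auto intro!: bilinear_mapI linear_map_pure_left linear_map_pure_right linear_map_ident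
      mod mods pure_tensor_closed)

private lemma assoc_outer:
  "bilinear_map k (tensor k U V) W (tensor k U (tensor k V W))
    (\<lambda>x w. tensor_lift (tensor k U (tensor k V W))
      (\<lambda>u v. pure_tensor k U (tensor k V W) u (pure_tensor k V W v w)) x)"
proof (rule bilinear_mapI)
  fix w assume "w \<in> carrier W"
  then show "linear_map k (tensor k U V) (tensor k U (tensor k V W))
      (\<lambda>x. tensor_lift (tensor k U (tensor k V W))
        (\<lambda>u v. pure_tensor k U (tensor k V W) u (pure_tensor k V W v w)) x)"
    using linear_map_tensor_lift[OF mod(1,2) mods(3) assoc_inner] by simp
next
  fix x assume "x \<in> carrier (tensor k U V)"
  then show "linear_map k W (tensor k U (tensor k V W))
      (\<lambda>w. tensor_lift (tensor k U (tensor k V W))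
        (\<lambda>u v. pure_tensor k U (tensor k V W) u (pure_tensor k V W v w)) x)"
    by (intro linear_map_tensor_lift_family[of k U V] assoc_inner linear_map_pure_right
        linear_map_ident mod mods pure_tensor_closed)
qed

lemma linear_map_tensor_assoc:
  assumes "linear_map k X (tensor k (tensor k U V) W) h"
  shows "linear_map k X (tensor k U (tensor k V W)) (\<lambda>x. tensor_assoc k U V W (h x))"
  unfolding tensor_assoc_def
  by (rule linear_map_compose[OF linear_map_tensor_lift[OF mods(1) mod(3) mods(3) assoc_outer] assms])

lemma tensor_assoc_pure:
  assumes "u \<in> carrier U" "v \<in> carrier V" "w \<in> carrier W"
  shows "tensor_assoc k U V W (pure_tensor k (tensor k U V) W (pure_tensor k U V u v) w) =
    pure_tensor k U (tensor k V W) u (pure_tensor k V W v w)"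
  unfolding tensor_assoc_def using assms
  by (simp add: tensor_lift_pure_tensor[OF mods(1) mod(3) mods(3) assoc_outer]
      tensor_lift_pure_tensor[OF mod(1,2) mods(3) assoc_inner] pure_tensor_closed mod)

private lemma unassoc_inner:
  "u \<in> carrier U \<Longrightarrow> bilinear_map k V W (tensor k (tensor k U V) W)
    (\<lambda>v w. pure_tensor k (tensor k U V) W (pure_tensor k U V u v) w)"
  by (auto intro!: bilinear_mapI linear_map_pure_left linear_map_pure_right linear_map_ident
      mod mods pure_tensor_closed)

private lemma unassoc_outer:
  "bilinear_map k U (tensor k V W) (tensor k (tensor k U V) W)
    (\<lambda>u y. tensor_lift (tensor k (tensor k U V) W)
      (\<lambda>v w. pure_tensor k (tensor k U V) W (pure_tensor k U V u v) w) y)"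
proof (rule bilinear_mapI)
  fix u assume "u \<in> carrier U"
  then show "linear_map k (tensor k V W) (tensor k (tensor k U V) W)
      (\<lambda>y. tensor_lift (tensor k (tensor k U V) W)
        (\<lambda>v w. pure_tensor k (tensor k U V) W (pure_tensor k U V u v) w) y)"
    using linear_map_tensor_lift[OF mod(2,3) mods(4) unassoc_inner] by simp
next
  fix y assume "y \<in> carrier (tensor k V W)"
  then show "linear_map k U (tensor k (tensor k U V) W)
      (\<lambda>u. tensor_lift (tensor k (tensor k U V) W)
        (\<lambda>v w. pure_tensor k (tensor k U V) W (pure_tensor k U V u v) w) y)"
    by (intro linear_map_tensor_lift_family[of k V W] unassoc_inner linear_map_pure_left
        linear_map_ident mod mods pure_tensor_closed)
qed

lemma linear_map_tensor_unassoc: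
  assumes "linear_map k X (tensor k U (tensor k V W)) h"
  shows "linear_map k X (tensor k (tensor k U V) W) (\<lambda>x. tensor_unassoc k U V W (h x))"
  unfolding tensor_unassoc_def
  by (rule linear_map_compose[OF linear_map_tensor_lift[OF mod(1) mods(2) mods(4) unassoc_outer] assms])

lemma tensor_unassoc_pure:
  assumes "u \<in> carrier U" "v \<in> carrier V" "w \<in> carrier W"
  shows "tensor_unassoc k U V W (pure_tensor k U (tensor k V W) u (pure_tensor k V W v w)) =
    pure_tensor k (tensor k U V) W (pure_tensor k U V u v) w"
  unfolding tensor_unassoc_def using assms
  by (simp add: tensor_lift_pure_tensor[OF mod(1) mods(2) mods(4) unassoc_outer]
      tensor_lift_pure_tensor[OF mod(2,3) mods(4) unassoc_inner] pure_tensor_closed mod)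

lemma tensor_assoc_unassoc:
  "\<forall>t\<in>carrier (tensor k U (tensor k V W)). tensor_assoc k U V W (tensor_unassoc k U V W t) = t"
proof (rule tensor_extI[where X = "tensor k U (tensor k V W)"])
  fix u y assume u: "u \<in> carrier U" and "y \<in> carrier (tensor k V W)"
  have "\<forall>y\<in>carrier (tensor k V W).
      tensor_assoc k U V W (tensor_unassoc k U V W (pure_tensor k U (tensor k V W) u y)) =
      pure_tensor k U (tensor k V W) u y"
    by (rule tensor_extI) (use u in \<open>auto intro!: linear_map_tensor_assoc linear_map_tensor_unassoc
      linear_map_pure_right linear_map_ident mod mods simp: tensor_assoc_pure tensor_unassoc_pure\<close>)
  then show "tensor_assoc k U V W (tensor_unassoc k U V W (pure_tensor k U (tensor k V W) u y)) =
      pure_tensor k U (tensor k V W) u y"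
    using \<open>y \<in> _\<close> by blast
qed (intro mod mods linear_map_tensor_assoc linear_map_tensor_unassoc linear_map_ident)+

lemma tensor_unassoc_assoc:
  "\<forall>t\<in>carrier (tensor k (tensor k U V) W). tensor_unassoc k U V W (tensor_assoc k U V W t) = t"
proof (rule tensor_extI[where X = "tensor k (tensor k U V) W"])
  fix x w assume w: "w \<in> carrier W" and "x \<in> carrier (tensor k U V)"
  have "\<forall>x\<in>carrier (tensor k U V).
      tensor_unassoc k U V W (tensor_assoc k U V W (pure_tensor k (tensor k U V) W x w)) =
      pure_tensor k (tensor k U V) W x w"
    by (rule tensor_extI) (use w in \<open>auto intro!: linear_map_tensor_assoc linear_map_tensor_unassoc
      linear_map_pure_left linear_map_ident mod mods simp: tensor_assoc_pure tensor_unassoc_pure\<close>)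
  then show "tensor_unassoc k U V W (tensor_assoc k U V W (pure_tensor k (tensor k U V) W x w)) =
      pure_tensor k (tensor k U V) W x w"
    using \<open>x \<in> _\<close> by blast
qed (intro mod mods linear_map_tensor_assoc linear_map_tensor_unassoc linear_map_ident)+

end

text \<open>The map \<open>w \<otimes> v \<mapsto> (u \<otimes> w) \<otimes> (v \<otimes>
  y)\<close>. On a pure tensor, \<open>1 \<otimes> f \<otimes> 1\<close> produces the value
  \<open>f (v \<otimes> w)\<close> framed by \<open>u\<close> and \<open>y\<close>; as that value
  need not be pure, the framing is expressed as a linear map.\<close>

definition tensor_insert ::
    "('k, 'r) ring_scheme \<Rightarrow> ('k, 'a, 'u) module_scheme \<Rightarrow> ('k, 'b, 'v) module_scheme
      \<Rightarrow> ('k, 'c, 'w) module_scheme \<Rightarrow> ('k, 'd, 'x) module_scheme \<Rightarrow> 'a \<Rightarrow> 'd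
      \<Rightarrow> ('c, 'b) tens \<Rightarrow> (('a, 'c) tens, ('b, 'd) tens) tens" where
  "tensor_insert k U V W Y u y =
     tensor_map k (tensor k U W) (tensor k V Y) (pure_tensor k U W u) (\<lambda>v. pure_tensor k V Y v y)"

context
  fixes k :: "('k, 'r) ring_scheme"
    and U :: "('k, 'a, 'u) module_scheme" and V :: "('k, 'b, 'v) module_scheme"
    and W :: "('k, 'c, 'w) module_scheme" and Y :: "('k, 'd, 'x) module_scheme"
  assumes mod: "module k U" "module k V" "module k W" "module k Y"
begin

lemma tensor_insert_pure:
  assumes "u \<in> carrier U" "y \<in> carrier Y" "w \<in> carrier W" "v \<in> carrier V"
  shows "tensor_insert k U V W Y u y (pure_tensor k W V w v) =
    pure_tensor k (tensor k U W) (tensor k V Y) (pure_tensor k U W u w) (pure_tensor k V Y v y)"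
  unfolding tensor_insert_def
  by (rule tensor_map_pure)
    (use assms mod in \<open>simp_all add: linear_map_pure_right linear_map_pure_left linear_map_ident
      module_tensor bilinear_map_right bilinear_map_pure_tensor\<close>)

lemma linear_map_tensor_insert:
  assumes "linear_map k X (tensor k W V) h" "u \<in> carrier U" "y \<in> carrier Y"
  shows "linear_map k X (tensor k (tensor k U W) (tensor k V Y)) (\<lambda>x. tensor_insert k U V W Y u y (h x))"
  unfolding tensor_insert_def
  by (rule linear_map_tensor_map[OF _ _ _ _ _ _ assms(1)])
    (use assms mod in \<open>simp_all add: linear_map_pure_right linear_map_pure_left linear_map_ident
      module_tensor bilinear_map_right bilinear_map_pure_tensor\<close>)

lemma linear_map_tensor_middle:
  assumes "linear_map k (tensor k V W) (tensor k W V) f"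
    and "linear_map k X (tensor k (tensor k U V) (tensor k W Y)) h"
  shows "linear_map k X (tensor k (tensor k U W) (tensor k V Y)) (\<lambda>x. tensor_middle k U V W Y f (h x))"
  unfolding tensor_middle_def comp_apply
  by (rule linear_map_tensor_unassoc linear_map_tensor_map linear_map_tensor_assoc linear_map_id
      linear_map_compose[OF assms(1)] linear_map_ident assms(2) mod module_tensor |
      simp only: comp_def)+

text \<open>Rebracketing brings \<open>v\<close> and \<open>w\<close> together, \<open>f\<close>
  acts, and rebracketing restores the grouping in pairs. The rebracketings after \<open>f\<close>
  are evaluated on every tensor \<open>s\<close> first, then at the value of
  \<open>f\<close>.\<close>

lemma tensor_middle_pure:
  assumes f: "linear_map k (tensor k V W) (tensor k W V) f"
    and u: "u \<in> carrier U" and v: "v \<in> carrier V" and w: "w \<in> carrier W" and y: "y \<in> carrier Y"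
  shows "tensor_middle k U V W Y f
      (pure_tensor k (tensor k U V) (tensor k W Y) (pure_tensor k U V u v) (pure_tensor k W Y w y)) =
    tensor_insert k U V W Y u y (f (pure_tensor k V W v w))"
proof -
  note lin = linear_map_tensor_unassoc linear_map_tensor_map linear_map_tensor_assoc linear_map_id
    linear_map_compose[OF f] linear_map_ident mod module_tensor linear_map_tensor_insert
    linear_map_pure_left linear_map_pure_right pure_tensor_closed
  have inner: "linear_map k (tensor k V (tensor k W Y)) (tensor k W (tensor k V Y))
      (tensor_assoc k W V Y \<circ> tensor_map k (tensor k W V) Y f id \<circ> tensor_unassoc k V W Y)"
    unfolding comp_def by (rule lin)+
  have "\<forall>s\<in>carrier (tensor k W V).
      tensor_unassoc k U W (tensor k V Y) (pure_tensor k U (tensor k W (tensor k V Y)) u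
        (tensor_assoc k W V Y (pure_tensor k (tensor k W V) Y s y))) =
      tensor_insert k U V W Y u y s"
    by (rule tensor_extI) (use u y in \<open>auto intro!: lin
      simp: tensor_assoc_pure tensor_unassoc_pure tensor_insert_pure mod module_tensor pure_tensor_closed\<close>)
  moreover have "f (pure_tensor k V W v w) \<in> carrier (tensor k W V)"
    using v w by (intro linear_map_closed[OF f] pure_tensor_closed mod)
  moreover have "tensor_middle k U V W Y f
      (pure_tensor k (tensor k U V) (tensor k W Y) (pure_tensor k U V u v) (pure_tensor k W Y w y)) =
    tensor_unassoc k U W (tensor k V Y) (pure_tensor k U (tensor k W (tensor k V Y)) u
        (tensor_assoc k W V Y (pure_tensor k (tensor k W V) Y (f (pure_tensor k V W v w)) y)))"
    using u v w y
    by (simp add: tensor_middle_def tensor_assoc_pure tensor_unassoc_pure mod module_tensor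
        pure_tensor_closed tensor_map_pure[OF linear_map_id inner] tensor_map_pure[OF f linear_map_id])
  ultimately show ?thesis
    by simp
qed

end

section \<open>Bimodule maps into the tensor square\<close>

text \<open>Apart from the identity rules, each rule says that a map applied to \<open>h x\<close>
  is linear in \<open>x\<close> when \<open>h\<close> is. Repeated resolution then strips a
  composite layer by layer, leaving carrier conditions for the arguments that stay fixed.\<close>

lemmas linear_intros = linear_map_ident linear_map_id linear_map_pure_left linear_map_pure_right
  linear_map_tensor_map linear_map_tensor_assoc linear_map_tensor_unassoc
  linear_map_tensor_insert

definition left_action ::
    "('k, 'r) ring_scheme \<Rightarrow> ('k, 'a, 'm) module_scheme \<Rightarrow> 'a \<Rightarrow> ('a, 'a) tens \<Rightarrow> ('a, 'a) tens" where
  "left_action k A a = tensor_map k A A (\<lambda>x. a \<otimes>\<^bsub>A\<^esub> x) id"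

definition right_action ::
    "('k, 'r) ring_scheme \<Rightarrow> ('k, 'a, 'm) module_scheme \<Rightarrow> 'a \<Rightarrow> ('a, 'a) tens \<Rightarrow> ('a, 'a) tens" where
  "right_action k A a = tensor_map k A A id (\<lambda>x. x \<otimes>\<^bsub>A\<^esub> a)"

text \<open>The meeting point of two notions: the Frobenius identities and the bimodule condition on
  a section, both formulated with rebracketed composites, come down to these equations between
  elements.\<close>

definition bimodule_hom ::
    "('k, 'r) ring_scheme \<Rightarrow> ('k, 'a, 'm) module_scheme \<Rightarrow> ('a \<Rightarrow> ('a, 'a) tens) \<Rightarrow> bool" where
  "bimodule_hom k A f \<longleftrightarrow> linear_map k A (tensor k A A) f \<and>
     (\<forall>x\<in>carrier A. \<forall>y\<in>carrier A.
        f (x \<otimes>\<^bsub>A\<^esub> y) = left_action k A x (f y) \<and> f (x \<otimes>\<^bsub>A\<^esub> y) = right_action k A y (f x))"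

locale unital_alg =
  fixes k :: "('k, 'r) ring_scheme" and A :: "('k, 'a, 'm) module_scheme"
  assumes unital_algebra: "unital_algebra k A"
begin

lemma module_alg: "module k A" and ring_alg: "ring A"
  using unital_algebra by (simp_all add: unital_algebra_def)

sublocale ring A by (rule ring_alg)

lemma linear_map_mult_left:
  assumes "linear_map k X A h" "a \<in> carrier A"
  shows "linear_map k X A (\<lambda>x. a \<otimes>\<^bsub>A\<^esub> h x)"
proof -
  have "linear_map k A A (\<lambda>x. a \<otimes>\<^bsub>A\<^esub> x)"
    using assms(2) unital_algebra
    by (intro linear_mapI) (auto simp: r_distr unital_algebra_def)
  then show ?thesis
    using assms(1) by (rule linear_map_compose)
qed

lemma linear_map_mult_right:
  assumes "linear_map k X A h" "a \<in> carrier A"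
  shows "linear_map k X A (\<lambda>x. h x \<otimes>\<^bsub>A\<^esub> a)"
proof -
  have "linear_map k A A (\<lambda>x. x \<otimes>\<^bsub>A\<^esub> a)"
    using assms(2) unital_algebra
    by (intro linear_mapI) (auto simp: l_distr unital_algebra_def)
  then show ?thesis
    using assms(1) by (rule linear_map_compose)
qed

lemma bilinear_map_mult: "bilinear_map k A A A (\<lambda>x y. x \<otimes>\<^bsub>A\<^esub> y)"
  by (intro bilinear_mapI linear_map_mult_left linear_map_mult_right linear_map_ident)

lemma nabla_pure: "x \<in> carrier A \<Longrightarrow> y \<in> carrier A \<Longrightarrow> nabla A (pure_tensor k A A x y) = x \<otimes>\<^bsub>A\<^esub> y"
  unfolding nabla_def
  by (rule tensor_lift_pure_tensor[OF module_alg module_alg module_alg bilinear_map_mult])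

lemma linear_map_nabla:
  "linear_map k X (tensor k A A) h \<Longrightarrow> linear_map k X A (\<lambda>x. nabla A (h x))"
  unfolding nabla_def
  by (rule linear_map_compose[OF linear_map_tensor_lift[OF module_alg module_alg module_alg bilinear_map_mult]])

lemma linear_map_left_action:
  "linear_map k X (tensor k A A) h \<Longrightarrow> a \<in> carrier A \<Longrightarrow>
    linear_map k X (tensor k A A) (\<lambda>x. left_action k A a (h x))"
  unfolding left_action_def
  by (rule linear_map_tensor_map[OF linear_map_mult_left[OF linear_map_ident] linear_map_id])
    (simp_all add: module_alg)

lemma linear_map_right_action:
  "linear_map k X (tensor k A A) h \<Longrightarrow> a \<in> carrier A \<Longrightarrow>
    linear_map k X (tensor k A A) (\<lambda>x. right_action k A a (h x))"
  unfolding right_action_def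
  by (rule linear_map_tensor_map[OF linear_map_id linear_map_mult_right[OF linear_map_ident]])
    (simp_all add: module_alg)

lemma left_action_pure:
  "a \<in> carrier A \<Longrightarrow> x \<in> carrier A \<Longrightarrow> y \<in> carrier A \<Longrightarrow>
    left_action k A a (pure_tensor k A A x y) = pure_tensor k A A (a \<otimes>\<^bsub>A\<^esub> x) y"
  unfolding left_action_def
  by (subst tensor_map_pure[OF linear_map_mult_left[OF linear_map_ident] linear_map_id])
    (simp_all add: module_alg)

lemma right_action_pure:
  "a \<in> carrier A \<Longrightarrow> x \<in> carrier A \<Longrightarrow> y \<in> carrier A \<Longrightarrow>
    right_action k A a (pure_tensor k A A x y) = pure_tensor k A A x (y \<otimes>\<^bsub>A\<^esub> a)"
  unfolding right_action_def
  by (subst tensor_map_pure[OF linear_map_id linear_map_mult_right[OF linear_map_ident]])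
    (simp_all add: module_alg)

lemma left_action_closed:
  "a \<in> carrier A \<Longrightarrow> t \<in> carrier (tensor k A A) \<Longrightarrow> left_action k A a t \<in> carrier (tensor k A A)"
  using linear_map_closed[OF linear_map_left_action[OF linear_map_ident]] .

lemma right_action_closed:
  "a \<in> carrier A \<Longrightarrow> t \<in> carrier (tensor k A A) \<Longrightarrow> right_action k A a t \<in> carrier (tensor k A A)"
  using linear_map_closed[OF linear_map_right_action[OF linear_map_ident]] .

lemma linear_map_left_action_arg:
  assumes "t \<in> carrier (tensor k A A)"
  shows "linear_map k A (tensor k A A) (\<lambda>a. left_action k A a t)"
  unfolding left_action_def
  by (rule linear_map_tensor_map_family_left[OF _ _ linear_map_id assms])
    (auto simp: module_alg intro: linear_map_mult_left linear_map_mult_right linear_map_ident)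

lemma linear_map_right_action_arg:
  assumes "t \<in> carrier (tensor k A A)"
  shows "linear_map k A (tensor k A A) (\<lambda>a. right_action k A a t)"
  unfolding right_action_def
  by (rule linear_map_tensor_map_family_right[OF _ _ linear_map_id assms])
    (auto simp: module_alg intro: linear_map_mult_left linear_map_mult_right linear_map_ident)

lemmas alg_linear = linear_intros linear_map_nabla linear_map_mult_left linear_map_mult_right
  linear_map_left_action linear_map_right_action module_tensor module_alg

lemmas alg_pure = nabla_pure left_action_pure right_action_pure tensor_assoc_pure tensor_unassoc_pure
  module_tensor module_alg pure_tensor_closed

lemma left_action_left_action:
  assumes "a \<in> carrier A" "b \<in> carrier A"
  shows "\<forall>t\<in>carrier (tensor k A A).
    left_action k A a (left_action k A b t) = left_action k A (a \<otimes>\<^bsub>A\<^esub> b) t"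
  using assms by (intro tensor_extI[where X = "tensor k A A"] alg_linear) (simp_all add: alg_pure m_assoc)

lemma right_action_right_action:
  assumes "a \<in> carrier A" "b \<in> carrier A"
  shows "\<forall>t\<in>carrier (tensor k A A).
    right_action k A b (right_action k A a t) = right_action k A (a \<otimes>\<^bsub>A\<^esub> b) t"
  using assms by (intro tensor_extI[where X = "tensor k A A"] alg_linear) (simp_all add: alg_pure m_assoc)

lemma left_action_right_action:
  assumes "a \<in> carrier A" "b \<in> carrier A"
  shows "\<forall>t\<in>carrier (tensor k A A).
    left_action k A a (right_action k A b t) = right_action k A b (left_action k A a t)"
  using assms by (intro tensor_extI[where X = "tensor k A A"] alg_linear) (simp_all add: alg_pure)

lemma left_action_one: "\<forall>t\<in>carrier (tensor k A A). left_action k A \<one>\<^bsub>A\<^esub> t = t"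
  by (intro tensor_extI[where X = "tensor k A A"] alg_linear) (simp_all add: alg_pure)

lemma right_action_one: "\<forall>t\<in>carrier (tensor k A A). right_action k A \<one>\<^bsub>A\<^esub> t = t"
  by (intro tensor_extI[where X = "tensor k A A"] alg_linear) (simp_all add: alg_pure)

text \<open>On a pure tensor the threefold condition says that \<open>\<Gamma>\<close> of
  \<open>x y z\<close> is \<open>x \<Gamma>(y) z\<close>. Putting a unit in the last or in the first
  place leaves one-sided linearity, and the two one-sided laws applied in turn give the threefold
  condition back.\<close>

lemma separability_section_iff:
  "separability_section k A \<Gamma> \<longleftrightarrow> bimodule_hom k A \<Gamma> \<and> (\<forall>a\<in>carrier A. nabla A (\<Gamma> a) = a)"
proof (cases "linear_map k A (tensor k A A) \<Gamma>")
  case False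
  then show ?thesis
    by (simp add: separability_section_def bimodule_hom_def)
next
  case lin: True
  note \<Gamma> = linear_map_compose[OF lin] linear_map_closed[OF lin]
  let ?AA = "tensor k A A"
  define f where "f = (\<lambda>t. \<Gamma> (nabla A (tensor_map k A A id (nabla A) t)))"
  define g where "g = (\<lambda>t. tensor_map k A A (nabla A) (nabla A)
          (tensor_unassoc k A A ?AA (tensor_map k A (tensor k A ?AA) id
              (tensor_assoc k A A A \<circ> tensor_map k ?AA A \<Gamma> id) t)))"
  have n: "linear_map k ?AA A (nabla A)"
    using linear_map_nabla[OF linear_map_ident] .
  have inner: "linear_map k (tensor k A A) (tensor k A ?AA) (tensor_assoc k A A A \<circ> tensor_map k ?AA A \<Gamma> id)"
    unfolding comp_def by (rule alg_linear lin)+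
  have f: "linear_map k (tensor k A ?AA) ?AA f"
    unfolding f_def by (rule \<Gamma> alg_linear n)+
  have g: "linear_map k (tensor k A ?AA) ?AA g"
    unfolding g_def by (rule alg_linear n inner)+
  have fp: "f (pure_tensor k A ?AA x (pure_tensor k A A y z)) = \<Gamma> (x \<otimes>\<^bsub>A\<^esub> (y \<otimes>\<^bsub>A\<^esub> z))"
    if "x \<in> carrier A" "y \<in> carrier A" "z \<in> carrier A" for x y z
    unfolding f_def using that by (simp add: tensor_map_pure[OF linear_map_id n] alg_pure)
  have gp: "g (pure_tensor k A ?AA x (pure_tensor k A A y z)) = left_action k A x (right_action k A z (\<Gamma> y))"
    if xyz: "x \<in> carrier A" "y \<in> carrier A" "z \<in> carrier A" for x y z
  proof -
    have "\<forall>s\<in>carrier ?AA. tensor_map k A A (nabla A) (nabla A)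
          (tensor_unassoc k A A ?AA (pure_tensor k A (tensor k A ?AA) x
            (tensor_assoc k A A A (pure_tensor k ?AA A s z)))) =
        left_action k A x (right_action k A z s)"
      by (rule tensor_extI[where X = ?AA]; ((rule alg_linear n xyz)+)?)
        (use xyz in \<open>simp_all add: alg_pure tensor_map_pure[OF n n]\<close>)
    then show ?thesis
      unfolding g_def using xyz \<Gamma>(2)[of y]
      by (simp add: tensor_map_pure[OF linear_map_id inner] tensor_map_pure[OF lin linear_map_id] alg_pure)
  qed
  have "(\<forall>t\<in>carrier (tensor k A ?AA). f t = g t) \<longleftrightarrow>
      (\<forall>x\<in>carrier A. \<forall>y\<in>carrier A. \<forall>z\<in>carrier A.
        \<Gamma> (x \<otimes>\<^bsub>A\<^esub> (y \<otimes>\<^bsub>A\<^esub> z)) = left_action k A x (right_action k A z (\<Gamma> y)))" (is "?L \<longleftrightarrow> ?R")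
  proof
    assume L: ?L
    show ?R
    proof (intro ballI)
      fix x y z assume xyz: "x \<in> carrier A" "y \<in> carrier A" "z \<in> carrier A"
      then have "f (pure_tensor k A ?AA x (pure_tensor k A A y z)) =
          g (pure_tensor k A ?AA x (pure_tensor k A A y z))"
        by (intro L[rule_format] pure_tensor_closed module_alg module_tensor)
      then show "\<Gamma> (x \<otimes>\<^bsub>A\<^esub> (y \<otimes>\<^bsub>A\<^esub> z)) = left_action k A x (right_action k A z (\<Gamma> y))"
        using xyz by (simp add: fp gp)
    qed
  next
    assume R: ?R
    show ?L
    proof (rule tensor_extI[OF module_alg module_tensor[OF module_alg module_alg] f g])
      fix x s assume x: "x \<in> carrier A" and "s \<in> carrier ?AA"
      have "\<forall>s\<in>carrier ?AA. f (pure_tensor k A ?AA x s) = g (pure_tensor k A ?AA x s)"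
        by (rule tensor_extI[where X = ?AA];
            ((rule linear_map_compose[OF f] linear_map_compose[OF g] alg_linear x)+)?)
          (use x R in \<open>simp_all add: fp gp\<close>)
      then show "f (pure_tensor k A ?AA x s) = g (pure_tensor k A ?AA x s)"
        using \<open>s \<in> _\<close> by blast
    qed
  qed
  also have "\<dots> \<longleftrightarrow> (\<forall>x\<in>carrier A. \<forall>y\<in>carrier A.
        \<Gamma> (x \<otimes>\<^bsub>A\<^esub> y) = left_action k A x (\<Gamma> y) \<and> \<Gamma> (x \<otimes>\<^bsub>A\<^esub> y) = right_action k A y (\<Gamma> x))"
    (is "?R \<longleftrightarrow> ?S")
  proof
    assume R: ?R
    show ?S
    proof (intro ballI conjI)
      fix x y assume "x \<in> carrier A" "y \<in> carrier A"
      then show "\<Gamma> (x \<otimes>\<^bsub>A\<^esub> y) = left_action k A x (\<Gamma> y)" "\<Gamma> (x \<otimes>\<^bsub>A\<^esub> y) = right_action k A y (\<Gamma> x)"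
        using R[rule_format, of x y "\<one>\<^bsub>A\<^esub>"] R[rule_format, of "\<one>\<^bsub>A\<^esub>" x y] \<Gamma>(2)
        by (simp_all add: right_action_one left_action_one right_action_closed)
    qed
  next
    assume S: ?S
    show ?R
    proof (intro ballI)
      fix x y z assume xyz: "x \<in> carrier A" "y \<in> carrier A" "z \<in> carrier A"
      then have "\<Gamma> (x \<otimes>\<^bsub>A\<^esub> (y \<otimes>\<^bsub>A\<^esub> z)) = left_action k A x (\<Gamma> (y \<otimes>\<^bsub>A\<^esub> z))"
        using S by blast
      also have "\<Gamma> (y \<otimes>\<^bsub>A\<^esub> z) = right_action k A z (\<Gamma> y)"
        using S xyz by blast
      finally show "\<Gamma> (x \<otimes>\<^bsub>A\<^esub> (y \<otimes>\<^bsub>A\<^esub> z)) = left_action k A x (right_action k A z (\<Gamma> y))" .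
    qed
  qed
  finally show ?thesis
    using lin by (auto simp: separability_section_def bimodule_hom_def f_def g_def)
qed

text \<open>Evaluated at \<open>x \<otimes> y\<close>, the two composites are \<open>f(x) y\<close>
  and \<open>x f(y)\<close>, so the Frobenius identities are right and left linearity of
  \<open>f\<close>.\<close>

lemma bimodule_hom_iff_frobenius:
  assumes lin: "linear_map k A (tensor k A A) f"
  shows "bimodule_hom k A f \<longleftrightarrow> (\<forall>t\<in>carrier (tensor k A A).
      f (nabla A t) = tensor_map k A A id (nabla A) (tensor_assoc k A A A (tensor_map k (tensor k A A) A f id t)) \<and>
      f (nabla A t) = tensor_map k A A (nabla A) id (tensor_unassoc k A A A (tensor_map k A (tensor k A A) id f t)))"
    (is "_ \<longleftrightarrow> (\<forall>t\<in>_. _ = ?r t \<and> _ = ?l t)")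
proof -
  let ?AA = "tensor k A A"
  note f = linear_map_compose[OF lin] linear_map_closed[OF lin]
  have n: "linear_map k ?AA A (nabla A)"
    using linear_map_nabla[OF linear_map_ident] .
  have lhs: "linear_map k ?AA ?AA (\<lambda>t. f (nabla A t))"
    by (rule f alg_linear)+
  have r: "linear_map k ?AA ?AA ?r" and l: "linear_map k ?AA ?AA ?l"
    by (rule alg_linear n lin)+
  have rp: "?r (pure_tensor k A A x y) = right_action k A y (f x)"
    and lp: "?l (pure_tensor k A A x y) = left_action k A x (f y)"
    if xy: "x \<in> carrier A" "y \<in> carrier A" for x y
  proof -
    have "\<forall>s\<in>carrier ?AA. tensor_map k A A id (nabla A) (tensor_assoc k A A A (pure_tensor k ?AA A s y)) =
        right_action k A y s"
      by (rule tensor_extI[where X = ?AA]; ((rule alg_linear n xy)+)?)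
        (use xy in \<open>simp_all add: alg_pure tensor_map_pure[OF linear_map_id n]\<close>)
    then show "?r (pure_tensor k A A x y) = right_action k A y (f x)"
      using xy f(2) by (simp add: tensor_map_pure[OF lin linear_map_id] alg_pure)
    have "\<forall>s\<in>carrier ?AA. tensor_map k A A (nabla A) id (tensor_unassoc k A A A (pure_tensor k A ?AA x s)) =
        left_action k A x s"
      by (rule tensor_extI[where X = ?AA]; ((rule alg_linear n xy)+)?)
        (use xy in \<open>simp_all add: alg_pure tensor_map_pure[OF n linear_map_id]\<close>)
    then show "?l (pure_tensor k A A x y) = left_action k A x (f y)"
      using xy f(2) by (simp add: tensor_map_pure[OF linear_map_id lin] alg_pure)
  qed
  have "(\<forall>t\<in>carrier ?AA. f (nabla A t) = ?r t \<and> f (nabla A t) = ?l t) \<longleftrightarrow>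
      (\<forall>x\<in>carrier A. \<forall>y\<in>carrier A.
        f (x \<otimes>\<^bsub>A\<^esub> y) = left_action k A x (f y) \<and> f (x \<otimes>\<^bsub>A\<^esub> y) = right_action k A y (f x))"
    (is "?L \<longleftrightarrow> ?R")
  proof
    assume L: ?L
    show ?R
    proof (intro ballI)
      fix x y assume xy: "x \<in> carrier A" "y \<in> carrier A"
      then have "pure_tensor k A A x y \<in> carrier ?AA"
        by (simp add: alg_pure)
      then show "f (x \<otimes>\<^bsub>A\<^esub> y) = left_action k A x (f y) \<and> f (x \<otimes>\<^bsub>A\<^esub> y) = right_action k A y (f x)"
        using L xy rp lp nabla_pure by metis
    qed
  next
    assume R: ?R
    have R1: "f (x \<otimes>\<^bsub>A\<^esub> y) = right_action k A y (f x)" and R2: "f (x \<otimes>\<^bsub>A\<^esub> y) = left_action k A x (f y)"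
      if "x \<in> carrier A" "y \<in> carrier A" for x y
      using R that by blast+
    have "\<forall>t\<in>carrier ?AA. f (nabla A t) = ?r t"
      by (rule tensor_extI[OF module_alg module_alg lhs r]) (simp add: rp nabla_pure R1)
    moreover have "\<forall>t\<in>carrier ?AA. f (nabla A t) = ?l t"
      by (rule tensor_extI[OF module_alg module_alg lhs l]) (simp add: lp nabla_pure R2)
    ultimately show ?L
      by blast
  qed
  then show ?thesis
    using lin by (simp add: bimodule_hom_def)
qed

lemma bimodule_hom_one:
  assumes "bimodule_hom k A f" "a \<in> carrier A"
  shows "left_action k A a (f \<one>\<^bsub>A\<^esub>) = f a" "right_action k A a (f \<one>\<^bsub>A\<^esub>) = f a"
  using assms unfolding bimodule_hom_def by (metis one_closed r_one, metis one_closed l_one)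

text \<open>Both laws are associativity: \<open>(x y) e = x (y e)\<close> and
  \<open>e (x y) = (e x) y\<close>. Linearity of \<open>f\<close> is inherited from
  \<open>a \<mapsto> a e\<close>, and the double description of \<open>f\<close> expresses that
  \<open>e\<close> is central.\<close>

lemma bimodule_homI:
  assumes e: "e \<in> carrier (tensor k A A)"
    and l: "\<And>a. a \<in> carrier A \<Longrightarrow> f a = left_action k A a e"
    and r: "\<And>a. a \<in> carrier A \<Longrightarrow> f a = right_action k A a e"
  shows "bimodule_hom k A f"
proof -
  have "linear_map k A (tensor k A A) f"
    by (rule iffD2[OF linear_map_cong[OF module_alg l] linear_map_left_action_arg[OF e]])
  moreover have "f (x \<otimes>\<^bsub>A\<^esub> y) = left_action k A x (f y)" if "x \<in> carrier A" "y \<in> carrier A" for x y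
    using that e by (simp add: l left_action_left_action)
  moreover have "f (x \<otimes>\<^bsub>A\<^esub> y) = right_action k A y (f x)" if "x \<in> carrier A" "y \<in> carrier A" for x y
    using that e by (simp add: r right_action_right_action)
  ultimately show ?thesis
    by (simp add: bimodule_hom_def)
qed

text \<open>With \<open>e = f 1\<close>, both sides are \<open>\<Sum> e\<^sub>1 \<otimes> e\<^sub>2 e'\<^sub>1 \<otimes> e'\<^sub>2\<close> multiplied by \<open>a\<close>; \<open>G\<close> below is
  the bilinear form of this expression in the two copies of \<open>e\<close>.\<close>

lemma bimodule_hom_coassociative:
  assumes f: "bimodule_hom k A f" and a: "a \<in> carrier A"
  shows "tensor_assoc k A A A (tensor_map k (tensor k A A) A f id (f a)) =
    tensor_map k A (tensor k A A) id f (f a)"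
proof -
  let ?AA = "tensor k A A"
  let ?T = "tensor k A ?AA"
  have lin: "linear_map k A ?AA f"
    using f by (simp add: bimodule_hom_def)
  note cl = linear_map_closed[OF lin]
  have e: "f \<one>\<^bsub>A\<^esub> \<in> carrier ?AA"
    by (simp add: cl)
  have n: "linear_map k ?AA A (nabla A)"
    using linear_map_nabla[OF linear_map_ident] .
  \<comment> \<open>The map \<open>x \<otimes> (y \<otimes> z) \<mapsto> x y \<otimes> z\<close>:
    the right component of the first copy acts on the left of the second.\<close>
  define h where "h = (\<lambda>x. tensor_map k A A (nabla A) id (tensor_unassoc k A A A x))"
  have h: "linear_map k ?T ?AA h"
    unfolding h_def by (rule alg_linear n)+
  define G where "G = (\<lambda>s t. tensor_map k A ?AA id h (tensor_assoc k A A ?AA (pure_tensor k ?AA ?AA s t)))"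
  have G1: "linear_map k ?AA ?T (\<lambda>s. G s t)" and G2: "linear_map k ?AA ?T (\<lambda>s. G t s)"
    if "t \<in> carrier ?AA" for t
    unfolding G_def by (rule alg_linear h that)+
  have h_pure: "h (pure_tensor k A ?AA x s) = left_action k A x s" if x: "x \<in> carrier A" and "s \<in> carrier ?AA" for x s
  proof -
    have "\<forall>s\<in>carrier ?AA. h (pure_tensor k A ?AA x s) = left_action k A x s"
      unfolding h_def
      by (rule tensor_extI[where X = ?AA]; ((rule alg_linear n x)+)?)
        (use x in \<open>simp_all add: alg_pure tensor_map_pure[OF n linear_map_id]\<close>)
    then show ?thesis
      using that by blast
  qed
  have G_pure: "G (pure_tensor k A A u v) t = pure_tensor k A ?AA u (left_action k A v t)"
    if "u \<in> carrier A" "v \<in> carrier A" "t \<in> carrier ?AA" for u v t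
    using that by (simp add: G_def alg_pure tensor_map_pure[OF linear_map_id h] h_pure)
  have "\<forall>s\<in>carrier ?AA. tensor_map k A ?AA id f s = G s (f \<one>\<^bsub>A\<^esub>)"
    by (rule tensor_extI[where X = ?T]; ((rule G1 alg_linear lin e)+)?)
      (simp_all add: tensor_map_pure[OF linear_map_id lin] alg_pure G_pure e bimodule_hom_one[OF f])
  then have 1: "tensor_map k A ?AA id f (f a) = G (f a) (f \<one>\<^bsub>A\<^esub>)"
    using cl[OF a] by blast
  \<comment> \<open>Here \<open>f p\<close> is expanded as \<open>e p\<close>, whereas the previous
    fact used the expansion \<open>v e\<close> of \<open>f v\<close>. Right multiplication by
    \<open>p\<close> in the first copy of \<open>e\<close> and left multiplication by
    \<open>p\<close> in the second land in the same middle factor.\<close>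
  have 2: "tensor_assoc k A A A (pure_tensor k ?AA A (f p) q) = G (f \<one>\<^bsub>A\<^esub>) (pure_tensor k A A p q)"
    if pq: "p \<in> carrier A" "q \<in> carrier A" for p q
  proof -
    have "\<forall>s\<in>carrier ?AA. tensor_assoc k A A A (pure_tensor k ?AA A (right_action k A p s) q) =
        G s (pure_tensor k A A p q)"
      by (rule tensor_extI[where X = ?T]; ((rule G1 alg_linear pure_tensor_closed e pq)+)?)
        (use pq in \<open>simp_all add: alg_pure G_pure\<close>)
    then show ?thesis
      using e bimodule_hom_one(2)[OF f pq(1)] by force
  qed
  have "\<forall>t\<in>carrier ?AA. tensor_assoc k A A A (tensor_map k ?AA A f id t) = G (f \<one>\<^bsub>A\<^esub>) t"
    by (rule tensor_extI[where X = ?T]; ((rule G2 alg_linear lin e)+)?)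
      (simp_all add: tensor_map_pure[OF lin linear_map_id] alg_pure 2)
  then have 3: "tensor_assoc k A A A (tensor_map k ?AA A f id (f a)) = G (f \<one>\<^bsub>A\<^esub>) (f a)"
    using cl[OF a] by blast
  \<comment> \<open>The factor \<open>a\<close> moves across the middle: it leaves the first copy on
    the right and enters the second on the left, where \<open>a e = f a\<close>.\<close>
  have "\<forall>s\<in>carrier ?AA. G (right_action k A a s) (f \<one>\<^bsub>A\<^esub>) = G s (f a)"
  proof (rule tensor_extI[where X = ?T]; ((rule linear_map_compose[OF G1] G1 alg_linear a cl e one_closed)+)?)
    fix u v assume uv: "u \<in> carrier A" "v \<in> carrier A"
    have "left_action k A (v \<otimes>\<^bsub>A\<^esub> a) (f \<one>\<^bsub>A\<^esub>) = left_action k A v (left_action k A a (f \<one>\<^bsub>A\<^esub>))"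
      using left_action_left_action[OF uv(2) a] e by simp
    then have "left_action k A (v \<otimes>\<^bsub>A\<^esub> a) (f \<one>\<^bsub>A\<^esub>) = left_action k A v (f a)"
      by (simp only: bimodule_hom_one(1)[OF f a])
    then show "G (right_action k A a (pure_tensor k A A u v)) (f \<one>\<^bsub>A\<^esub>) = G (pure_tensor k A A u v) (f a)"
      using uv a e cl by (simp add: alg_pure G_pure)
  qed
  then have "G (right_action k A a (f \<one>\<^bsub>A\<^esub>)) (f \<one>\<^bsub>A\<^esub>) = G (f \<one>\<^bsub>A\<^esub>) (f a)"
    using e by blast
  then show ?thesis
    by (simp add: 1 3 bimodule_hom_one(2)[OF f a])
qed

end

section \<open>Functionals on tensor products\<close>

lemma bilinear_map_functional_left:
  assumes "linear_functional k U \<epsilon>" "module k U" "module k V"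
  shows "bilinear_map k U V V (\<lambda>x y. \<epsilon> x \<odot>\<^bsub>V\<^esub> y)"
proof -
  interpret U: module k U by (rule assms)
  interpret V: module k V by (rule assms)
  have "r \<otimes>\<^bsub>k\<^esub> s = s \<otimes>\<^bsub>k\<^esub> r" if "r \<in> carrier k" "s \<in> carrier k" for r s
    using that by (rule U.m_comm)
  then show ?thesis
    using assms(1)
    by (auto intro!: bilinear_mapI linear_mapI
        simp: linear_functional_def Pi_iff V.smult_l_distr V.smult_r_distr V.smult_assoc1[symmetric])
qed

lemma bilinear_map_functional_right:
  assumes "linear_functional k U \<epsilon>" "module k U" "module k V"
  shows "bilinear_map k V U V (\<lambda>x y. \<epsilon> y \<odot>\<^bsub>V\<^esub> x)"
  using bilinear_map_functional_left[OF assms] by (simp add: bilinear_map_def)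

lemma balanced_map_functionals:
  assumes "linear_functional k U \<epsilon>" "linear_functional k V \<delta>" "module k U" "module k V"
  shows "balanced_map k U V k (\<lambda>a b. \<epsilon> a \<otimes>\<^bsub>k\<^esub> \<delta> b)"
proof -
  interpret U: module k U by (rule assms)
  show ?thesis
    using assms(1,2) U.R.abelian_group_axioms
    by (auto simp: balanced_map_def linear_functional_def Pi_iff U.R.l_distr U.R.r_distr U.m_ac)
qed

text \<open>The target \<open>k\<close> is a ring record, so \<open>linear_map_tensor_lift\<close>
  does not apply. Additivity comes from the balanced lift, and homogeneity is shown on pure
  tensors.\<close>

lemma linear_functional_tensor_lift:
  assumes \<epsilon>: "linear_functional k U \<epsilon>" and \<delta>: "linear_functional k V \<delta>"
    and U: "module k U" and V: "module k V"
  shows "linear_functional k (tensor k U V) (tensor_lift k (\<lambda>a b. \<epsilon> a \<otimes>\<^bsub>k\<^esub> \<delta> b))"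
proof -
  interpret U: module k U by (rule U)
  interpret V: module k V by (rule V)
  interpret T: module k "tensor k U V" by (rule module_tensor[OF U V])
  let ?l = "tensor_lift k (\<lambda>a b. \<epsilon> a \<otimes>\<^bsub>k\<^esub> \<delta> b)"
  note bal = balanced_map_functionals[OF assms]
  note lift = tensor_lift_closed[OF U V bal] tensor_lift_add[OF U V bal] tensor_lift_pure[OF U V bal]
  have "?l (r \<odot>\<^bsub>tensor k U V\<^esub> t) = r \<otimes>\<^bsub>k\<^esub> ?l t"
    if r: "r \<in> carrier k" and "t \<in> carrier (tensor k U V)" for r t
    using that(2)
  proof (induction rule: tensor_induct[OF U V, consumes 1, case_names pure add])
    case (pure v w)
    then show ?case
      using r \<epsilon> \<delta>
      by (simp add: smult_pure_tensor[OF U V] lift linear_functional_def Pi_iff U.R.m_assoc)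
  next
    case (add s t)
    then show ?case
      using r by (simp add: T.smult_r_distr lift U.R.r_distr)
  qed
  then show ?thesis
    using lift(1,2) by (simp add: linear_functional_def)
qed

section \<open>The twisted tensor product algebra\<close>

text \<open>The algebra structures and \<open>\<tau>\<close> alone, so that the product algebra and
  its tensor square serve both the comultiplications and the sections.\<close>

locale twisting = A: unital_alg k A + B: unital_alg k B
  for k :: "('k, 'r) ring_scheme" and A :: "('k, 'a, 'm) frobenius_scheme"
    and B :: "('k, 'b, 'n) frobenius_scheme" +
  fixes \<tau> :: "('b, 'a) tens \<Rightarrow> ('a, 'b) tens"
  assumes twisting: "twisting_map k A B \<tau>"
begin

abbreviation "AB \<equiv> tensor k A B"
abbreviation "BA \<equiv> tensor k B A"
abbreviation "C \<equiv> twisted_tensor_product k A B \<tau>"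
abbreviation "CC \<equiv> tensor k AB AB"
abbreviation "pAB \<equiv> pure_tensor k A B"
abbreviation "pBA \<equiv> pure_tensor k B A"
abbreviation "pCC \<equiv> pure_tensor k AB AB"

definition \<iota>A :: "'a \<Rightarrow> ('a, 'b) tens" where "\<iota>A a = pAB a \<one>\<^bsub>B\<^esub>"
definition \<iota>B :: "'b \<Rightarrow> ('a, 'b) tens" where "\<iota>B b = pAB \<one>\<^bsub>A\<^esub> b"

text \<open>The left action of \<open>A\<close> and the right action of \<open>B\<close> on
  \<open>A \<otimes> B\<close>, both independent of \<open>\<tau>\<close>. In these terms the
  product of \<open>a \<otimes> b\<close> and \<open>a' \<otimes> b'\<close> is
  \<open>a \<tau>(b \<otimes> a') b'\<close>.\<close>

definition outer :: "'a \<Rightarrow> 'b \<Rightarrow> ('a, 'b) tens \<Rightarrow> ('a, 'b) tens" where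
  "outer a b = tensor_map k A B (\<lambda>x. a \<otimes>\<^bsub>A\<^esub> x) (\<lambda>y. y \<otimes>\<^bsub>B\<^esub> b)"

lemma linear_\<tau>: "linear_map k BA AB \<tau>"
  and bij_\<tau>: "bij_betw \<tau> (carrier BA) (carrier AB)"
  and \<tau>_one_right: "b \<in> carrier B \<Longrightarrow> \<tau> (pBA b \<one>\<^bsub>A\<^esub>) = \<iota>B b"
  and \<tau>_one_left: "a \<in> carrier A \<Longrightarrow> \<tau> (pBA \<one>\<^bsub>B\<^esub> a) = \<iota>A a"
  and \<tau>_square: "t \<in> carrier (tensor k (tensor k B B) (tensor k A A)) \<Longrightarrow>
      \<tau> (tensor_map k B A (nabla B) (nabla A) t) =
      tensor_map k A B (nabla A) (nabla B) (twist_square k A B \<tau> t)"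
  using twisting by (simp_all add: twisting_map_def \<iota>A_def \<iota>B_def)

lemma mult_C: "x \<otimes>\<^bsub>C\<^esub> y = tensor_map k A B (nabla A) (nabla B) (tensor_middle k A B A B \<tau> (pCC x y))"
  and one_C: "\<one>\<^bsub>C\<^esub> = pAB \<one>\<^bsub>A\<^esub> \<one>\<^bsub>B\<^esub>"
  and carrier_C: "carrier C = carrier AB"
  and zero_C: "\<zero>\<^bsub>C\<^esub> = \<zero>\<^bsub>AB\<^esub>"
  and add_C: "x \<oplus>\<^bsub>C\<^esub> y = x \<oplus>\<^bsub>AB\<^esub> y"
  and smult_C: "r \<odot>\<^bsub>C\<^esub> x = r \<odot>\<^bsub>AB\<^esub> x"
  and comult_C: "comult C = twisted_cotensor k A B \<tau> (comult A) (comult B)"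
  and counit_C: "counit C = tensor_lift k (\<lambda>a b. counit A a \<otimes>\<^bsub>k\<^esub> counit B b)"
  by (simp_all add: twisted_tensor_product_def)

lemma linear_map_to_C: "linear_map k X C f \<longleftrightarrow> linear_map k X AB f"
  by (simp add: linear_map_def carrier_C add_C smult_C)

lemma linear_map_from_C: "linear_map k C X f \<longleftrightarrow> linear_map k AB X f"
  by (simp add: linear_map_def carrier_C add_C smult_C)

lemma tensor_class_C: "tensor_class k C C = tensor_class k AB AB"
  by (rule ext) (simp add: tensor_class_def tensor_relations_def carrier_C add_C smult_C)

lemma pure_tensor_C: "pure_tensor k C C = pCC"
  by (intro ext) (simp add: pure_tensor_def tensor_class_C)

text \<open>\<open>C\<close> and \<open>AB\<close> are different records on one space, and a tensor
  product looks only at carrier, addition and scalars. Through this equation the results about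
  \<open>unital_alg\<close>, which speak of \<open>C\<close>, are restated for \<open>CC\<close>,
  where \<open>\<tau>\<close> and the rebracketings act.\<close>

lemma tensor_C: "tensor k C C = CC"
proof -
  have "tensor_relations k C C = tensor_relations k AB AB"
    by (simp add: tensor_relations_def carrier_C add_C smult_C)
  then show ?thesis
    by (simp only: tensor_def[of k C C] tensor_def[of k AB AB] Let_def tensor_class_C carrier_C smult_C)
qed

lemmas linear_\<tau>_compose = linear_map_compose[OF linear_\<tau>]

lemmas modules = A.module_alg B.module_alg module_tensor

lemma linear_map_outer:
  "linear_map k X AB h \<Longrightarrow> a \<in> carrier A \<Longrightarrow> b \<in> carrier B \<Longrightarrow>
    linear_map k X AB (\<lambda>x. outer a b (h x))"
  unfolding outer_def
  by (rule linear_map_tensor_map[OF A.linear_map_mult_left[OF linear_map_ident]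
        B.linear_map_mult_right[OF linear_map_ident]]) (simp_all add: modules)

lemma outer_pure:
  "a \<in> carrier A \<Longrightarrow> b \<in> carrier B \<Longrightarrow> x \<in> carrier A \<Longrightarrow> y \<in> carrier B \<Longrightarrow>
    outer a b (pAB x y) = pAB (a \<otimes>\<^bsub>A\<^esub> x) (y \<otimes>\<^bsub>B\<^esub> b)"
  unfolding outer_def
  by (rule tensor_map_pure[OF A.linear_map_mult_left[OF linear_map_ident]
        B.linear_map_mult_right[OF linear_map_ident]]) (simp_all add: modules)

lemma linear_nabla_A: "linear_map k (tensor k A A) A (nabla A)"
  and linear_nabla_B: "linear_map k (tensor k B B) B (nabla B)"
  using A.linear_map_nabla[OF linear_map_ident] B.linear_map_nabla[OF linear_map_ident] .

lemma linear_map_multiply_middle: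
  assumes "linear_map k X CC h"
  shows "linear_map k X AB (\<lambda>x. tensor_map k A B (nabla A) (nabla B) (tensor_middle k A B A B \<tau> (h x)))"
  by (rule linear_map_tensor_map[OF linear_nabla_A linear_nabla_B] linear_map_tensor_middle
      linear_\<tau> assms modules)+

lemma linear_map_mult_C_left:
  "linear_map k X AB h \<Longrightarrow> c \<in> carrier AB \<Longrightarrow> linear_map k X AB (\<lambda>x. c \<otimes>\<^bsub>C\<^esub> h x)"
  unfolding mult_C by (rule linear_map_multiply_middle linear_intros modules | assumption)+

lemma linear_map_mult_C_right:
  "linear_map k X AB h \<Longrightarrow> c \<in> carrier AB \<Longrightarrow> linear_map k X AB (\<lambda>x. h x \<otimes>\<^bsub>C\<^esub> c)"
  unfolding mult_C by (rule linear_map_multiply_middle linear_intros modules | assumption)+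

lemma linear_map_\<iota>A: "linear_map k X A h \<Longrightarrow> linear_map k X AB (\<lambda>x. \<iota>A (h x))"
  unfolding \<iota>A_def by (rule linear_map_pure_left) (simp_all add: modules)

lemma linear_map_\<iota>B: "linear_map k X B h \<Longrightarrow> linear_map k X AB (\<lambda>x. \<iota>B (h x))"
  unfolding \<iota>B_def by (rule linear_map_pure_right) (simp_all add: modules)

lemmas twist_linear = linear_intros linear_\<tau>_compose linear_map_outer A.linear_map_nabla B.linear_map_nabla
  linear_map_mult_C_left linear_map_mult_C_right linear_map_\<iota>A linear_map_\<iota>B
  A.linear_map_mult_left A.linear_map_mult_right B.linear_map_mult_left B.linear_map_mult_right
  modules

lemma \<tau>_closed: "t \<in> carrier BA \<Longrightarrow> \<tau> t \<in> carrier AB"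
  by (rule linear_map_closed[OF linear_\<tau>])

lemma outer_closed:
  "a \<in> carrier A \<Longrightarrow> b \<in> carrier B \<Longrightarrow> s \<in> carrier AB \<Longrightarrow> outer a b s \<in> carrier AB"
  by (rule linear_map_closed[OF linear_map_outer[OF linear_map_ident]])

lemma mult_C_closed: "x \<in> carrier AB \<Longrightarrow> y \<in> carrier AB \<Longrightarrow> x \<otimes>\<^bsub>C\<^esub> y \<in> carrier AB"
  by (rule linear_map_closed[OF linear_map_mult_C_left[OF linear_map_ident]])

lemma \<iota>A_closed: "a \<in> carrier A \<Longrightarrow> \<iota>A a \<in> carrier AB"
  by (rule linear_map_closed[OF linear_map_\<iota>A[OF linear_map_ident]])

lemma \<iota>B_closed: "b \<in> carrier B \<Longrightarrow> \<iota>B b \<in> carrier AB"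
  by (rule linear_map_closed[OF linear_map_\<iota>B[OF linear_map_ident]])

lemmas twist_closed = pure_tensor_closed \<tau>_closed outer_closed mult_C_closed \<iota>A_closed \<iota>B_closed

lemmas twist_pure = A.nabla_pure B.nabla_pure tensor_assoc_pure tensor_unassoc_pure outer_pure
  tensor_insert_pure modules twist_closed

lemma mult_C_pure:
  assumes a: "a \<in> carrier A" and b: "b \<in> carrier B" and a': "a' \<in> carrier A" and b': "b' \<in> carrier B"
  shows "pAB a b \<otimes>\<^bsub>C\<^esub> pAB a' b' = outer a b' (\<tau> (pBA b a'))"
proof -
  have "\<forall>s\<in>carrier AB. tensor_map k A B (nabla A) (nabla B) (tensor_insert k A B A B a b' s) = outer a b' s"
    by (rule tensor_extI[where X = AB]; ((rule linear_nabla_A linear_nabla_B twist_linear assms)+)?)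
      (use assms in \<open>simp_all add: twist_pure tensor_map_pure[OF linear_nabla_A linear_nabla_B]\<close>)
  then show ?thesis
    using assms by (simp add: mult_C tensor_middle_pure[OF _ _ _ _ linear_\<tau>] twist_pure)
qed

lemma outer_outer:
  assumes "a \<in> carrier A" "b \<in> carrier B" "a' \<in> carrier A" "b' \<in> carrier B"
  shows "\<forall>s\<in>carrier AB. outer a b (outer a' b' s) = outer (a \<otimes>\<^bsub>A\<^esub> a') (b' \<otimes>\<^bsub>B\<^esub> b) s"
  by (rule tensor_extI[where X = AB]; ((rule twist_linear A.m_closed B.m_closed assms)+)?)
    (use assms in \<open>simp_all add: twist_pure A.m_assoc B.m_assoc\<close>)

lemma outer_one: "\<forall>s\<in>carrier AB. outer \<one>\<^bsub>A\<^esub> \<one>\<^bsub>B\<^esub> s = s"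
  by (rule tensor_extI[where X = AB]; ((rule twist_linear A.one_closed B.one_closed)+)?)
    (simp_all add: twist_pure)

lemma mult_\<iota>A_left:
  assumes "a \<in> carrier A"
  shows "\<forall>s\<in>carrier AB. \<iota>A a \<otimes>\<^bsub>C\<^esub> s = outer a \<one>\<^bsub>B\<^esub> s"
  by (rule tensor_extI[where X = AB]; ((rule twist_linear \<iota>A_closed B.one_closed assms)+)?)
    (use assms in \<open>simp_all add: \<iota>A_def mult_C_pure \<tau>_one_left twist_pure\<close>)

lemma mult_\<iota>B_right:
  assumes "b \<in> carrier B"
  shows "\<forall>s\<in>carrier AB. s \<otimes>\<^bsub>C\<^esub> \<iota>B b = outer \<one>\<^bsub>A\<^esub> b s"
  by (rule tensor_extI[where X = AB]; ((rule twist_linear \<iota>B_closed A.one_closed assms)+)?)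
    (use assms in \<open>simp_all add: \<iota>B_def mult_C_pure \<tau>_one_right twist_pure\<close>)

lemma mult_pure_left:
  assumes "a \<in> carrier A" "b \<in> carrier B"
  shows "\<forall>s\<in>carrier AB. pAB a b \<otimes>\<^bsub>C\<^esub> s = outer a \<one>\<^bsub>B\<^esub> (\<iota>B b \<otimes>\<^bsub>C\<^esub> s)"
  by (rule tensor_extI[where X = AB]; ((rule twist_linear twist_closed A.one_closed B.one_closed assms)+)?)
    (use assms in \<open>simp_all add: \<iota>B_def mult_C_pure twist_pure outer_outer\<close>)

lemma mult_pure_right:
  assumes "a \<in> carrier A" "b \<in> carrier B"
  shows "\<forall>s\<in>carrier AB. s \<otimes>\<^bsub>C\<^esub> pAB a b = outer \<one>\<^bsub>A\<^esub> b (s \<otimes>\<^bsub>C\<^esub> \<iota>A a)"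
  by (rule tensor_extI[where X = AB]; ((rule twist_linear twist_closed A.one_closed B.one_closed assms)+)?)
    (use assms in \<open>simp_all add: \<iota>A_def mult_C_pure twist_pure outer_outer\<close>)

text \<open>The square of \<open>\<tau>\<close> at
  \<open>(b \<otimes> b') \<otimes> (a \<otimes> 1)\<close>: crossing the unit is trivial, so
  \<open>b'\<close> crosses \<open>a\<close> and then \<open>b\<close> crosses the resulting
  component in \<open>A\<close>. Written in \<open>C\<close> this is
  \<open>b (b' a) = (b b') a\<close>.\<close>

lemma \<tau>_pentagon_B:
  assumes b: "b \<in> carrier B" and b': "b' \<in> carrier B" and a: "a \<in> carrier A"
  shows "\<iota>B b \<otimes>\<^bsub>C\<^esub> \<tau> (pBA b' a) = \<tau> (pBA (b \<otimes>\<^bsub>B\<^esub> b') a)"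
proof -
  have "\<forall>s\<in>carrier AB. tensor_map k A B (nabla A) (nabla B) (tensor_middle k A B A B \<tau>
      (tensor_map k AB AB \<tau> \<tau> (tensor_insert k B B A A b \<one>\<^bsub>A\<^esub> s))) = \<iota>B b \<otimes>\<^bsub>C\<^esub> s"
    by (rule tensor_extI[where X = AB];
        ((rule linear_map_multiply_middle linear_\<tau> twist_linear twist_closed A.one_closed assms)+)?)
      (use assms in \<open>simp_all add: twist_pure tensor_map_pure[OF linear_\<tau> linear_\<tau>] \<tau>_one_right
        mult_\<iota>B_right mult_C_pure[OF A.one_closed b, folded \<iota>B_def] flip: mult_C\<close>)
  moreover have "\<tau> (pBA (b \<otimes>\<^bsub>B\<^esub> b') a) = \<tau> (tensor_map k B A (nabla B) (nabla A)
      (pure_tensor k (tensor k B B) (tensor k A A) (pure_tensor k B B b b') (pure_tensor k A A a \<one>\<^bsub>A\<^esub>)))"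
    using assms by (simp add: tensor_map_pure[OF linear_nabla_B linear_nabla_A] twist_pure)
  ultimately show ?thesis
    using assms
    by (simp add: \<tau>_square twist_pure twist_square_def tensor_middle_pure[OF _ _ _ _ linear_\<tau>])
qed

text \<open>The square at \<open>(1 \<otimes> b) \<otimes> (a \<otimes> a')\<close>, with the unit
  now on the side of \<open>B\<close>.\<close>

lemma \<tau>_pentagon_A:
  assumes b: "b \<in> carrier B" and a: "a \<in> carrier A" and a': "a' \<in> carrier A"
  shows "\<tau> (pBA b a) \<otimes>\<^bsub>C\<^esub> \<iota>A a' = \<tau> (pBA b (a \<otimes>\<^bsub>A\<^esub> a'))"
proof -
  have "\<forall>s\<in>carrier AB. tensor_map k A B (nabla A) (nabla B) (tensor_middle k A B A B \<tau>
      (tensor_map k AB AB \<tau> \<tau> (tensor_insert k B B A A \<one>\<^bsub>B\<^esub> a' s))) = s \<otimes>\<^bsub>C\<^esub> \<iota>A a'"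
    by (rule tensor_extI[where X = AB];
        ((rule linear_map_multiply_middle linear_\<tau> twist_linear twist_closed B.one_closed assms)+)?)
      (use assms in \<open>simp_all add: twist_pure tensor_map_pure[OF linear_\<tau> linear_\<tau>] \<tau>_one_left
        mult_\<iota>A_left mult_C_pure[OF _ _ a' B.one_closed, folded \<iota>A_def] flip: mult_C\<close>)
  moreover have "\<tau> (pBA b (a \<otimes>\<^bsub>A\<^esub> a')) = \<tau> (tensor_map k B A (nabla B) (nabla A)
      (pure_tensor k (tensor k B B) (tensor k A A) (pure_tensor k B B \<one>\<^bsub>B\<^esub> b) (pure_tensor k A A a a')))"
    using assms by (simp add: tensor_map_pure[OF linear_nabla_B linear_nabla_A] twist_pure)
  ultimately show ?thesis
    using assms
    by (simp add: \<tau>_square twist_pure twist_square_def tensor_middle_pure[OF _ _ _ _ linear_\<tau>])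
qed

text \<open>With \<open>s = \<tau>(b1 \<otimes> a2)\<close> and
  \<open>t = \<tau>(b2 \<otimes> a3)\<close> both bracketings equal \<open>a1 (s t) b3\<close>: the
  left one because \<open>\<tau>\<close> respects products in \<open>B\<close>, the right one
  because it respects products in \<open>A\<close>.\<close>

lemma mult_C_assoc_pure:
  assumes c: "a1 \<in> carrier A" "b1 \<in> carrier B" "a2 \<in> carrier A" "b2 \<in> carrier B" "a3 \<in> carrier A" "b3 \<in> carrier B"
  shows "pAB a1 b1 \<otimes>\<^bsub>C\<^esub> pAB a2 b2 \<otimes>\<^bsub>C\<^esub> pAB a3 b3 = pAB a1 b1 \<otimes>\<^bsub>C\<^esub> (pAB a2 b2 \<otimes>\<^bsub>C\<^esub> pAB a3 b3)"
proof -
  define s where "s = \<tau> (pBA b1 a2)"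
  define t where "t = \<tau> (pBA b2 a3)"
  have st: "s \<in> carrier AB" "t \<in> carrier AB"
    using c by (simp_all add: s_def t_def twist_pure)
  have "\<forall>s\<in>carrier AB. outer a1 b2 s \<otimes>\<^bsub>C\<^esub> pAB a3 b3 = outer a1 b3 (s \<otimes>\<^bsub>C\<^esub> t)"
  proof (rule tensor_extI[where X = AB]; ((rule twist_linear twist_closed c st)+)?)
    fix a b assume ab: "a \<in> carrier A" "b \<in> carrier B"
    have "outer a1 b2 (pAB a b) \<otimes>\<^bsub>C\<^esub> pAB a3 b3 = outer (a1 \<otimes>\<^bsub>A\<^esub> a) b3 (\<iota>B b \<otimes>\<^bsub>C\<^esub> t)"
      using ab c by (simp add: t_def \<tau>_pentagon_B mult_C_pure twist_pure)
    also have "\<dots> = outer a1 b3 (pAB a b \<otimes>\<^bsub>C\<^esub> t)"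
      using ab c st by (simp add: mult_pure_left outer_outer twist_closed)
    finally show "outer a1 b2 (pAB a b) \<otimes>\<^bsub>C\<^esub> pAB a3 b3 = outer a1 b3 (pAB a b \<otimes>\<^bsub>C\<^esub> t)" .
  qed
  then have 1: "pAB a1 b1 \<otimes>\<^bsub>C\<^esub> pAB a2 b2 \<otimes>\<^bsub>C\<^esub> pAB a3 b3 = outer a1 b3 (s \<otimes>\<^bsub>C\<^esub> t)"
    using c st by (simp add: mult_C_pure flip: s_def)
  have "\<forall>t\<in>carrier AB. pAB a1 b1 \<otimes>\<^bsub>C\<^esub> outer a2 b3 t = outer a1 b3 (s \<otimes>\<^bsub>C\<^esub> t)"
  proof (rule tensor_extI[where X = AB]; ((rule twist_linear twist_closed c st modules)+)?)
    fix a b assume ab: "a \<in> carrier A" "b \<in> carrier B"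
    have "pAB a1 b1 \<otimes>\<^bsub>C\<^esub> outer a2 b3 (pAB a b) = outer a1 (b \<otimes>\<^bsub>B\<^esub> b3) (s \<otimes>\<^bsub>C\<^esub> \<iota>A a)"
      using ab c by (simp add: s_def \<tau>_pentagon_A mult_C_pure twist_pure)
    also have "\<dots> = outer a1 b3 (s \<otimes>\<^bsub>C\<^esub> pAB a b)"
      using ab c st by (simp add: mult_pure_right outer_outer twist_closed)
    finally show "pAB a1 b1 \<otimes>\<^bsub>C\<^esub> outer a2 b3 (pAB a b) = outer a1 b3 (s \<otimes>\<^bsub>C\<^esub> pAB a b)" .
  qed
  then have 2: "pAB a1 b1 \<otimes>\<^bsub>C\<^esub> (pAB a2 b2 \<otimes>\<^bsub>C\<^esub> pAB a3 b3) = outer a1 b3 (s \<otimes>\<^bsub>C\<^esub> t)"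
    using c st by (simp add: mult_C_pure flip: t_def)
  show ?thesis
    unfolding 1 2 ..
qed

lemma mult_C_assoc:
  assumes x: "x \<in> carrier AB" and y: "y \<in> carrier AB" and z: "z \<in> carrier AB"
  shows "x \<otimes>\<^bsub>C\<^esub> y \<otimes>\<^bsub>C\<^esub> z = x \<otimes>\<^bsub>C\<^esub> (y \<otimes>\<^bsub>C\<^esub> z)"
proof -
  note L = twist_linear twist_closed
  have 1: "\<forall>z\<in>carrier AB. pAB a1 b1 \<otimes>\<^bsub>C\<^esub> pAB a2 b2 \<otimes>\<^bsub>C\<^esub> z = pAB a1 b1 \<otimes>\<^bsub>C\<^esub> (pAB a2 b2 \<otimes>\<^bsub>C\<^esub> z)"
    if c: "a1 \<in> carrier A" "b1 \<in> carrier B" "a2 \<in> carrier A" "b2 \<in> carrier B" for a1 b1 a2 b2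
    by (rule tensor_extI[where X = AB]; ((rule L c)+)?) (use c in \<open>simp add: mult_C_assoc_pure\<close>)
  have 2: "\<forall>y\<in>carrier AB. pAB a1 b1 \<otimes>\<^bsub>C\<^esub> y \<otimes>\<^bsub>C\<^esub> z = pAB a1 b1 \<otimes>\<^bsub>C\<^esub> (y \<otimes>\<^bsub>C\<^esub> z)"
    if c: "a1 \<in> carrier A" "b1 \<in> carrier B" for a1 b1
    by (rule tensor_extI[where X = AB]; ((rule L c z)+)?) (use c z 1 in simp)
  have "\<forall>x\<in>carrier AB. x \<otimes>\<^bsub>C\<^esub> y \<otimes>\<^bsub>C\<^esub> z = x \<otimes>\<^bsub>C\<^esub> (y \<otimes>\<^bsub>C\<^esub> z)"
    by (rule tensor_extI[where X = AB]; ((rule L y z)+)?) (use y z 2 in simp)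
  then show ?thesis
    using x by blast
qed

text \<open>Besides the algebra laws, this gives \<open>C\<close> the results on bimodule maps into
  its tensor square, coassociativity included.\<close>

sublocale C: unital_alg k C
proof
  interpret T: module k AB by (intro modules)
  have group: "abelian_group C"
  proof (rule abelian_groupI)
    fix x assume "x \<in> carrier C"
    then show "\<exists>y\<in>carrier C. y \<oplus>\<^bsub>C\<^esub> x = \<zero>\<^bsub>C\<^esub>"
      using T.l_neg[of x] T.a_inv_closed[of x] by (auto simp: carrier_C add_C zero_C)
  qed (auto simp: carrier_C add_C zero_C T.a_ac)
  have module: "module k C"
    by (rule moduleI[OF T.R.is_cring group])
      (auto simp: carrier_C add_C smult_C T.smult_l_distr T.smult_r_distr T.smult_assoc1)
  have one: "\<one>\<^bsub>C\<^esub> \<in> carrier AB" "\<one>\<^bsub>C\<^esub> = \<iota>A \<one>\<^bsub>A\<^esub>" "\<one>\<^bsub>C\<^esub> = \<iota>B \<one>\<^bsub>B\<^esub>"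
    by (simp_all add: one_C \<iota>A_def \<iota>B_def twist_pure)
  have monoid: "monoid C"
  proof (rule monoidI)
    fix x assume "x \<in> carrier C"
    then have x: "x \<in> carrier AB"
      by (simp add: carrier_C)
    show "\<one>\<^bsub>C\<^esub> \<otimes>\<^bsub>C\<^esub> x = x"
      unfolding one(2) using x by (simp add: mult_\<iota>A_left outer_one)
    show "x \<otimes>\<^bsub>C\<^esub> \<one>\<^bsub>C\<^esub> = x"
      unfolding one(3) using x by (simp add: mult_\<iota>B_right outer_one)
  qed (simp_all add: carrier_C mult_C_closed mult_C_assoc one(1))
  note right = linear_map_mult_C_right[OF linear_map_ident]
  note left = linear_map_mult_C_left[OF linear_map_ident]
  have ring: "ring C"
    by (rule ringI[OF group monoid])
      (simp_all add: carrier_C add_C linear_map_add[OF left] linear_map_add[OF right])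
  show "unital_algebra k C"
    using module ring
    by (simp add: unital_algebra_def carrier_C smult_C linear_map_smult[OF left] linear_map_smult[OF right])
qed

end

text \<open>The entries of a pure tensor in the outer product are arbitrary tensors again, so
  extension is used once for the outer product and once for each of its factors.\<close>

lemma tensor_ext4I:
  assumes mod: "module k U" "module k V" "module k W" "module k Y"
    and f: "linear_map k (tensor k (tensor k U V) (tensor k W Y)) X f"
    and g: "linear_map k (tensor k (tensor k U V) (tensor k W Y)) X g"
    and eq: "\<And>u v w y. u \<in> carrier U \<Longrightarrow> v \<in> carrier V \<Longrightarrow> w \<in> carrier W \<Longrightarrow> y \<in> carrier Y \<Longrightarrow>
      f (pure_tensor k (tensor k U V) (tensor k W Y) (pure_tensor k U V u v) (pure_tensor k W Y w y)) =
      g (pure_tensor k (tensor k U V) (tensor k W Y) (pure_tensor k U V u v) (pure_tensor k W Y w y))"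
  shows "\<forall>t\<in>carrier (tensor k (tensor k U V) (tensor k W Y)). f t = g t"
proof (rule tensor_extI[OF _ _ f g])
  fix s t assume s: "s \<in> carrier (tensor k U V)" and t: "t \<in> carrier (tensor k W Y)"
  note L = linear_map_compose[OF f] linear_map_compose[OF g] linear_intros module_tensor mod
    pure_tensor_closed
  have inner: "\<forall>t\<in>carrier (tensor k W Y).
      f (pure_tensor k (tensor k U V) (tensor k W Y) (pure_tensor k U V u v) t) =
      g (pure_tensor k (tensor k U V) (tensor k W Y) (pure_tensor k U V u v) t)"
    if uv: "u \<in> carrier U" "v \<in> carrier V" for u v
    by (rule tensor_extI[where X = X]; ((rule L uv)+)?) (use eq uv in simp)
  have "\<forall>s\<in>carrier (tensor k U V). f (pure_tensor k (tensor k U V) (tensor k W Y) s t) =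
      g (pure_tensor k (tensor k U V) (tensor k W Y) s t)"
    by (rule tensor_extI[where X = X]; ((rule L t)+)?) (use inner t in simp)
  then show "f (pure_tensor k (tensor k U V) (tensor k W Y) s t) =
      g (pure_tensor k (tensor k U V) (tensor k W Y) s t)"
    using s by blast
qed (intro module_tensor mod)+

lemma linear_map_smult_scalar:
  assumes "linear_map k X V h" "r \<in> carrier k" "module k V"
  shows "linear_map k X V (\<lambda>x. r \<odot>\<^bsub>V\<^esub> h x)"
proof -
  interpret V: module k V by (rule assms)
  have "a \<odot>\<^bsub>V\<^esub> (r \<odot>\<^bsub>V\<^esub> x) = r \<odot>\<^bsub>V\<^esub> (a \<odot>\<^bsub>V\<^esub> x)" if "a \<in> carrier k" "x \<in> carrier V" for a x
    using that assms(2) by (simp add: V.m_comm flip: V.smult_assoc1)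
  then show ?thesis
    using assms by (auto simp: linear_map_def Pi_iff V.smult_r_distr)
qed

section \<open>Multiplication from both sides on the tensor square of the twisted product\<close>

context twisting
begin

abbreviation "AA \<equiv> tensor k A A"
abbreviation "BB \<equiv> tensor k B B"
abbreviation "pAA \<equiv> pure_tensor k A A"
abbreviation "pBB \<equiv> pure_tensor k B B"
abbreviation "pAABB \<equiv> pure_tensor k AA BB"
abbreviation "pBBAA \<equiv> pure_tensor k BB AA"
abbreviation "\<sigma> \<equiv> twist_inverse k A B \<tau>"
abbreviation "\<Phi> \<equiv> tensor_middle k A A B B \<sigma>"
abbreviation "J \<equiv> tensor_insert k A A B B"
abbreviation "sq \<equiv> twist_square k A B \<tau>"
abbreviation "lC \<equiv> left_action k C"
abbreviation "rC \<equiv> right_action k C"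

text \<open>The first two layers of \<open>twist_square\<close>, ending in the tensor square of
  \<open>C\<close>. It does for products \<open>b a\<close> what \<open>\<Phi>\<close> does for
  products \<open>a b\<close>.\<close>

definition \<Psi> where "\<Psi> t = tensor_map k AB AB \<tau> \<tau> (tensor_middle k B B A A \<tau> t)"

lemma \<sigma>_closed: "s \<in> carrier AB \<Longrightarrow> \<sigma> s \<in> carrier BA"
  and \<tau>_\<sigma>: "s \<in> carrier AB \<Longrightarrow> \<tau> (\<sigma> s) = s"
  and \<sigma>_\<tau>: "t \<in> carrier BA \<Longrightarrow> \<sigma> (\<tau> t) = t"
  using bij_\<tau>
  by (auto simp: twist_inverse_def bij_betw_def f_inv_into_f intro: inv_into_into)

text \<open>As \<open>\<sigma>\<close> is just a set-theoretic inverse on carriers, both laws are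
  compared after applying the injective map \<open>\<tau>\<close>.\<close>

lemma linear_\<sigma>: "linear_map k AB BA \<sigma>"
proof (rule linear_mapI)
  interpret BA: module k BA by (intro modules)
  note inj = inj_onD[OF bij_betw_imp_inj_on[OF bij_\<tau>]]
  interpret AB: module k AB by (intro modules)
  show "\<sigma> (x \<oplus>\<^bsub>AB\<^esub> y) = \<sigma> x \<oplus>\<^bsub>BA\<^esub> \<sigma> y" if "x \<in> carrier AB" "y \<in> carrier AB" for x y
    by (rule inj) (use that in \<open>simp_all add: linear_map_add[OF linear_\<tau>] \<tau>_\<sigma> \<sigma>_closed\<close>)
  show "\<sigma> (r \<odot>\<^bsub>AB\<^esub> x) = r \<odot>\<^bsub>BA\<^esub> \<sigma> x" if "r \<in> carrier k" "x \<in> carrier AB" for r x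
    by (rule inj) (use that in \<open>simp_all add: linear_map_smult[OF linear_\<tau>] \<tau>_\<sigma> \<sigma>_closed\<close>)
qed (rule \<sigma>_closed)

lemma \<sigma>_one_left: "b \<in> carrier B \<Longrightarrow> \<sigma> (pAB \<one>\<^bsub>A\<^esub> b) = pBA b \<one>\<^bsub>A\<^esub>"
  using \<sigma>_\<tau>[of "pBA b \<one>\<^bsub>A\<^esub>"] by (simp add: \<tau>_one_right \<iota>B_def twist_pure)

lemma \<sigma>_one_right: "a \<in> carrier A \<Longrightarrow> \<sigma> (pAB a \<one>\<^bsub>B\<^esub>) = pBA \<one>\<^bsub>B\<^esub> a"
  using \<sigma>_\<tau>[of "pBA \<one>\<^bsub>B\<^esub> a"] by (simp add: \<tau>_one_left \<iota>A_def twist_pure)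

lemmas C_linear = C.linear_map_left_action[unfolded tensor_C carrier_C]
  C.linear_map_right_action[unfolded tensor_C carrier_C]
  C.linear_map_nabla[unfolded tensor_C linear_map_to_C]

lemmas C_pure = C.left_action_pure[unfolded pure_tensor_C carrier_C]
  C.right_action_pure[unfolded pure_tensor_C carrier_C]
  C.nabla_pure[unfolded pure_tensor_C carrier_C]

lemma linear_map_\<Phi>:
  "linear_map k X (tensor k AA BB) h \<Longrightarrow> linear_map k X CC (\<lambda>x. \<Phi> (h x))"
  by (rule linear_map_tensor_middle[OF _ _ _ _ linear_\<sigma>]) (simp_all add: modules)

lemma linear_map_J:
  "linear_map k X BA h \<Longrightarrow> x \<in> carrier A \<Longrightarrow> v \<in> carrier B \<Longrightarrow> linear_map k X CC (\<lambda>y. J x v (h y))"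
  by (rule linear_map_tensor_insert) (simp_all add: modules)

lemma linear_map_\<Psi>:
  "linear_map k X (tensor k BB AA) h \<Longrightarrow> linear_map k X CC (\<lambda>x. \<Psi> (h x))"
  unfolding \<Psi>_def
  by (rule linear_map_tensor_map[OF linear_\<tau> linear_\<tau>] linear_map_tensor_middle[OF _ _ _ _ linear_\<tau>]
      modules | assumption)+

lemma linear_map_sq:
  "linear_map k X (tensor k BB AA) h \<Longrightarrow> linear_map k X (tensor k AA BB) (\<lambda>x. sq (h x))"
  unfolding twist_square_def comp_apply
  by (rule linear_map_tensor_map[OF linear_\<tau> linear_\<tau>] linear_map_tensor_middle[OF _ _ _ _ linear_\<tau>]
      modules | assumption)+

lemmas linear_\<sigma>_compose = linear_map_compose[OF linear_\<sigma>]

lemmas CC_linear = C_linear linear_map_\<Phi> linear_map_J linear_map_\<Psi> linear_map_sq linear_\<sigma>_compose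
  A.linear_map_left_action A.linear_map_right_action B.linear_map_left_action B.linear_map_right_action
  twist_linear twist_closed A.m_closed B.m_closed A.one_closed B.one_closed

lemmas CC_pure = C_pure A.left_action_pure A.right_action_pure B.left_action_pure B.right_action_pure
  twist_pure \<sigma>_closed

lemma \<Phi>_pure:
  assumes "x \<in> carrier A" "y \<in> carrier A" "u \<in> carrier B" "v \<in> carrier B"
  shows "\<Phi> (pAABB (pAA x y) (pBB u v)) = J x v (\<sigma> (pAB y u))"
  by (rule tensor_middle_pure) (use assms linear_\<sigma> in \<open>simp_all add: modules\<close>)

lemma \<Psi>_pure:
  assumes "x \<in> carrier A" "y \<in> carrier A" "u \<in> carrier B" "v \<in> carrier B"
  shows "\<Psi> (pBBAA (pBB u v) (pAA x y)) =
    tensor_map k AB AB \<tau> \<tau> (tensor_insert k B B A A u y (\<tau> (pBA v x)))"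
  unfolding \<Psi>_def using assms by (simp add: tensor_middle_pure[OF _ _ _ _ linear_\<tau>] modules)

lemma mult_\<iota>A_pure: "a \<in> carrier A \<Longrightarrow> x \<in> carrier A \<Longrightarrow> y \<in> carrier B \<Longrightarrow>
    \<iota>A a \<otimes>\<^bsub>C\<^esub> pAB x y = pAB (a \<otimes>\<^bsub>A\<^esub> x) y"
  by (simp add: mult_\<iota>A_left twist_pure)

lemma mult_pure_\<iota>B: "b \<in> carrier B \<Longrightarrow> x \<in> carrier A \<Longrightarrow> y \<in> carrier B \<Longrightarrow>
    pAB x y \<otimes>\<^bsub>C\<^esub> \<iota>B b = pAB x (y \<otimes>\<^bsub>B\<^esub> b)"
  by (simp add: mult_\<iota>B_right twist_pure)

lemma mult_\<iota>A_\<iota>B: "a \<in> carrier A \<Longrightarrow> b \<in> carrier B \<Longrightarrow> \<iota>A a \<otimes>\<^bsub>C\<^esub> \<iota>B b = pAB a b"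
  unfolding \<iota>B_def by (simp add: mult_\<iota>A_pure)

lemma mult_\<iota>A_\<iota>A: "a \<in> carrier A \<Longrightarrow> b \<in> carrier A \<Longrightarrow> \<iota>A a \<otimes>\<^bsub>C\<^esub> \<iota>A b = \<iota>A (a \<otimes>\<^bsub>A\<^esub> b)"
  using mult_\<iota>A_pure[of a b "\<one>\<^bsub>B\<^esub>"] by (simp add: \<iota>A_def)

lemma mult_\<iota>B_\<iota>B: "a \<in> carrier B \<Longrightarrow> b \<in> carrier B \<Longrightarrow> \<iota>B a \<otimes>\<^bsub>C\<^esub> \<iota>B b = \<iota>B (a \<otimes>\<^bsub>B\<^esub> b)"
  using mult_pure_\<iota>B[of b "\<one>\<^bsub>A\<^esub>" a] by (simp add: \<iota>B_def)

lemma mult_\<iota>B_\<iota>A: "b \<in> carrier B \<Longrightarrow> a \<in> carrier A \<Longrightarrow> \<iota>B b \<otimes>\<^bsub>C\<^esub> \<iota>A a = \<tau> (pBA b a)"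
  unfolding \<iota>A_def \<iota>B_def by (simp add: mult_C_pure outer_one twist_pure)

lemma \<iota>A_one: "\<iota>A \<one>\<^bsub>A\<^esub> = \<one>\<^bsub>C\<^esub>" and \<iota>B_one: "\<iota>B \<one>\<^bsub>B\<^esub> = \<one>\<^bsub>C\<^esub>"
  by (simp_all add: \<iota>A_def \<iota>B_def one_C)

lemma \<Phi>_actions:
  assumes ab: "a \<in> carrier A" "b \<in> carrier B"
  shows "\<forall>t\<in>carrier (tensor k AA BB).
    \<Phi> (tensor_map k AA BB (left_action k A a) (right_action k B b) t) = lC (\<iota>A a) (rC (\<iota>B b) (\<Phi> t))"
proof (rule tensor_ext4I[where X = CC]; ((rule CC_linear ab)+)?)
  fix x y u v assume c: "x \<in> carrier A" "y \<in> carrier A" "u \<in> carrier B" "v \<in> carrier B"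
  have "\<forall>s\<in>carrier BA. J (a \<otimes>\<^bsub>A\<^esub> x) (v \<otimes>\<^bsub>B\<^esub> b) s = lC (\<iota>A a) (rC (\<iota>B b) (J x v s))"
    by (rule tensor_extI[where X = CC]; ((rule CC_linear ab c)+)?)
      (use ab c in \<open>simp_all add: CC_pure mult_\<iota>A_pure mult_pure_\<iota>B\<close>)
  then show "\<Phi> (tensor_map k AA BB (left_action k A a) (right_action k B b) (pAABB (pAA x y) (pBB u v))) =
      lC (\<iota>A a) (rC (\<iota>B b) (\<Phi> (pAABB (pAA x y) (pBB u v))))"
    using ab c by (simp add: CC_pure \<Phi>_pure
        tensor_map_pure[OF A.linear_map_left_action[OF linear_map_ident] B.linear_map_right_action[OF linear_map_ident]])
qed

text \<open>In \<open>\<Phi>\<close> the outer components are left alone by \<open>\<sigma>\<close>,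
  so the actions pass at once. In \<open>\<Psi>\<close> they take part in
  \<open>\<tau> \<otimes> \<tau>\<close>, and it is multiplicativity of \<open>\<tau>\<close> in
  each argument that brings \<open>b\<close> and \<open>a\<close> out as multiplications in
  \<open>C\<close>.\<close>

lemma \<Psi>_actions:
  assumes ab: "a \<in> carrier A" "b \<in> carrier B"
  shows "\<forall>t\<in>carrier (tensor k BB AA).
    \<Psi> (tensor_map k BB AA (left_action k B b) (right_action k A a) t) = lC (\<iota>B b) (rC (\<iota>A a) (\<Psi> t))"
proof (rule tensor_ext4I[where X = CC]; ((rule CC_linear ab)+)?)
  fix u v x y assume c: "u \<in> carrier B" "v \<in> carrier B" "x \<in> carrier A" "y \<in> carrier A"
  have "\<forall>s\<in>carrier AB.
      tensor_map k AB AB \<tau> \<tau> (tensor_insert k B B A A (b \<otimes>\<^bsub>B\<^esub> u) (y \<otimes>\<^bsub>A\<^esub> a) s) =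
      lC (\<iota>B b) (rC (\<iota>A a) (tensor_map k AB AB \<tau> \<tau> (tensor_insert k B B A A u y s)))"
    by (rule tensor_extI[where X = CC]; ((rule linear_\<tau> CC_linear ab c)+)?)
      (use ab c in \<open>simp_all add: CC_pure tensor_map_pure[OF linear_\<tau> linear_\<tau>] \<tau>_pentagon_A \<tau>_pentagon_B\<close>)
  then show "\<Psi> (tensor_map k BB AA (left_action k B b) (right_action k A a) (pBBAA (pBB u v) (pAA x y))) =
      lC (\<iota>B b) (rC (\<iota>A a) (\<Psi> (pBBAA (pBB u v) (pAA x y))))"
    using ab c by (simp add: CC_pure \<Psi>_pure
        tensor_map_pure[OF B.linear_map_left_action[OF linear_map_ident] A.linear_map_right_action[OF linear_map_ident]])
qed

lemma \<Phi>_middle: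
  "\<forall>z\<in>carrier CC. \<Phi> (tensor_middle k A B A B \<tau> z) = z"
proof (rule tensor_ext4I[where X = CC]; ((rule linear_map_tensor_middle[OF _ _ _ _ linear_\<tau>] CC_linear)+)?)
  fix a b a' b' assume c: "a \<in> carrier A" "b \<in> carrier B" "a' \<in> carrier A" "b' \<in> carrier B"
  have "\<forall>s\<in>carrier AB. \<Phi> (tensor_insert k A B A B a b' s) = J a b' (\<sigma> s)"
    by (rule tensor_extI[where X = CC]; ((rule CC_linear c)+)?)
      (use c in \<open>simp_all add: CC_pure \<Phi>_pure\<close>)
  then show "\<Phi> (tensor_middle k A B A B \<tau> (pCC (pAB a b) (pAB a' b'))) = pCC (pAB a b) (pAB a' b')"
    using c by (simp add: CC_pure tensor_middle_pure[OF _ _ _ _ linear_\<tau>] \<sigma>_\<tau>)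
qed

text \<open>The last layer of the square is \<open>1 \<otimes> \<tau> \<otimes> 1\<close>, which
  \<open>\<Phi>\<close> undoes. Compatibility with the square thus turns the cotensor at
  \<open>\<tau>(b \<otimes> a)\<close> into an expression free of \<open>\<sigma>\<close>.\<close>

lemma \<Phi>_sq: "t \<in> carrier (tensor k BB AA) \<Longrightarrow> \<Phi> (sq t) = \<Psi> t"
  using \<Phi>_middle linear_map_closed[OF linear_map_\<Psi>[OF linear_map_ident]]
  by (simp add: twist_square_def \<Psi>_def)

lemma linear_map_cotensor:
  assumes "linear_map k A AA f" "linear_map k B BB g"
  shows "linear_map k AB CC (twisted_cotensor k A B \<tau> f g)"
  unfolding twisted_cotensor_def comp_def by (rule assms CC_linear)+

lemma cotensor_pure:
  assumes "linear_map k A AA f" "linear_map k B BB g" "a \<in> carrier A" "b \<in> carrier B"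
  shows "twisted_cotensor k A B \<tau> f g (pAB a b) = \<Phi> (pAABB (f a) (g b))"
  using assms(3,4) by (simp add: twisted_cotensor_def tensor_map_pure[OF assms(1,2)] modules)

text \<open>Stated for arbitrary bimodule maps because it serves twice: with the comultiplications
  and with the sections.\<close>

lemma bimodule_hom_cotensor:
  assumes f: "bimodule_hom k A f" and g: "bimodule_hom k B g"
    and square: "\<And>t. t \<in> carrier BA \<Longrightarrow> tensor_map k AA BB f g (\<tau> t) = sq (tensor_map k BB AA g f t)"
  shows "bimodule_hom k C (twisted_cotensor k A B \<tau> f g)"
proof -
  let ?D = "twisted_cotensor k A B \<tau> f g"
  have lf: "linear_map k A AA f" and lg: "linear_map k B BB g"
    using f g by (simp_all add: bimodule_hom_def)
  note cl = linear_map_closed[OF lf] linear_map_closed[OF lg]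
  define e where "e = ?D (pAB \<one>\<^bsub>A\<^esub> \<one>\<^bsub>B\<^esub>)"
  have e_eq: "e = \<Phi> (pAABB (f \<one>\<^bsub>A\<^esub>) (g \<one>\<^bsub>B\<^esub>))"
    by (simp add: e_def cotensor_pure[OF lf lg])
  define e' where "e' = \<Psi> (pBBAA (g \<one>\<^bsub>B\<^esub>) (f \<one>\<^bsub>A\<^esub>))"
  have e: "e \<in> carrier CC"
    unfolding e_def using linear_map_closed[OF linear_map_cotensor[OF lf lg]] by (simp add: CC_pure)
  have D_pure: "?D (pAB a b) = lC (\<iota>A a) (rC (\<iota>B b) e)" if ab: "a \<in> carrier A" "b \<in> carrier B" for a b
  proof -
    have "?D (pAB a b) = \<Phi> (tensor_map k AA BB (left_action k A a) (right_action k B b)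
        (pAABB (f \<one>\<^bsub>A\<^esub>) (g \<one>\<^bsub>B\<^esub>)))"
      using ab by (simp add: cotensor_pure[OF lf lg] A.bimodule_hom_one[OF f] B.bimodule_hom_one[OF g]
          tensor_map_pure[OF A.linear_map_left_action[OF linear_map_ident]
            B.linear_map_right_action[OF linear_map_ident]] cl modules)
    then show ?thesis
      using \<Phi>_actions[OF ab] by (simp add: e_eq cl CC_pure)
  qed
  have D_\<tau>: "?D (\<tau> (pBA b a)) = lC (\<iota>B b) (rC (\<iota>A a) e')" if ab: "a \<in> carrier A" "b \<in> carrier B" for a b
  proof -
    have "?D (\<tau> (pBA b a)) = \<Psi> (pBBAA (g b) (f a))"
      using ab by (simp add: twisted_cotensor_def square \<Phi>_sq tensor_map_pure[OF lg lf] cl CC_pure)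
    also have "\<dots> = \<Psi> (tensor_map k BB AA (left_action k B b) (right_action k A a)
        (pBBAA (g \<one>\<^bsub>B\<^esub>) (f \<one>\<^bsub>A\<^esub>)))"
      using ab by (simp add: A.bimodule_hom_one[OF f] B.bimodule_hom_one[OF g]
          tensor_map_pure[OF B.linear_map_left_action[OF linear_map_ident]
            A.linear_map_right_action[OF linear_map_ident]] cl modules)
    finally show ?thesis
      using \<Psi>_actions[OF ab] by (simp add: e'_def cl CC_pure)
  qed
  have e': "e' \<in> carrier CC"
    unfolding e'_def by (rule linear_map_closed[OF linear_map_\<Psi>[OF linear_map_ident]]) (simp add: cl CC_pure)
  \<comment> \<open>The unit of \<open>C\<close> turns up as \<open>\<iota>A\<close> and as
    \<open>\<iota>B\<close> of a unit, so the unit laws of the actions are put in both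
    shapes.\<close>
  note one = C.left_action_one[unfolded tensor_C, folded \<iota>A_one]
    C.left_action_one[unfolded tensor_C, folded \<iota>B_one]
    C.right_action_one[unfolded tensor_C, folded \<iota>A_one]
    C.right_action_one[unfolded tensor_C, folded \<iota>B_one]
  note actC = C.left_action_closed[unfolded tensor_C carrier_C] C.right_action_closed[unfolded tensor_C carrier_C]
  have ee': "e' = e"
    using D_\<tau>[OF A.one_closed B.one_closed] e'
    by (simp add: one \<tau>_one_right e_def \<iota>B_def[of "\<one>\<^bsub>B\<^esub>", symmetric])
  have cB: "lC (\<iota>B b) e = rC (\<iota>B b) e" if b: "b \<in> carrier B" for b
    using D_\<tau>[OF A.one_closed b] D_pure[OF A.one_closed b] e b
    by (simp add: one ee' \<tau>_one_right \<iota>B_def[of b, symmetric] actC \<iota>B_closed)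
  have cA: "lC (\<iota>A a) e = rC (\<iota>A a) e" if a: "a \<in> carrier A" for a
    using D_\<tau>[OF a B.one_closed] D_pure[OF a B.one_closed] e a
    by (simp add: one ee' \<tau>_one_left \<iota>A_def[of a, symmetric] actC \<iota>A_closed)
  \<comment> \<open>Commuting with \<open>\<iota>A a\<close> and \<open>\<iota>B b\<close> is
    enough, since their products are the pure tensors:
    \<open>a (e b) = a (b e) = (a b) e\<close>.\<close>
  have "\<forall>c\<in>carrier AB. ?D c = lC c e"
  proof (rule tensor_extI[OF modules(1,2) linear_map_cotensor[OF lf lg]])
    show "linear_map k AB CC (\<lambda>c. lC c e)"
      by (rule C.linear_map_left_action_arg[unfolded tensor_C linear_map_from_C, OF e])
    fix a b assume ab: "a \<in> carrier A" "b \<in> carrier B"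
    have "lC (\<iota>A a \<otimes>\<^bsub>C\<^esub> \<iota>B b) e = lC (\<iota>A a) (lC (\<iota>B b) e)"
      using C.left_action_left_action[of "\<iota>A a" "\<iota>B b"] ab e by (simp add: tensor_C carrier_C twist_closed)
    then show "?D (pAB a b) = lC (pAB a b) e"
      using ab by (simp add: D_pure cB mult_\<iota>A_\<iota>B)
  qed
  moreover have "\<forall>c\<in>carrier AB. ?D c = rC c e"
  proof (rule tensor_extI[OF modules(1,2) linear_map_cotensor[OF lf lg]])
    show "linear_map k AB CC (\<lambda>c. rC c e)"
      by (rule C.linear_map_right_action_arg[unfolded tensor_C linear_map_from_C, OF e])
    fix a b assume ab: "a \<in> carrier A" "b \<in> carrier B"
    have "rC (\<iota>A a \<otimes>\<^bsub>C\<^esub> \<iota>B b) e = rC (\<iota>B b) (rC (\<iota>A a) e)"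
      using C.right_action_right_action[of "\<iota>A a" "\<iota>B b"] ab e by (simp add: tensor_C carrier_C twist_closed)
    then have "rC (pAB a b) e = rC (\<iota>B b) (lC (\<iota>A a) e)"
      using ab by (simp add: cA mult_\<iota>A_\<iota>B)
    also have "\<dots> = lC (\<iota>A a) (rC (\<iota>B b) e)"
      using C.left_action_right_action[of "\<iota>A a" "\<iota>B b"] ab e by (simp add: tensor_C carrier_C twist_closed)
    finally show "?D (pAB a b) = rC (pAB a b) e"
      using ab by (simp add: D_pure)
  qed
  ultimately show ?thesis
    using e by (intro C.bimodule_homI[of e]) (simp_all add: tensor_C carrier_C)
qed

end

section \<open>Frobenius structure of the twisted tensor product\<close>

locale frobenius_twisting = twisting +
  assumes frobenius_A: "frobenius_algebra k A" and frobenius_B: "frobenius_algebra k B"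
    and comult_\<tau>: "\<And>t. t \<in> carrier BA \<Longrightarrow>
      tensor_map k AA BB (comult A) (comult B) (\<tau> t) = sq (tensor_map k BB AA (comult B) (comult A) t)"
begin

abbreviation "\<epsilon>A \<equiv> counit A"
abbreviation "\<epsilon>B \<equiv> counit B"
abbreviation "\<epsilon>C \<equiv> counit C"

lemma linear_comult: "linear_map k A AA (comult A)" "linear_map k B BB (comult B)"
  and linear_counit: "linear_functional k A \<epsilon>A" "linear_functional k B \<epsilon>B"
  using frobenius_A frobenius_B by (simp_all add: frobenius_algebra_def counital_coalgebra_def)

lemma bimodule_hom_comult: "bimodule_hom k A (comult A)" "bimodule_hom k B (comult B)"
  using frobenius_A frobenius_B
  unfolding frobenius_algebra_def A.bimodule_hom_iff_frobenius[OF linear_comult(1)]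
    B.bimodule_hom_iff_frobenius[OF linear_comult(2)]
  by blast+

lemma counit_one:
  "tensor_lift A (\<lambda>x y. \<epsilon>A x \<odot>\<^bsub>A\<^esub> y) (comult A \<one>\<^bsub>A\<^esub>) = \<one>\<^bsub>A\<^esub>"
  "tensor_lift A (\<lambda>x y. \<epsilon>A y \<odot>\<^bsub>A\<^esub> x) (comult A \<one>\<^bsub>A\<^esub>) = \<one>\<^bsub>A\<^esub>"
  "tensor_lift B (\<lambda>x y. \<epsilon>B x \<odot>\<^bsub>B\<^esub> y) (comult B \<one>\<^bsub>B\<^esub>) = \<one>\<^bsub>B\<^esub>"
  "tensor_lift B (\<lambda>x y. \<epsilon>B y \<odot>\<^bsub>B\<^esub> x) (comult B \<one>\<^bsub>B\<^esub>) = \<one>\<^bsub>B\<^esub>"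
  using frobenius_A frobenius_B by (simp_all add: frobenius_algebra_def counital_coalgebra_def)

lemma bimodule_hom_comult_C: "bimodule_hom k C (comult C)"
  unfolding comult_C by (rule bimodule_hom_cotensor[OF bimodule_hom_comult comult_\<tau>])

lemma linear_counit_C: "linear_functional k AB \<epsilon>C"
  unfolding counit_C by (rule linear_functional_tensor_lift[OF linear_counit modules(1,2)])

lemma counit_C_pure: "a \<in> carrier A \<Longrightarrow> b \<in> carrier B \<Longrightarrow> \<epsilon>C (pAB a b) = \<epsilon>A a \<otimes>\<^bsub>k\<^esub> \<epsilon>B b"
  unfolding counit_C
  by (rule tensor_lift_pure[OF modules(1,2) balanced_map_functionals[OF linear_counit modules(1,2)]])

lemma counit_closed:
  "a \<in> carrier A \<Longrightarrow> \<epsilon>A a \<in> carrier k" "b \<in> carrier B \<Longrightarrow> \<epsilon>B b \<in> carrier k"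
  "c \<in> carrier AB \<Longrightarrow> \<epsilon>C c \<in> carrier k"
  using linear_counit linear_counit_C by (auto simp: linear_functional_def)

lemma linear_functional_C: "linear_functional k C \<epsilon>C"
  using linear_counit_C by (simp add: linear_functional_def carrier_C add_C smult_C)

section \<open>Contraction of one tensor factor by the counit\<close>

definition contract_left where
  "contract_left = tensor_lift C (\<lambda>x y. \<epsilon>C x \<odot>\<^bsub>C\<^esub> y)"

definition contract_right where
  "contract_right = tensor_lift C (\<lambda>x y. \<epsilon>C y \<odot>\<^bsub>C\<^esub> x)"

lemma linear_contract:
  assumes "linear_map k X CC h"
  shows "linear_map k X AB (\<lambda>x. contract_left (h x))" "linear_map k X AB (\<lambda>x. contract_right (h x))"
  unfolding contract_left_def contract_right_def
  using assms linear_map_tensor_lift[OF C.module_alg C.module_alg C.module_alg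
      bilinear_map_functional_left[OF linear_functional_C C.module_alg C.module_alg]]
    linear_map_tensor_lift[OF C.module_alg C.module_alg C.module_alg
      bilinear_map_functional_right[OF linear_functional_C C.module_alg C.module_alg]]
  by (auto simp: tensor_C linear_map_to_C intro: linear_map_compose)

lemma contract_pure:
  assumes "x \<in> carrier AB" "y \<in> carrier AB"
  shows "contract_left (pCC x y) = \<epsilon>C x \<odot>\<^bsub>AB\<^esub> y" "contract_right (pCC x y) = \<epsilon>C y \<odot>\<^bsub>AB\<^esub> x"
proof -
  note pure = tensor_lift_pure_tensor[OF C.module_alg C.module_alg C.module_alg]
  have xy: "x \<in> carrier C" "y \<in> carrier C"
    using assms by (simp_all add: carrier_C)
  have "contract_left (pCC x y) = \<epsilon>C x \<odot>\<^bsub>C\<^esub> y"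
    unfolding contract_left_def
    by (rule pure[OF bilinear_map_functional_left[OF linear_functional_C C.module_alg C.module_alg] xy,
          unfolded pure_tensor_C])
  then show "contract_left (pCC x y) = \<epsilon>C x \<odot>\<^bsub>AB\<^esub> y"
    by (simp only: smult_C)
  have "contract_right (pCC x y) = \<epsilon>C y \<odot>\<^bsub>C\<^esub> x"
    unfolding contract_right_def
    by (rule pure[OF bilinear_map_functional_right[OF linear_functional_C C.module_alg C.module_alg] xy,
          unfolded pure_tensor_C])
  then show "contract_right (pCC x y) = \<epsilon>C y \<odot>\<^bsub>AB\<^esub> x"
    by (simp only: smult_C)
qed

sublocale AB: module k AB
  by (intro modules)

text \<open>Contracting one factor commutes with multiplying the other. With \<open>e\<close> the
  comultiplication of the unit, the comultiplication of \<open>c\<close> is both \<open>e c\<close>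
  and \<open>c e\<close>, so each counit law reduces to its case at the unit.\<close>

lemma contract_action:
  assumes c: "c \<in> carrier AB"
  shows "\<forall>t\<in>carrier CC. contract_left (rC c t) = contract_left t \<otimes>\<^bsub>C\<^esub> c"
    and "\<forall>t\<in>carrier CC. contract_right (lC c t) = c \<otimes>\<^bsub>C\<^esub> contract_right t"
proof -
  note smult = linear_map_smult[OF linear_map_mult_C_right[OF linear_map_ident]]
    linear_map_smult[OF linear_map_mult_C_left[OF linear_map_ident]]
  show "\<forall>t\<in>carrier CC. contract_left (rC c t) = contract_left t \<otimes>\<^bsub>C\<^esub> c"
    by (rule tensor_extI[where X = AB]; ((rule linear_contract CC_linear c)+)?)
      (use c in \<open>simp_all add: CC_pure contract_pure counit_closed smult\<close>)
  show "\<forall>t\<in>carrier CC. contract_right (lC c t) = c \<otimes>\<^bsub>C\<^esub> contract_right t"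
    by (rule tensor_extI[where X = AB]; ((rule linear_contract CC_linear c)+)?)
      (use c in \<open>simp_all add: CC_pure contract_pure counit_closed smult\<close>)
qed

lemmas functional_lift = linear_map_tensor_lift[OF _ _ _ bilinear_map_functional_left]
  linear_map_tensor_lift[OF _ _ _ bilinear_map_functional_right]

lemmas functional_lift_pure = tensor_lift_pure_tensor[OF _ _ _ bilinear_map_functional_left]
  tensor_lift_pure_tensor[OF _ _ _ bilinear_map_functional_right]

text \<open>The counit of \<open>A\<close> meets the outer component of \<open>comult A 1\<close>
  and collapses this tensor to \<open>1\<close>. What \<open>\<sigma>\<close> then receives is
  \<open>1 \<otimes> u\<close>, on which it is a mere exchange, so the counit never has to be moved
  across \<open>\<tau>\<close>.\<close>

lemma contract_left_\<Phi>:
  assumes h: "h \<in> carrier BB"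
  shows "contract_left (\<Phi> (pAABB (comult A \<one>\<^bsub>A\<^esub>) h)) = \<iota>B (tensor_lift B (\<lambda>x y. \<epsilon>B x \<odot>\<^bsub>B\<^esub> y) h)"
proof -
  let ?eA = "tensor_lift A (\<lambda>x y. \<epsilon>A x \<odot>\<^bsub>A\<^esub> y)" and ?eB = "tensor_lift B (\<lambda>x y. \<epsilon>B x \<odot>\<^bsub>B\<^esub> y)"
  let ?e = "tensor_lift A (\<lambda>b a. \<epsilon>B b \<odot>\<^bsub>A\<^esub> a)"
  have eA: "linear_map k AA A ?eA" and eB: "linear_map k BB B ?eB" and e: "linear_map k BA A ?e"
    by (intro functional_lift linear_counit modules)+
  have eA_pure: "?eA (pAA x y) = \<epsilon>A x \<odot>\<^bsub>A\<^esub> y" if "x \<in> carrier A" "y \<in> carrier A" for x y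
    by (intro functional_lift_pure linear_counit modules that)
  have eB_pure: "?eB (pBB x y) = \<epsilon>B x \<odot>\<^bsub>B\<^esub> y" if "x \<in> carrier B" "y \<in> carrier B" for x y
    by (intro functional_lift_pure linear_counit modules that)
  have e_pure: "?e (pBA x y) = \<epsilon>B x \<odot>\<^bsub>A\<^esub> y" if "x \<in> carrier B" "y \<in> carrier A" for x y
    by (intro functional_lift_pure linear_counit modules that)
  interpret A': module k A by (rule modules)
  have pure: "contract_left (\<Phi> (pAABB (comult A \<one>\<^bsub>A\<^esub>) (pBB u v))) = \<iota>B (?eB (pBB u v))"
    if uv: "u \<in> carrier B" "v \<in> carrier B" for u v
  proof -
    have "\<forall>g\<in>carrier AA. contract_left (\<Phi> (pAABB g (pBB u v))) = pAB (?e (\<sigma> (pAB (?eA g) u))) v"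
    proof (rule tensor_extI[where X = AB];
        ((rule linear_contract linear_map_compose[OF e] linear_map_compose[OF eA] CC_linear uv)+)?)
      fix x y assume xy: "x \<in> carrier A" "y \<in> carrier A"
      have "\<forall>s\<in>carrier BA. contract_left (J x v s) = \<epsilon>A x \<odot>\<^bsub>AB\<^esub> pAB (?e s) v"
        by (rule tensor_extI[where X = AB];
            ((rule linear_contract linear_map_smult_scalar linear_map_compose[OF e] CC_linear uv xy counit_closed)+)?)
          (use uv xy in \<open>simp_all add: CC_pure contract_pure counit_closed counit_C_pure e_pure
            smult_pure_tensor A'.smult_assoc1\<close>)
      then have "contract_left (\<Phi> (pAABB (pAA x y) (pBB u v))) = \<epsilon>A x \<odot>\<^bsub>AB\<^esub> pAB (?e (\<sigma> (pAB y u))) v"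
        using xy uv by (simp add: \<Phi>_pure CC_pure)
      \<comment> \<open>The scalar is moved inward to \<open>y\<close>, so that the whole depends on
        \<open>x \<otimes> y\<close> only through \<open>?eA\<close>; the counit law of
        \<open>A\<close> can then be applied to a tensor that is not pure.\<close>
      also have "\<dots> = pAB (?e (\<sigma> (pAB (\<epsilon>A x \<odot>\<^bsub>A\<^esub> y) u))) v"
        using xy uv linear_map_closed[OF e, of "\<sigma> (pAB y u)"]
        by (simp add: smult_pure_tensor[symmetric] linear_map_smult[OF linear_\<sigma>] linear_map_smult[OF e]
            counit_closed CC_pure)
      finally show "contract_left (\<Phi> (pAABB (pAA x y) (pBB u v))) =
          pAB (?e (\<sigma> (pAB (?eA (pAA x y)) u))) v"
        using xy by (simp add: eA_pure)
    qed
    then have "contract_left (\<Phi> (pAABB (comult A \<one>\<^bsub>A\<^esub>) (pBB u v))) = pAB (?e (\<sigma> (pAB \<one>\<^bsub>A\<^esub> u))) v"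
      using linear_map_closed[OF linear_comult(1)] counit_one by simp
    also have "\<dots> = \<iota>B (\<epsilon>B u \<odot>\<^bsub>B\<^esub> v)"
      using uv by (simp add: \<sigma>_one_left e_pure \<iota>B_def pure_tensor_balanced counit_closed modules)
    finally show ?thesis
      using uv by (simp add: eB_pure)
  qed
  have "\<forall>h\<in>carrier BB. contract_left (\<Phi> (pAABB (comult A \<one>\<^bsub>A\<^esub>) h)) = \<iota>B (?eB h)"
    by (rule tensor_extI[where X = AB];
        ((rule linear_contract linear_map_compose[OF eB] CC_linear linear_map_closed[OF linear_comult(1)])+)?)
      (rule pure)
  then show ?thesis
    using h by blast
qed

text \<open>The mirror image: now \<open>comult B 1\<close> collapses to \<open>1\<close>, and
  \<open>\<sigma>\<close> receives \<open>y \<otimes> 1\<close>. Scalars act on the first entry of a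
  pure tensor by definition, so they are carried over to the second entry on the way.\<close>

lemma contract_right_\<Phi>:
  assumes g: "g \<in> carrier AA"
  shows "contract_right (\<Phi> (pAABB g (comult B \<one>\<^bsub>B\<^esub>))) = \<iota>A (tensor_lift A (\<lambda>x y. \<epsilon>A y \<odot>\<^bsub>A\<^esub> x) g)"
proof -
  let ?eA = "tensor_lift A (\<lambda>x y. \<epsilon>A y \<odot>\<^bsub>A\<^esub> x)" and ?eB = "tensor_lift B (\<lambda>x y. \<epsilon>B y \<odot>\<^bsub>B\<^esub> x)"
  let ?e = "tensor_lift B (\<lambda>b a. \<epsilon>A a \<odot>\<^bsub>B\<^esub> b)"
  have eA: "linear_map k AA A ?eA" and eB: "linear_map k BB B ?eB" and e: "linear_map k BA B ?e"
    by (intro functional_lift linear_counit modules)+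
  have eA_pure: "?eA (pAA x y) = \<epsilon>A y \<odot>\<^bsub>A\<^esub> x" if "x \<in> carrier A" "y \<in> carrier A" for x y
    by (intro functional_lift_pure linear_counit modules that)
  have eB_pure: "?eB (pBB x y) = \<epsilon>B y \<odot>\<^bsub>B\<^esub> x" if "x \<in> carrier B" "y \<in> carrier B" for x y
    by (intro functional_lift_pure linear_counit modules that)
  have e_pure: "?e (pBA x y) = \<epsilon>A y \<odot>\<^bsub>B\<^esub> x" if "x \<in> carrier B" "y \<in> carrier A" for x y
    by (intro functional_lift_pure linear_counit modules that)
  interpret B': module k B by (rule modules)
  have smult_right: "r \<odot>\<^bsub>AB\<^esub> pAB a b = pAB a (r \<odot>\<^bsub>B\<^esub> b)"
    if "r \<in> carrier k" "a \<in> carrier A" "b \<in> carrier B" for r a b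
    using that by (simp add: smult_pure_tensor pure_tensor_balanced modules)
  have smult_swap: "r \<odot>\<^bsub>B\<^esub> (s \<odot>\<^bsub>B\<^esub> b) = s \<odot>\<^bsub>B\<^esub> (r \<odot>\<^bsub>B\<^esub> b)"
    if "r \<in> carrier k" "s \<in> carrier k" "b \<in> carrier B" for r s b
    using that by (simp add: AB.m_comm flip: B'.smult_assoc1)
  have pure: "contract_right (\<Phi> (pAABB (pAA x y) (comult B \<one>\<^bsub>B\<^esub>))) = \<iota>A (?eA (pAA x y))"
    if xy: "x \<in> carrier A" "y \<in> carrier A" for x y
  proof -
    have "\<forall>h\<in>carrier BB. contract_right (\<Phi> (pAABB (pAA x y) h)) = pAB x (?e (\<sigma> (pAB y (?eB h))))"
    proof (rule tensor_extI[where X = AB];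
        ((rule linear_contract linear_map_compose[OF e] linear_map_compose[OF eB] CC_linear xy)+)?)
      fix u v assume uv: "u \<in> carrier B" "v \<in> carrier B"
      have "\<forall>s\<in>carrier BA. contract_right (J x v s) = \<epsilon>B v \<odot>\<^bsub>AB\<^esub> pAB x (?e s)"
        by (rule tensor_extI[where X = AB];
            ((rule linear_contract linear_map_smult_scalar linear_map_compose[OF e] CC_linear uv xy counit_closed)+)?)
          (use uv xy in \<open>simp_all add: CC_pure contract_pure counit_closed counit_C_pure e_pure
            smult_right smult_swap B'.smult_assoc1\<close>)
      then have "contract_right (\<Phi> (pAABB (pAA x y) (pBB u v))) = \<epsilon>B v \<odot>\<^bsub>AB\<^esub> pAB x (?e (\<sigma> (pAB y u)))"
        using xy uv by (simp add: \<Phi>_pure CC_pure)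
      also have "\<dots> = pAB x (?e (\<sigma> (pAB y (\<epsilon>B v \<odot>\<^bsub>B\<^esub> u))))"
        using xy uv linear_map_closed[OF e, of "\<sigma> (pAB y u)"]
        by (simp add: smult_right[symmetric] linear_map_smult[OF linear_\<sigma>] linear_map_smult[OF e]
            counit_closed CC_pure)
      finally show "contract_right (\<Phi> (pAABB (pAA x y) (pBB u v))) =
          pAB x (?e (\<sigma> (pAB y (?eB (pBB u v)))))"
        using uv by (simp add: eB_pure)
    qed
    then have "contract_right (\<Phi> (pAABB (pAA x y) (comult B \<one>\<^bsub>B\<^esub>))) = pAB x (?e (\<sigma> (pAB y \<one>\<^bsub>B\<^esub>)))"
      using linear_map_closed[OF linear_comult(2)] counit_one by simp
    also have "\<dots> = \<iota>A (\<epsilon>A y \<odot>\<^bsub>A\<^esub> x)"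
      using xy by (simp add: \<sigma>_one_right e_pure \<iota>A_def pure_tensor_balanced counit_closed modules)
    finally show ?thesis
      using xy by (simp add: eA_pure)
  qed
  have "\<forall>g\<in>carrier AA. contract_right (\<Phi> (pAABB g (comult B \<one>\<^bsub>B\<^esub>))) = \<iota>A (?eA g)"
    by (rule tensor_extI[where X = AB];
        ((rule linear_contract linear_map_compose[OF eA] CC_linear linear_map_closed[OF linear_comult(2)])+)?)
      (rule pure)
  then show ?thesis
    using g by blast
qed

lemma counit_comult_C:
  assumes c: "c \<in> carrier AB"
  shows "contract_left (comult C c) = c" "contract_right (comult C c) = c"
proof -
  have one: "comult C \<one>\<^bsub>C\<^esub> = \<Phi> (pAABB (comult A \<one>\<^bsub>A\<^esub>) (comult B \<one>\<^bsub>B\<^esub>))"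
    unfolding comult_C one_C by (rule cotensor_pure[OF linear_comult]) simp_all
  have cl: "comult A \<one>\<^bsub>A\<^esub> \<in> carrier AA" "comult B \<one>\<^bsub>B\<^esub> \<in> carrier BB" "comult C \<one>\<^bsub>C\<^esub> \<in> carrier CC"
    using linear_map_closed[OF linear_comult(1)] linear_map_closed[OF linear_comult(2)]
      linear_map_closed[OF linear_map_cotensor[OF linear_comult]] by (simp_all add: comult_C one_C CC_pure)
  have "contract_left (comult C \<one>\<^bsub>C\<^esub>) = \<one>\<^bsub>C\<^esub>" "contract_right (comult C \<one>\<^bsub>C\<^esub>) = \<one>\<^bsub>C\<^esub>"
    unfolding one using cl by (simp_all add: contract_left_\<Phi> contract_right_\<Phi> counit_one \<iota>A_one \<iota>B_one)
  then have "contract_left (rC c (comult C \<one>\<^bsub>C\<^esub>)) = c" "contract_right (lC c (comult C \<one>\<^bsub>C\<^esub>)) = c"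
    using contract_action[OF c] cl(3) C.l_one[of c] C.r_one[of c] c by (simp_all add: carrier_C)
  then show "contract_left (comult C c) = c" "contract_right (comult C c) = c"
    using C.bimodule_hom_one[OF bimodule_hom_comult_C, of c] c by (simp_all add: carrier_C)
qed

lemma frobenius_algebra_C: "frobenius_algebra k C"
proof -
  have lin: "linear_map k C (tensor k C C) (comult C)"
    using bimodule_hom_comult_C by (simp add: bimodule_hom_def)
  have "counital_coalgebra k C"
    unfolding counital_coalgebra_def
    using C.module_alg lin linear_functional_C C.bimodule_hom_coassociative[OF bimodule_hom_comult_C]
      counit_comult_C
    by (simp add: carrier_C contract_left_def contract_right_def)
  then show ?thesis
    using C.unital_algebra iffD1[OF C.bimodule_hom_iff_frobenius[OF lin] bimodule_hom_comult_C]
    unfolding frobenius_algebra_def by blast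
qed

end

section \<open>Separability sections\<close>

context twisting
begin

text \<open>An element of \<open>B\<close> crosses two elements of \<open>A\<close>, one after the
  other. The result is left in the bracketing \<open>A \<otimes> (A \<otimes> B)\<close>, the target
  of the projection \<open>\<Pi>B\<close>; for the same reason \<open>passB\<close> ends in
  \<open>(A \<otimes> B) \<otimes> B\<close>.\<close>

definition passA :: "('b, ('a, 'a) tens) tens \<Rightarrow> ('a, ('a, 'b) tens) tens" where
  "passA s = tensor_map k A AB id \<tau> (tensor_assoc k A B A (tensor_map k AB A \<tau> id (tensor_unassoc k B A A s)))"

definition passB :: "(('b, 'b) tens, 'a) tens \<Rightarrow> (('a, 'b) tens, 'b) tens" where
  "passB s = tensor_map k AB B \<tau> id (tensor_unassoc k B A B (tensor_map k B AB id \<tau> (tensor_assoc k B B A s)))"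

lemma linear_passA:
  "linear_map k X (tensor k B AA) h \<Longrightarrow> linear_map k X (tensor k A AB) (\<lambda>x. passA (h x))"
  unfolding passA_def by (rule linear_\<tau> twist_linear | assumption)+

lemma linear_passB:
  "linear_map k X (tensor k BB A) h \<Longrightarrow> linear_map k X (tensor k AB B) (\<lambda>x. passB (h x))"
  unfolding passB_def by (rule linear_\<tau> twist_linear | assumption)+

lemma passA_pure:
  assumes "b \<in> carrier B" "x \<in> carrier A" "y \<in> carrier A"
  shows "passA (pure_tensor k B AA b (pAA x y)) =
    tensor_map k A AB id \<tau> (tensor_assoc k A B A (pure_tensor k AB A (\<tau> (pBA b x)) y))"
  using assms by (simp add: passA_def twist_pure tensor_map_pure[OF linear_\<tau> linear_map_id])

lemma passB_pure:
  assumes "u \<in> carrier B" "v \<in> carrier B" "a \<in> carrier A"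
  shows "passB (pure_tensor k BB A (pBB u v) a) =
    tensor_map k AB B \<tau> id (tensor_unassoc k B A B (pure_tensor k B AB u (\<tau> (pBA v a))))"
  using assms by (simp add: passB_def twist_pure tensor_map_pure[OF linear_map_id linear_\<tau>])

definition mult_B :: "('b, ('a, 'b) tens) tens \<Rightarrow> ('a, 'b) tens" where
  "mult_B = tensor_lift AB (\<lambda>b c. \<iota>B b \<otimes>\<^bsub>C\<^esub> c)"

definition mult_A :: "(('a, 'b) tens, 'a) tens \<Rightarrow> ('a, 'b) tens" where
  "mult_A = tensor_lift AB (\<lambda>c a. c \<otimes>\<^bsub>C\<^esub> \<iota>A a)"

lemma bilinear_mult_B: "bilinear_map k B AB AB (\<lambda>b c. \<iota>B b \<otimes>\<^bsub>C\<^esub> c)"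
  by (rule bilinear_mapI; (rule twist_linear twist_closed | assumption)+)

lemma bilinear_mult_A: "bilinear_map k AB A AB (\<lambda>c a. c \<otimes>\<^bsub>C\<^esub> \<iota>A a)"
  by (rule bilinear_mapI; (rule twist_linear twist_closed | assumption)+)

lemma linear_mult_B: "linear_map k (tensor k B AB) AB mult_B"
  and linear_mult_A: "linear_map k (tensor k AB A) AB mult_A"
  unfolding mult_B_def mult_A_def
  by (rule linear_map_tensor_lift bilinear_mult_B bilinear_mult_A modules)+

lemma mult_B_pure: "b \<in> carrier B \<Longrightarrow> c \<in> carrier AB \<Longrightarrow> mult_B (pure_tensor k B AB b c) = \<iota>B b \<otimes>\<^bsub>C\<^esub> c"
  unfolding mult_B_def by (rule tensor_lift_pure_tensor[OF _ _ _ bilinear_mult_B]) (simp_all add: modules)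

lemma mult_A_pure: "a \<in> carrier A \<Longrightarrow> c \<in> carrier AB \<Longrightarrow> mult_A (pure_tensor k AB A c a) = c \<otimes>\<^bsub>C\<^esub> \<iota>A a"
  unfolding mult_A_def by (rule tensor_lift_pure_tensor[OF _ _ _ bilinear_mult_A]) (simp_all add: modules)

text \<open>\<open>\<Pi>B\<close> is the projection \<open>C \<otimes> C \<rightarrow> C \<otimes>\<^sub>B C \<cong> A \<otimes> C\<close>, and \<open>\<Pi>A\<close> is
  \<open>C \<otimes> C \<rightarrow> C \<otimes>\<^sub>A C \<cong> C \<otimes> B\<close>. They forget the factor \<open>\<Gamma>\<^sub>B\<close>, respectively \<open>\<Gamma>\<^sub>A\<close>, of the
  section of \<open>C\<close>, because this factor is a right inverse of the multiplication.\<close>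

definition \<Pi>B :: "(('a, 'b) tens, ('a, 'b) tens) tens \<Rightarrow> ('a, ('a, 'b) tens) tens" where
  "\<Pi>B z = tensor_map k A AB id mult_B (tensor_assoc k A B AB z)"

definition \<Pi>A :: "(('a, 'b) tens, ('a, 'b) tens) tens \<Rightarrow> (('a, 'b) tens, 'b) tens" where
  "\<Pi>A z = tensor_map k AB B mult_A id (tensor_unassoc k AB A B z)"

lemma linear_\<Pi>B: "linear_map k X CC h \<Longrightarrow> linear_map k X (tensor k A AB) (\<lambda>x. \<Pi>B (h x))"
  unfolding \<Pi>B_def by (rule linear_mult_B twist_linear | assumption)+

lemma linear_\<Pi>A: "linear_map k X CC h \<Longrightarrow> linear_map k X (tensor k AB B) (\<lambda>x. \<Pi>A (h x))"
  unfolding \<Pi>A_def by (rule linear_mult_A twist_linear | assumption)+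

lemma \<Pi>B_pure: "a \<in> carrier A \<Longrightarrow> b \<in> carrier B \<Longrightarrow> c \<in> carrier AB \<Longrightarrow>
    \<Pi>B (pCC (pAB a b) c) = pure_tensor k A AB a (\<iota>B b \<otimes>\<^bsub>C\<^esub> c)"
  by (simp add: \<Pi>B_def twist_pure tensor_map_pure[OF linear_map_id linear_mult_B] mult_B_pure)

lemma \<Pi>A_pure: "a \<in> carrier A \<Longrightarrow> b \<in> carrier B \<Longrightarrow> c \<in> carrier AB \<Longrightarrow>
    \<Pi>A (pCC c (pAB a b)) = pure_tensor k AB B (c \<otimes>\<^bsub>C\<^esub> \<iota>A a) b"
  by (simp add: \<Pi>A_def twist_pure tensor_map_pure[OF linear_mult_A linear_map_id] mult_A_pure)

lemma mult_pure_\<iota>A: "x \<in> carrier A \<Longrightarrow> b \<in> carrier B \<Longrightarrow> a \<in> carrier A \<Longrightarrow>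
    pAB x b \<otimes>\<^bsub>C\<^esub> \<iota>A a = outer x \<one>\<^bsub>B\<^esub> (\<tau> (pBA b a))"
  unfolding \<iota>A_def by (simp add: mult_C_pure)

lemma mult_\<iota>B_pure: "x \<in> carrier A \<Longrightarrow> b \<in> carrier B \<Longrightarrow> y \<in> carrier B \<Longrightarrow>
    \<iota>B b \<otimes>\<^bsub>C\<^esub> pAB x y = outer \<one>\<^bsub>A\<^esub> y (\<tau> (pBA b x))"
  unfolding \<iota>B_def by (simp add: mult_C_pure)

text \<open>Multiplying a component from \<open>B\<close> onto the next factor applies
  \<open>\<tau>\<close> to what \<open>\<sigma>\<close> has produced. The two cancel, and of the
  multiplication in \<open>C\<close> only the product \<open>u v\<close> in \<open>B\<close> is
  left.\<close>

lemma \<Pi>B_\<Phi>: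
  "\<forall>t\<in>carrier (tensor k AA BB). \<Pi>B (\<Phi> t) = tensor_assoc k A A B (tensor_map k AA B id (nabla B) t)"
proof (rule tensor_ext4I[where X = "tensor k A AB"]; ((rule linear_\<Pi>B linear_nabla_B CC_linear)+)?)
  fix x y u v assume c: "x \<in> carrier A" "y \<in> carrier A" "u \<in> carrier B" "v \<in> carrier B"
  have "\<forall>s\<in>carrier BA. \<Pi>B (J x v s) = pure_tensor k A AB x (outer \<one>\<^bsub>A\<^esub> v (\<tau> s))"
    by (rule tensor_extI[where X = "tensor k A AB"]; ((rule linear_\<Pi>B CC_linear c)+)?)
      (use c in \<open>simp_all add: CC_pure \<Pi>B_pure mult_\<iota>B_pure\<close>)
  then show "\<Pi>B (\<Phi> (pAABB (pAA x y) (pBB u v))) =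
      tensor_assoc k A A B (tensor_map k AA B id (nabla B) (pAABB (pAA x y) (pBB u v)))"
    using c by (simp add: \<Phi>_pure CC_pure \<tau>_\<sigma> tensor_map_pure[OF linear_map_id linear_nabla_B])
qed

lemma \<Pi>A_\<Phi>:
  "\<forall>t\<in>carrier (tensor k AA BB). \<Pi>A (\<Phi> t) = tensor_unassoc k A B B (tensor_map k A BB (nabla A) id t)"
proof (rule tensor_ext4I[where X = "tensor k AB B"]; ((rule linear_\<Pi>A linear_nabla_A CC_linear)+)?)
  fix x y u v assume c: "x \<in> carrier A" "y \<in> carrier A" "u \<in> carrier B" "v \<in> carrier B"
  have "\<forall>s\<in>carrier BA. \<Pi>A (J x v s) = pure_tensor k AB B (outer x \<one>\<^bsub>B\<^esub> (\<tau> s)) v"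
    by (rule tensor_extI[where X = "tensor k AB B"]; ((rule linear_\<Pi>A CC_linear c)+)?)
      (use c in \<open>simp_all add: CC_pure \<Pi>A_pure mult_pure_\<iota>A\<close>)
  then show "\<Pi>A (\<Phi> (pAABB (pAA x y) (pBB u v))) =
      tensor_unassoc k A B B (tensor_map k A BB (nabla A) id (pAABB (pAA x y) (pBB u v)))"
    using c by (simp add: \<Phi>_pure CC_pure \<tau>_\<sigma> tensor_map_pure[OF linear_nabla_A linear_map_id])
qed

text \<open>Left multiplication by \<open>b\<close> descends to the balanced tensor product, which
  is what \<open>\<Xi>\<close> expresses. Two properties of the induced map are used later: that it
  is induced, and its effect on a tensor from \<open>A \<otimes> A\<close> followed by the unit of
  \<open>B\<close>.\<close>

lemma \<Pi>B_left_action: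
  assumes b: "b \<in> carrier B"
  obtains \<Xi> where "\<forall>z\<in>carrier CC. \<Pi>B (lC (\<iota>B b) z) = \<Xi> (\<Pi>B z)"
    and "\<forall>g\<in>carrier AA. \<Xi> (tensor_assoc k A A B (pure_tensor k AA B g \<one>\<^bsub>B\<^esub>)) = passA (pure_tensor k B AA b g)"
proof
  let ?X = "tensor k A AB"
  define \<Xi> where "\<Xi> = tensor_lift ?X (\<lambda>a c. \<Pi>B (pCC (\<tau> (pBA b a)) c))"
  have bil: "bilinear_map k A AB ?X (\<lambda>a c. \<Pi>B (pCC (\<tau> (pBA b a)) c))"
    by (rule bilinear_mapI; (rule linear_\<Pi>B twist_linear twist_closed b | assumption)+)
  have lin: "linear_map k ?X ?X \<Xi>"
    unfolding \<Xi>_def by (rule linear_map_tensor_lift[OF _ _ _ bil]) (simp_all add: modules)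
  have \<Xi>_pure: "\<Xi> (pure_tensor k A AB a c) = \<Pi>B (pCC (\<tau> (pBA b a)) c)"
    if "a \<in> carrier A" "c \<in> carrier AB" for a c
    unfolding \<Xi>_def by (rule tensor_lift_pure_tensor[OF _ _ _ bil]) (simp_all add: modules that)
  have inner: "\<Pi>B (lC (\<iota>B b) (pCC (pAB a b') c)) = \<Xi> (\<Pi>B (pCC (pAB a b') c))"
    if ab: "a \<in> carrier A" "b' \<in> carrier B" and c: "c \<in> carrier AB" for a b' c
  proof -
    \<comment> \<open>Balancing over \<open>B\<close>: under \<open>\<Pi>B\<close> the factor
      \<open>b'\<close> may move from the right of the first component to the left of the
      second.\<close>
    have "\<forall>s\<in>carrier AB. \<Pi>B (pCC (outer \<one>\<^bsub>A\<^esub> b' s) c) = \<Pi>B (pCC s (\<iota>B b' \<otimes>\<^bsub>C\<^esub> c))"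
      by (rule tensor_extI[where X = ?X]; ((rule linear_\<Pi>B CC_linear b ab c)+)?)
        (use ab c in \<open>simp_all add: CC_pure \<Pi>B_pure mult_C_assoc[symmetric] mult_\<iota>B_\<iota>B\<close>)
    then show ?thesis
      using ab b c by (simp add: CC_pure \<Pi>B_pure \<Xi>_pure mult_\<iota>B_pure)
  qed
  have inner': "\<forall>s\<in>carrier AB. \<Pi>B (lC (\<iota>B b) (pCC s c)) = \<Xi> (\<Pi>B (pCC s c))" if c: "c \<in> carrier AB" for c
    by (rule tensor_extI[where X = ?X];
        ((rule linear_map_compose[OF lin] linear_\<Pi>B CC_linear b c)+)?) (rule inner[OF _ _ c])
  show "\<forall>z\<in>carrier CC. \<Pi>B (lC (\<iota>B b) z) = \<Xi> (\<Pi>B z)"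
    by (rule tensor_extI[where X = ?X];
        ((rule linear_map_compose[OF lin] linear_\<Pi>B CC_linear b)+)?) (use inner' in blast)
  show "\<forall>g\<in>carrier AA. \<Xi> (tensor_assoc k A A B (pure_tensor k AA B g \<one>\<^bsub>B\<^esub>)) = passA (pure_tensor k B AA b g)"
  proof (rule tensor_extI[where X = ?X];
      ((rule linear_map_compose[OF lin] linear_passA linear_\<Pi>B CC_linear b)+)?)
    fix x y assume xy: "x \<in> carrier A" "y \<in> carrier A"
    \<comment> \<open>When the second component is \<open>y\<close> from \<open>A\<close>, the
      product inside \<open>\<Pi>B\<close> is itself a crossing, the second one of
      \<open>passA\<close>.\<close>
    have "\<forall>s\<in>carrier AB. \<Pi>B (pCC s (pAB y \<one>\<^bsub>B\<^esub>)) = tensor_map k A AB id \<tau> (tensor_assoc k A B A (pure_tensor k AB A s y))"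
      by (rule tensor_extI[where X = ?X]; ((rule linear_\<tau> linear_\<Pi>B CC_linear xy)+)?)
        (use xy in \<open>simp_all add: CC_pure \<Pi>B_pure mult_\<iota>B_pure outer_one
          tensor_map_pure[OF linear_map_id linear_\<tau>]\<close>)
    then show "\<Xi> (tensor_assoc k A A B (pure_tensor k AA B (pAA x y) \<one>\<^bsub>B\<^esub>)) = passA (pure_tensor k B AA b (pAA x y))"
      using xy b by (simp add: CC_pure \<Xi>_pure passA_pure)
  qed
qed

text \<open>The mirror image: \<open>\<Pi>A\<close> balances over \<open>A\<close>, so it is the
  right action of \<open>a\<close> that descends.\<close>

lemma \<Pi>A_right_action:
  assumes a: "a \<in> carrier A"
  obtains \<Xi> where "\<forall>z\<in>carrier CC. \<Pi>A (rC (\<iota>A a) z) = \<Xi> (\<Pi>A z)"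
    and "\<forall>h\<in>carrier BB. \<Xi> (tensor_unassoc k A B B (pure_tensor k A BB \<one>\<^bsub>A\<^esub> h)) = passB (pure_tensor k BB A h a)"
proof
  let ?X = "tensor k AB B"
  define \<Xi> where "\<Xi> = tensor_lift ?X (\<lambda>c b. \<Pi>A (pCC c (\<tau> (pBA b a))))"
  have bil: "bilinear_map k AB B ?X (\<lambda>c b. \<Pi>A (pCC c (\<tau> (pBA b a))))"
    by (rule bilinear_mapI; (rule linear_\<Pi>A twist_linear twist_closed a | assumption)+)
  have lin: "linear_map k ?X ?X \<Xi>"
    unfolding \<Xi>_def by (rule linear_map_tensor_lift[OF _ _ _ bil]) (simp_all add: modules)
  have \<Xi>_pure: "\<Xi> (pure_tensor k AB B c b) = \<Pi>A (pCC c (\<tau> (pBA b a)))"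
    if "b \<in> carrier B" "c \<in> carrier AB" for b c
    unfolding \<Xi>_def by (rule tensor_lift_pure_tensor[OF _ _ _ bil]) (simp_all add: modules that)
  have inner: "\<Pi>A (rC (\<iota>A a) (pCC c (pAB a' b))) = \<Xi> (\<Pi>A (pCC c (pAB a' b)))"
    if ab: "a' \<in> carrier A" "b \<in> carrier B" and c: "c \<in> carrier AB" for a' b c
  proof -
    have "\<forall>s\<in>carrier AB. \<Pi>A (pCC c (outer a' \<one>\<^bsub>B\<^esub> s)) = \<Pi>A (pCC (c \<otimes>\<^bsub>C\<^esub> \<iota>A a') s)"
      by (rule tensor_extI[where X = ?X]; ((rule linear_\<Pi>A CC_linear a ab c)+)?)
        (use ab c in \<open>simp_all add: CC_pure \<Pi>A_pure mult_C_assoc mult_\<iota>A_\<iota>A\<close>)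
    then show ?thesis
      using ab a c by (simp add: CC_pure \<Pi>A_pure \<Xi>_pure mult_pure_\<iota>A)
  qed
  have inner': "\<forall>s\<in>carrier AB. \<Pi>A (rC (\<iota>A a) (pCC c s)) = \<Xi> (\<Pi>A (pCC c s))" if c: "c \<in> carrier AB" for c
    by (rule tensor_extI[where X = ?X];
        ((rule linear_map_compose[OF lin] linear_\<Pi>A CC_linear a c)+)?) (rule inner[OF _ _ c])
  show "\<forall>z\<in>carrier CC. \<Pi>A (rC (\<iota>A a) z) = \<Xi> (\<Pi>A z)"
    by (rule tensor_extI[where X = ?X];
        ((rule linear_map_compose[OF lin] linear_\<Pi>A CC_linear a)+)?) (use inner' in blast)
  show "\<forall>h\<in>carrier BB. \<Xi> (tensor_unassoc k A B B (pure_tensor k A BB \<one>\<^bsub>A\<^esub> h)) = passB (pure_tensor k BB A h a)"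
  proof (rule tensor_extI[where X = ?X];
      ((rule linear_map_compose[OF lin] linear_passB linear_\<Pi>A CC_linear a)+)?)
    fix u v assume uv: "u \<in> carrier B" "v \<in> carrier B"
    have "\<forall>s\<in>carrier AB. \<Pi>A (pCC (pAB \<one>\<^bsub>A\<^esub> u) s) = tensor_map k AB B \<tau> id (tensor_unassoc k B A B (pure_tensor k B AB u s))"
      by (rule tensor_extI[where X = ?X]; ((rule linear_\<tau> linear_\<Pi>A CC_linear uv)+)?)
        (use uv in \<open>simp_all add: CC_pure \<Pi>A_pure mult_pure_\<iota>A outer_one
          tensor_map_pure[OF linear_\<tau> linear_map_id]\<close>)
    then show "\<Xi> (tensor_unassoc k A B B (pure_tensor k A BB \<one>\<^bsub>A\<^esub> (pBB u v))) = passB (pure_tensor k BB A (pBB u v) a)"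
      using uv a by (simp add: CC_pure \<Xi>_pure passB_pure)
  qed
qed

end

section \<open>The section formed from the sections of the factors\<close>

locale section_twisting = twisting k A B \<tau>
  for k :: "('k, 'r) ring_scheme" and A :: "('k, 'a, 'm) frobenius_scheme"
    and B :: "('k, 'b, 'n) frobenius_scheme" and \<tau> :: "('b, 'a) tens \<Rightarrow> ('a, 'b) tens" +
  fixes \<Gamma>A :: "'a \<Rightarrow> ('a, 'a) tens" and \<Gamma>B :: "'b \<Rightarrow> ('b, 'b) tens"
  assumes section_A: "separability_section k A \<Gamma>A" and section_B: "separability_section k B \<Gamma>B"
begin

abbreviation "\<Gamma>C \<equiv> twisted_cotensor k A B \<tau> \<Gamma>A \<Gamma>B"

lemma bimodule_hom_\<Gamma>: "bimodule_hom k A \<Gamma>A" "bimodule_hom k B \<Gamma>B"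
  and nabla_\<Gamma>: "a \<in> carrier A \<Longrightarrow> nabla A (\<Gamma>A a) = a" "b \<in> carrier B \<Longrightarrow> nabla B (\<Gamma>B b) = b"
  using section_A section_B by (simp_all add: A.separability_section_iff B.separability_section_iff)

lemma linear_\<Gamma>: "linear_map k A AA \<Gamma>A" "linear_map k B BB \<Gamma>B"
  using bimodule_hom_\<Gamma> by (simp_all add: bimodule_hom_def)

lemmas \<Gamma>_closed = linear_map_closed[OF linear_\<Gamma>(1)] linear_map_closed[OF linear_\<Gamma>(2)]

lemmas linear_\<Gamma>C = linear_map_cotensor[OF linear_\<Gamma>]

lemma \<Gamma>C_pure: "a \<in> carrier A \<Longrightarrow> b \<in> carrier B \<Longrightarrow> \<Gamma>C (pAB a b) = \<Phi> (pAABB (\<Gamma>A a) (\<Gamma>B b))"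
  by (rule cotensor_pure[OF linear_\<Gamma>])

text \<open>Multiplication in \<open>C\<close> applies \<open>\<tau>\<close> to the middle pair and
  so undoes \<open>\<sigma>\<close>; what remains is multiplication in each factor. The right
  inverse property therefore holds in any case, and the equivalence is about the bimodule
  property.\<close>

lemma nabla_\<Gamma>C: "\<forall>c\<in>carrier AB. nabla C (\<Gamma>C c) = c"
proof -
  have \<Phi>: "\<forall>t\<in>carrier (tensor k AA BB). nabla C (\<Phi> t) = tensor_map k A B (nabla A) (nabla B) t"
  proof (rule tensor_ext4I[where X = AB]; ((rule linear_nabla_A linear_nabla_B CC_linear)+)?)
    fix x y u v assume c: "x \<in> carrier A" "y \<in> carrier A" "u \<in> carrier B" "v \<in> carrier B"
    have "\<forall>s\<in>carrier BA. nabla C (J x v s) = outer x v (\<tau> s)"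
      by (rule tensor_extI[where X = AB]; ((rule CC_linear c)+)?)
        (use c in \<open>simp_all add: CC_pure mult_C_pure\<close>)
    then show "nabla C (\<Phi> (pAABB (pAA x y) (pBB u v))) =
        tensor_map k A B (nabla A) (nabla B) (pAABB (pAA x y) (pBB u v))"
      using c by (simp add: \<Phi>_pure CC_pure \<tau>_\<sigma> tensor_map_pure[OF linear_nabla_A linear_nabla_B])
  qed
  show ?thesis
    by (rule tensor_extI[where X = AB]; ((rule linear_map_compose[OF linear_\<Gamma>C] CC_linear)+)?)
      (simp_all add: \<Gamma>C_pure \<Phi> \<Gamma>_closed modules pure_tensor_closed nabla_\<Gamma>
        tensor_map_pure[OF linear_nabla_A linear_nabla_B])
qed

lemma separability_section_\<Gamma>C_iff: "separability_section k C \<Gamma>C \<longleftrightarrow> bimodule_hom k C \<Gamma>C"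
  using nabla_\<Gamma>C by (simp add: C.separability_section_iff carrier_C)

lemma \<Pi>B_\<Gamma>C: "\<forall>s\<in>carrier AB. \<Pi>B (\<Gamma>C s) = tensor_assoc k A A B (tensor_map k AA B \<Gamma>A id s)"
  by (rule tensor_extI[where X = "tensor k A AB"];
      ((rule linear_map_compose[OF linear_\<Gamma>C] linear_\<Pi>B linear_\<Gamma> CC_linear)+)?)
    (simp_all add: \<Gamma>C_pure \<Pi>B_\<Phi> \<Gamma>_closed modules pure_tensor_closed nabla_\<Gamma>
      tensor_map_pure[OF linear_map_id linear_nabla_B] tensor_map_pure[OF linear_\<Gamma>(1) linear_map_id])

lemma \<Pi>A_\<Gamma>C: "\<forall>s\<in>carrier AB. \<Pi>A (\<Gamma>C s) = tensor_unassoc k A B B (tensor_map k A BB id \<Gamma>B s)"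
  by (rule tensor_extI[where X = "tensor k AB B"];
      ((rule linear_map_compose[OF linear_\<Gamma>C] linear_\<Pi>A linear_\<Gamma> CC_linear)+)?)
    (simp_all add: \<Gamma>C_pure \<Pi>A_\<Phi> \<Gamma>_closed modules pure_tensor_closed nabla_\<Gamma>
      tensor_map_pure[OF linear_nabla_A linear_map_id] tensor_map_pure[OF linear_map_id linear_\<Gamma>(2)])

text \<open>The product is taken with \<open>\<iota>A a\<close> because the projection of
  \<open>\<Gamma>C\<close> there is \<open>\<Gamma>A a\<close> followed by the unit of
  \<open>B\<close>, the form on which \<open>\<Xi>\<close> is known to be
  \<open>passA\<close>.\<close>

lemma passA_\<Gamma>A:
  assumes hom: "bimodule_hom k C \<Gamma>C" and b: "b \<in> carrier B" and a: "a \<in> carrier A"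
  shows "passA (pure_tensor k B AA b (\<Gamma>A a)) = tensor_assoc k A A B (tensor_map k AA B \<Gamma>A id (\<tau> (pBA b a)))"
proof -
  obtain \<Xi> where \<Xi>: "\<forall>z\<in>carrier CC. \<Pi>B (lC (\<iota>B b) z) = \<Xi> (\<Pi>B z)"
    "\<forall>g\<in>carrier AA. \<Xi> (tensor_assoc k A A B (pure_tensor k AA B g \<one>\<^bsub>B\<^esub>)) = passA (pure_tensor k B AA b g)"
    using \<Pi>B_left_action[OF b] .
  have "\<Gamma>C (\<tau> (pBA b a)) = lC (\<iota>B b) (\<Gamma>C (\<iota>A a))"
    using hom a b by (simp add: bimodule_hom_def carrier_C \<iota>A_closed \<iota>B_closed flip: mult_\<iota>B_\<iota>A)
  then have "\<Pi>B (\<Gamma>C (\<tau> (pBA b a))) = \<Xi> (\<Pi>B (\<Gamma>C (\<iota>A a)))"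
    using \<Xi>(1) linear_map_closed[OF linear_\<Gamma>C \<iota>A_closed[OF a]] by simp
  also have "\<Pi>B (\<Gamma>C (\<iota>A a)) = tensor_assoc k A A B (pure_tensor k AA B (\<Gamma>A a) \<one>\<^bsub>B\<^esub>)"
    using a by (simp add: \<Pi>B_\<Gamma>C \<iota>A_closed)
      (simp add: \<iota>A_def tensor_map_pure[OF linear_\<Gamma>(1) linear_map_id] modules)
  finally show ?thesis
    using \<Xi>(2) a b by (simp add: \<Pi>B_\<Gamma>C twist_pure \<Gamma>_closed)
qed

lemma passB_\<Gamma>B:
  assumes hom: "bimodule_hom k C \<Gamma>C" and b: "b \<in> carrier B" and a: "a \<in> carrier A"
  shows "passB (pure_tensor k BB A (\<Gamma>B b) a) = tensor_unassoc k A B B (tensor_map k A BB id \<Gamma>B (\<tau> (pBA b a)))"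
proof -
  obtain \<Xi> where \<Xi>: "\<forall>z\<in>carrier CC. \<Pi>A (rC (\<iota>A a) z) = \<Xi> (\<Pi>A z)"
    "\<forall>h\<in>carrier BB. \<Xi> (tensor_unassoc k A B B (pure_tensor k A BB \<one>\<^bsub>A\<^esub> h)) = passB (pure_tensor k BB A h a)"
    using \<Pi>A_right_action[OF a] .
  have "\<Gamma>C (\<iota>B b \<otimes>\<^bsub>C\<^esub> \<iota>A a) = rC (\<iota>A a) (\<Gamma>C (\<iota>B b))"
    using hom a b unfolding bimodule_hom_def carrier_C by (blast intro: \<iota>A_closed \<iota>B_closed)
  then have "\<Pi>A (\<Gamma>C (\<tau> (pBA b a))) = \<Xi> (\<Pi>A (\<Gamma>C (\<iota>B b)))"
    using \<Xi>(1) linear_map_closed[OF linear_\<Gamma>C \<iota>B_closed[OF b]] a b by (simp add: mult_\<iota>B_\<iota>A)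
  also have "\<Pi>A (\<Gamma>C (\<iota>B b)) = tensor_unassoc k A B B (pure_tensor k A BB \<one>\<^bsub>A\<^esub> (\<Gamma>B b))"
    using b by (simp add: \<Pi>A_\<Gamma>C \<iota>B_closed)
      (simp add: \<iota>B_def tensor_map_pure[OF linear_map_id linear_\<Gamma>(2)] modules)
  finally show ?thesis
    using \<Xi>(2) a b by (simp add: \<Pi>A_\<Gamma>C twist_pure \<Gamma>_closed)
qed

text \<open>In the square the crossings of \<open>u\<close> with the first component and of
  \<open>v\<close> with the second involve disjoint factors. Hence the square can be regrouped so
  that \<open>v\<close> crosses both components of \<open>\<Gamma>A a\<close> before
  \<open>u\<close> does. The hypothesis, used once for \<open>v\<close> and once for
  \<open>u\<close>, replaces each double crossing by a single one performed before
  \<open>\<Gamma>A\<close>.\<close>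

lemma sq_passes:
  assumes passA: "\<And>b a. b \<in> carrier B \<Longrightarrow> a \<in> carrier A \<Longrightarrow> passA (pure_tensor k B AA b (\<Gamma>A a)) =
      tensor_assoc k A A B (tensor_map k AA B \<Gamma>A id (\<tau> (pBA b a)))"
    and a: "a \<in> carrier A"
  shows "\<forall>h\<in>carrier BB. sq (pBBAA h (\<Gamma>A a)) =
    tensor_map k AA BB \<Gamma>A id (tensor_assoc k A B B (passB (pure_tensor k BB A h a)))"
proof (rule tensor_extI[where X = "tensor k AA BB"];
    ((rule linear_\<Gamma> linear_passB CC_linear \<Gamma>_closed a)+)?)
  fix u v assume uv: "u \<in> carrier B" "v \<in> carrier B"
  let ?X = "tensor k AA BB"
  let ?mid = "tensor_middle k A B A B \<tau>"
  note lin_mid = linear_map_tensor_middle[OF _ _ _ _ linear_\<tau>]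
  define pass where "pass = (\<lambda>g. tensor_unassoc k A A B (passA (pure_tensor k B AA u g)))"
  have pass: "linear_map k AA (tensor k AA B) pass"
    unfolding pass_def by (rule linear_passA CC_linear uv)+
  \<comment> \<open>The second half of the regrouped square: \<open>u\<close> crosses
    \<open>x \<otimes> y\<close>, while \<open>b\<close>, the outcome of the first half, waits on
    the right.\<close>
  define Z where "Z = (\<lambda>w. tensor_assoc k AA B B (tensor_map k (tensor k AA B) B pass id (tensor_unassoc k A A B w)))"
  have Z: "linear_map k (tensor k A AB) ?X Z"
    unfolding Z_def by (rule pass CC_linear)+
  have Z_pure: "Z (pure_tensor k A AB x (pAB y b)) = tensor_assoc k AA B B (pure_tensor k (tensor k AA B) B (pass (pAA x y)) b)"
    if "x \<in> carrier A" "y \<in> carrier A" "b \<in> carrier B" for x y b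
    using that by (simp add: Z_def CC_pure tensor_map_pure[OF pass linear_map_id])
  \<comment> \<open>The facts \<open>r\<close>, \<open>p\<close>, \<open>q\<close> and
    \<open>s\<close> generalise the four values of \<open>\<tau>\<close> to arbitrary tensors, from
    the last crossing back to the first.\<close>
  have r: "\<forall>r\<in>carrier AB. tensor_insert k A B A B a1 b2 r =
      tensor_assoc k AA B B (pure_tensor k (tensor k AA B) B (tensor_unassoc k A A B (pure_tensor k A AB a1 r)) b2)"
    if "a1 \<in> carrier A" "b2 \<in> carrier B" for a1 b2
    by (rule tensor_extI[where X = ?X]; ((rule CC_linear that)+)?) (use that in \<open>simp_all add: CC_pure\<close>)
  have p: "\<forall>p\<in>carrier AB. ?mid (pCC p (pAB a2 b2)) =
      tensor_assoc k AA B B (pure_tensor k (tensor k AA B) B (tensor_unassoc k A A B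
        (tensor_map k A AB id \<tau> (tensor_assoc k A B A (pure_tensor k AB A p a2)))) b2)"
    if "a2 \<in> carrier A" "b2 \<in> carrier B" for a2 b2
    by (rule tensor_extI[where X = ?X]; ((rule lin_mid linear_\<tau> CC_linear that)+)?)
      (use that in \<open>simp_all add: CC_pure tensor_middle_pure[OF _ _ _ _ linear_\<tau>] r
        tensor_map_pure[OF linear_map_id linear_\<tau>]\<close>)
  have q: "\<forall>q\<in>carrier AB. ?mid (pCC (\<tau> (pBA u a')) q) = Z (pure_tensor k A AB a' q)"
    if "a' \<in> carrier A" for a'
    by (rule tensor_extI[where X = ?X]; ((rule linear_map_compose[OF Z] lin_mid CC_linear that uv)+)?)
      (use that uv in \<open>simp_all add: CC_pure p Z_pure pass_def passA_pure\<close>)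
  have s: "\<forall>s\<in>carrier AB. ?mid (tensor_map k AB AB \<tau> \<tau> (tensor_insert k B B A A u y s)) =
      Z (tensor_map k A AB id \<tau> (tensor_assoc k A B A (pure_tensor k AB A s y)))"
    if "y \<in> carrier A" for y
    by (rule tensor_extI[where X = ?X]; ((rule linear_map_compose[OF Z] linear_\<tau> lin_mid CC_linear that uv)+)?)
      (use that uv in \<open>simp_all add: CC_pure q tensor_map_pure[OF linear_map_id linear_\<tau>]
        tensor_map_pure[OF linear_\<tau> linear_\<tau>]\<close>)
  have "\<forall>g\<in>carrier AA. sq (pBBAA (pBB u v) g) = Z (passA (pure_tensor k B AA v g))"
    by (rule tensor_extI[where X = ?X]; ((rule linear_map_compose[OF Z] linear_passA CC_linear uv)+)?)
      (use uv in \<open>simp_all add: CC_pure twist_square_def tensor_middle_pure[OF _ _ _ _ linear_\<tau>] s passA_pure\<close>)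
  \<comment> \<open>First use of the hypothesis, for \<open>v\<close> crossing
    \<open>\<Gamma>A a\<close>.\<close>
  then have "sq (pBBAA (pBB u v) (\<Gamma>A a)) = Z (tensor_assoc k A A B (tensor_map k AA B \<Gamma>A id (\<tau> (pBA v a))))"
    using a uv by (simp add: \<Gamma>_closed passA)
  also have "\<dots> = tensor_map k AA BB \<Gamma>A id (tensor_assoc k A B B
      (tensor_map k AB B \<tau> id (tensor_unassoc k B A B (pure_tensor k B AB u (\<tau> (pBA v a))))))"
  proof -
    have t: "\<forall>s\<in>carrier AB. tensor_assoc k AA B B (pure_tensor k (tensor k AA B) B (tensor_map k AA B \<Gamma>A id s) b) =
        tensor_map k AA BB \<Gamma>A id (tensor_assoc k A B B (pure_tensor k AB B s b))"
      if "b \<in> carrier B" for b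
      by (rule tensor_extI[where X = ?X]; ((rule linear_\<Gamma> CC_linear that)+)?)
        (use that in \<open>simp_all add: CC_pure \<Gamma>_closed tensor_map_pure[OF linear_\<Gamma>(1) linear_map_id]\<close>)
    have "\<forall>s\<in>carrier AB. Z (tensor_assoc k A A B (tensor_map k AA B \<Gamma>A id s)) =
        tensor_map k AA BB \<Gamma>A id (tensor_assoc k A B B
          (tensor_map k AB B \<tau> id (tensor_unassoc k B A B (pure_tensor k B AB u s))))"
    proof (rule tensor_extI[where X = ?X];
        ((rule linear_map_compose[OF Z] linear_\<Gamma> linear_\<tau> CC_linear uv)+)?)
      fix x b assume c: "x \<in> carrier A" "b \<in> carrier B"
      have "tensor_map k AA B \<Gamma>A id (\<tau> (pBA u x)) \<in> carrier (tensor k AA B)"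
        using c uv by (intro linear_map_closed[OF linear_map_tensor_map[OF linear_\<Gamma>(1) linear_map_id _ _ _ _ linear_\<tau>]])
          (simp_all add: modules pure_tensor_closed)
      \<comment> \<open>Second use, for \<open>u\<close>; here \<open>x\<close> stands for the
        component in \<open>A\<close> left by the crossing of \<open>v\<close> with
        \<open>a\<close>.\<close>
      then have "pass (\<Gamma>A x) = tensor_map k AA B \<Gamma>A id (\<tau> (pBA u x))"
        using c uv tensor_unassoc_assoc[of k A A B] by (simp add: pass_def passA modules)
      moreover have "pure_tensor k AA B (\<Gamma>A x) b \<in> carrier (tensor k AA B)"
        using c by (simp add: modules pure_tensor_closed \<Gamma>_closed)
      ultimately show "Z (tensor_assoc k A A B (tensor_map k AA B \<Gamma>A id (pAB x b))) =
          tensor_map k AA BB \<Gamma>A id (tensor_assoc k A B B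
            (tensor_map k AB B \<tau> id (tensor_unassoc k B A B (pure_tensor k B AB u (pAB x b)))))"
        using c uv tensor_unassoc_assoc[of k A A B]
        by (simp add: Z_def tensor_map_pure[OF linear_\<Gamma>(1) linear_map_id] tensor_map_pure[OF pass linear_map_id]
            tensor_map_pure[OF linear_\<tau> linear_map_id] t \<Gamma>_closed CC_pure)
    qed
    then show ?thesis
      using uv a by (simp add: twist_pure)
  qed
  finally show "sq (pBBAA (pBB u v) (\<Gamma>A a)) =
    tensor_map k AA BB \<Gamma>A id (tensor_assoc k A B B (passB (pure_tensor k BB A (pBB u v) a)))"
    using uv a by (simp add: passB_pure)
qed

text \<open>Once \<open>\<Gamma>A\<close> has been pulled out of the square,
  \<open>\<Gamma>B b\<close> crosses the single element \<open>a\<close>. The second hypothesis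
  turns this into \<open>1 \<otimes> \<Gamma>B\<close> after \<open>\<tau>\<close>, and the two maps
  combine to \<open>\<Gamma>A \<otimes> \<Gamma>B\<close>.\<close>

lemma \<Gamma>_square:
  assumes passA: "\<And>b a. b \<in> carrier B \<Longrightarrow> a \<in> carrier A \<Longrightarrow> passA (pure_tensor k B AA b (\<Gamma>A a)) =
      tensor_assoc k A A B (tensor_map k AA B \<Gamma>A id (\<tau> (pBA b a)))"
    and passB: "\<And>b a. b \<in> carrier B \<Longrightarrow> a \<in> carrier A \<Longrightarrow> passB (pure_tensor k BB A (\<Gamma>B b) a) =
      tensor_unassoc k A B B (tensor_map k A BB id \<Gamma>B (\<tau> (pBA b a)))"
    and t: "t \<in> carrier BA"
  shows "tensor_map k AA BB \<Gamma>A \<Gamma>B (\<tau> t) = sq (tensor_map k BB AA \<Gamma>B \<Gamma>A t)"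
proof -
  let ?X = "tensor k AA BB"
  have split: "\<forall>s\<in>carrier AB. tensor_map k AA BB \<Gamma>A id (tensor_map k A BB id \<Gamma>B s) = tensor_map k AA BB \<Gamma>A \<Gamma>B s"
    by (rule tensor_extI[where X = ?X]; ((rule linear_\<Gamma> CC_linear)+)?)
      (simp_all add: CC_pure \<Gamma>_closed tensor_map_pure[OF linear_\<Gamma>(1) linear_map_id]
        tensor_map_pure[OF linear_map_id linear_\<Gamma>(2)] tensor_map_pure[OF linear_\<Gamma>])
  have "\<forall>t\<in>carrier BA. tensor_map k AA BB \<Gamma>A \<Gamma>B (\<tau> t) = sq (tensor_map k BB AA \<Gamma>B \<Gamma>A t)"
  proof (rule tensor_extI[where X = ?X]; ((rule linear_\<Gamma> CC_linear)+)?)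
    fix b a assume c: "b \<in> carrier B" "a \<in> carrier A"
    have cl: "tensor_map k A BB id \<Gamma>B (\<tau> (pBA b a)) \<in> carrier (tensor k A BB)"
      using c by (intro linear_map_closed[OF linear_map_tensor_map[OF linear_map_id linear_\<Gamma>(2) _ _ _ _ linear_\<tau>]])
        (simp_all add: modules pure_tensor_closed)
    have "sq (tensor_map k BB AA \<Gamma>B \<Gamma>A (pBA b a)) = sq (pBBAA (\<Gamma>B b) (\<Gamma>A a))"
      using c by (simp add: tensor_map_pure[OF linear_\<Gamma>(2,1)] modules)
    also have "\<dots> = tensor_map k AA BB \<Gamma>A id (tensor_assoc k A B B (passB (pure_tensor k BB A (\<Gamma>B b) a)))"
      using sq_passes[OF passA c(2)] c \<Gamma>_closed(2) by blast
    also have "\<dots> = tensor_map k AA BB \<Gamma>A \<Gamma>B (\<tau> (pBA b a))"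
      using c cl tensor_assoc_unassoc[of k A B B] split by (simp add: passB modules twist_pure)
    finally show "tensor_map k AA BB \<Gamma>A \<Gamma>B (\<tau> (pBA b a)) = sq (tensor_map k BB AA \<Gamma>B \<Gamma>A (pBA b a))"
      by simp
  qed
  then show ?thesis
    using t by blast
qed

text \<open>One direction goes through the projections, the other through the square. Both use the
  conditions in the bracketing of \<open>passA\<close> and \<open>passB\<close>; the version here
  differs by the associativity isomorphisms, moved across the equation as mutually inverse
  maps.\<close>

lemma bimodule_hom_\<Gamma>C_iff:
  "bimodule_hom k C \<Gamma>C \<longleftrightarrow>
    (\<forall>t\<in>carrier BA. tensor_map k AA B \<Gamma>A id (\<tau> t) =
      tensor_unassoc k A A B (passA (tensor_map k B AA id \<Gamma>A t))) \<and>
    (\<forall>t\<in>carrier BA. tensor_map k A BB id \<Gamma>B (\<tau> t) =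
      tensor_assoc k A B B (passB (tensor_map k BB A \<Gamma>B id t)))"
    (is "?L \<longleftrightarrow> ?RA \<and> ?RB")
proof -
  have cl: "tensor_map k A BB id \<Gamma>B (\<tau> (pBA b a)) \<in> carrier (tensor k A BB)"
    "tensor_map k AA B \<Gamma>A id (\<tau> (pBA b a)) \<in> carrier (tensor k AA B)"
    "passA (pure_tensor k B AA b (\<Gamma>A a)) \<in> carrier (tensor k A AB)"
    "passB (pure_tensor k BB A (\<Gamma>B b) a) \<in> carrier (tensor k AB B)"
    if c: "b \<in> carrier B" "a \<in> carrier A" for a b
    using c linear_map_closed[OF linear_map_tensor_map[OF linear_map_id linear_\<Gamma>(2) _ _ _ _ linear_\<tau>]]
      linear_map_closed[OF linear_map_tensor_map[OF linear_\<Gamma>(1) linear_map_id _ _ _ _ linear_\<tau>]]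
      linear_map_closed[OF linear_passA[OF linear_map_ident]]
      linear_map_closed[OF linear_passB[OF linear_map_ident]]
    by (simp_all add: modules pure_tensor_closed \<Gamma>_closed)
  have pure: "tensor_map k B AA id \<Gamma>A (pBA b a) = pure_tensor k B AA b (\<Gamma>A a)"
    "tensor_map k BB A \<Gamma>B id (pBA b a) = pure_tensor k BB A (\<Gamma>B b) a"
    if c: "b \<in> carrier B" "a \<in> carrier A" for a b
    using c by (simp_all add: tensor_map_pure[OF linear_map_id linear_\<Gamma>(1)]
        tensor_map_pure[OF linear_\<Gamma>(2) linear_map_id] modules)
  show ?thesis
  proof
    assume L: ?L
    show "?RA \<and> ?RB"
    proof
      show ?RA
        by (rule tensor_extI[where X = "tensor k AA B"]; ((rule linear_\<Gamma> linear_passA CC_linear)+)?)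
          (use cl tensor_unassoc_assoc[of k A A B] in \<open>simp add: pure passA_\<Gamma>A[OF L] modules\<close>)
      show ?RB
        by (rule tensor_extI[where X = "tensor k A BB"]; ((rule linear_\<Gamma> linear_passB CC_linear)+)?)
          (use cl tensor_assoc_unassoc[of k A B B] in \<open>simp add: pure passB_\<Gamma>B[OF L] modules\<close>)
    qed
  next
    assume R: "?RA \<and> ?RB"
    have "passA (pure_tensor k B AA b (\<Gamma>A a)) = tensor_assoc k A A B (tensor_map k AA B \<Gamma>A id (\<tau> (pBA b a)))"
      and "passB (pure_tensor k BB A (\<Gamma>B b) a) = tensor_unassoc k A B B (tensor_map k A BB id \<Gamma>B (\<tau> (pBA b a)))"
      if c: "b \<in> carrier B" "a \<in> carrier A" for a b
      using R c cl(3,4)[OF c] tensor_assoc_unassoc[of k A A B] tensor_unassoc_assoc[of k A B B]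
      by (simp_all add: pure modules pure_tensor_closed)
    then show ?L
      by (intro bimodule_hom_cotensor bimodule_hom_\<Gamma> \<Gamma>_square)
  qed
qed

end

theorem corollary5p4:
  fixes k :: "('k, 'r) ring_scheme"
    and A :: "('k, 'a, 'm) frobenius_scheme"
    and B :: "('k, 'b, 'n) frobenius_scheme"
    and \<Gamma>A :: "'a \<Rightarrow> ('a, 'a) tens"
    and \<Gamma>B :: "'b \<Rightarrow> ('b, 'b) tens"
    and \<tau> :: "('b, 'a) tens \<Rightarrow> ('a, 'b) tens"
  assumes "field k"
    and "separable_frobenius_algebra k A"
    and "separable_frobenius_algebra k B"
    and "separability_section k A \<Gamma>A"
    and "separability_section k B \<Gamma>B"
    and "twisting_map k A B \<tau>"
    and "\<And>t. t \<in> carrier (tensor k B A) \<Longrightarrow>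
      tensor_map k (tensor k A A) (tensor k B B) (comult A) (comult B) (\<tau> t) =
      twist_square k A B \<tau> (tensor_map k (tensor k B B) (tensor k A A) (comult B) (comult A) t)"
  shows "(separable_frobenius_algebra k (twisted_tensor_product k A B \<tau>) \<and>
          separability_section k (twisted_tensor_product k A B \<tau>)
            (twisted_section k A B \<tau> \<Gamma>A \<Gamma>B)) \<longleftrightarrow>
    ((\<forall>t\<in>carrier (tensor k B A).
        tensor_map k (tensor k A A) B \<Gamma>A id (\<tau> t) =
        (tensor_unassoc k A A B \<circ> tensor_map k A (tensor k A B) id \<tau> \<circ> tensor_assoc k A B A \<circ>
         tensor_map k (tensor k A B) A \<tau> id \<circ> tensor_unassoc k B A A \<circ>
         tensor_map k B (tensor k A A) id \<Gamma>A) t) \<and>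
     (\<forall>t\<in>carrier (tensor k B A).
        tensor_map k A (tensor k B B) id \<Gamma>B (\<tau> t) =
        (tensor_assoc k A B B \<circ> tensor_map k (tensor k A B) B \<tau> id \<circ> tensor_unassoc k B A B \<circ>
         tensor_map k B (tensor k A B) id \<tau> \<circ> tensor_assoc k B B A \<circ>
         tensor_map k (tensor k B B) A \<Gamma>B id) t))"
proof -
  have algebras: "unital_algebra k A" "unital_algebra k B"
    and frobenius: "frobenius_algebra k A" "frobenius_algebra k B"
    using assms(2,3) by (simp_all add: separable_frobenius_algebra_def separable_algebra_def)
  interpret S: section_twisting k A B \<tau> \<Gamma>A \<Gamma>B
    by unfold_locales (use algebras assms in auto)
  interpret F: frobenius_twisting k A B \<tau>
    by unfold_locales (use frobenius assms(7) in auto)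
  \<comment> \<open>The Frobenius part on the left follows from the hypotheses, and a bimodule map
    \<open>\<Gamma>C\<close> is itself the witness of separability. So the left-hand side comes down
    to the bimodule property.\<close>
  have "separable_frobenius_algebra k (twisted_tensor_product k A B \<tau>) \<and>
      separability_section k (twisted_tensor_product k A B \<tau>) (twisted_section k A B \<tau> \<Gamma>A \<Gamma>B) \<longleftrightarrow>
      bimodule_hom k (twisted_tensor_product k A B \<tau>) S.\<Gamma>C"
    using F.frobenius_algebra_C S.C.unital_algebra S.separability_section_\<Gamma>C_iff
    unfolding separable_frobenius_algebra_def separable_algebra_def twisted_section_def by blast
  then show ?thesis
    unfolding S.bimodule_hom_\<Gamma>C_iff by (simp add: S.passA_def S.passB_def)
qed

end
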